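(* For all $n\geq1$ and all partitions $\lambda,\mu,\nu\vdash n$, $$c^\lambda_{\mu,\nu}(1)=a^\lambda_{\mu,\nu}\quad\text{and}\quad c^\lambda_{\mu,\nu}(0)=\widetilde a^\lambda_{\mu,\nu},$$ where $c^\lambda_{\mu,\nu}(1)$ and $c^\lambda_{\mu,\nu}(0)$ are the evaluations of the polynomial $c^\lambda_{\mu,\nu}(b)$ at $b=1$ and $b=0$.
   Context: For a partition $\lambda$, $|\lambda|$ is its size, $\ell(\lambda)$ its length, $\lambda\vdash n$ means $|\lambda|=n$, $m_i(\lambda)$ is the number of parts equal to $i$, and $z_\lambda=\prod_{i\geq1}m_i(\lambda)!\,i^{m_i(\lambda)}$. For variables $\mathbf{p}=(p_1,p_2,\dots)$ put $p_\lambda=p_{\lambda_1}p_{\lambda_2}\cdots$ (similarly for other sequences). Let $b$ be a formal parameter and $\alpha=b+1$. On symmetric functions over $\mathbb{Q}(\alpha)$ consider the scalar product $\langle p_\lambda,p_\mu\rangle_\alpha=\delta_{\lambda,\mu}z_\lambda\alpha^{\ell(\lambda)}$. $J^{(\alpha)}_\theta$ denotes the Jack polynomial in its integral normalization: the $J_\theta^{(\alpha)}$ are pairwise orthogonal for $\langle\cdot,\cdot\rangle_\alpha$; for $\theta\vdash n$, $J_\theta^{(\alpha)}$ is a linear combination of monomial symmetric functions $m_\mu$ with $\mu$ dominated by $\theta$, and the coefficient of $m_{[1^n]}$ in it is $n!$. Put $j^{(\alpha)}_\theta=\langle J^{(\alpha)}_\theta,J^{(\alpha)}_\theta\rangle_\alpha$.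 $J^{(\alpha)}_\theta(\mathbf{p})$ is $J^{(\alpha)}_\theta$ written as a polynomial in the power sums. For three independent sequences of variables $\mathbf{p},\mathbf{q},\mathbf{r}$, the $c^\lambda_{\mu,\nu}(b)$ are defined by $$\sum_{n\geq0}t^n\sum_{\theta\vdash n}\frac{1}{j^{(\alpha)}_\theta}J^{(\alpha)}_\theta(\mathbf{p})J^{(\alpha)}_\theta(\mathbf{q})J^{(\alpha)}_\theta(\mathbf{r})=1+\sum_{n\geq 1}t^n\sum_{\lambda,\mu,\nu\vdash n}\frac{c^\lambda_{\mu,\nu}(b)}{z_\lambda(1+b)^{\ell(\lambda)}}p_\lambda q_\mu r_\nu;$$ they are polynomials in $b$ with rational coefficients (Dołęga–Féray). A matching on $\mathcal{A}_n=\{1,\widehat{1},\dots,n,\widehat{n}\}$ is a set partition of $\mathcal{A}_n$ into pairs; it is bipartite if each pair has the form $\{i,\widehat{j}\}$. For two matchings $\delta_1,\delta_2$ on $\mathcal{A}_n$, $\Lambda(\delta_1,\delta_2)$ is the partition of $n$ whose parts are the half-sizes (half the numbers of vertices) of the connected components of the graph on $\mathcal{A}_n$ with edge set $\delta_1\cup\delta_2$. Given $\lambda\vdash n$, fix bipartite matchings $\delta_1,\delta_2$ on $\mathcal{A}_n$ with $\Lambda(\delta_1,\delta_2)=\lambda$. Then $a^\lambda_{\mu,\nu}$ is the number of matchings $\delta$ on $\mathcal{A}_n$ with $\Lambda(\delta_1,\delta)=\mu$ and $\Lambda(\delta,\delta_2)=\nu$, and $\widetilde a^\lambda_{\mu,\nu}$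 is the number of bipartite matchings $\delta$ with the same two properties. These numbers do not depend on the choice of $\delta_1,\delta_2$. *)

theory Defs
  imports
    "HOL-Computational_Algebra.Computational_Algebra"
    "HOL-Library.Poly_Mapping"
    "HOL-Library.Product_Plus"
    "HOL-Library.Multiset"
    "HOL-Library.Disjoint_Sets"
begin

section \<open>Partitions\<close>

text \<open>A partition is the multiset of its parts: its size is \<^term>\<open>sum_mset lam\<close>, its length is
  \<^term>\<open>size lam\<close>, and the number of parts equal to \<open>i\<close> is \<^term>\<open>count lam i\<close>.\<close>

definition partitions :: "nat \<Rightarrow> nat multiset set" where
  "partitions n = {lam. 0 \<notin># lam \<and> sum_mset lam = n}"

definition zee :: "nat multiset \<Rightarrow> nat" where
  "zee lam = (\<Prod>i\<in>set_mset lam. fact (count lam i) * i ^ count lam i)"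

definition parts_desc :: "nat multiset \<Rightarrow> nat list" where
  "parts_desc lam = rev (sorted_list_of_multiset lam)"

definition dominated :: "nat multiset \<Rightarrow> nat multiset \<Rightarrow> bool" where
  "dominated mu theta \<longleftrightarrow> sum_mset mu = sum_mset theta \<and>
     (\<forall>k. sum_list (take k (parts_desc mu)) \<le> sum_list (take k (parts_desc theta)))"

lemma finite_partitions: "finite (partitions n)"
proof (rule finite_subset)
  show "partitions n \<subseteq> mset ` {xs. set xs \<subseteq> {..n} \<and> length xs \<le> n}"
  proof
    fix lam assume lam: "lam \<in> partitions n"
    obtain xs where xs: "lam = mset xs" by (metis ex_mset)
    have nz: "0 \<notin> set xs" and s: "sum_list xs = n"
      using lam by (auto simp: partitions_def xs sum_mset_sum_list)
    have "length xs \<le> sum_list xs" using nz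
      by (induction xs) auto
    moreover have "set xs \<subseteq> {..n}" using s member_le_sum_list by fastforce
    ultimately show "lam \<in> mset ` {xs. set xs \<subseteq> {..n} \<and> length xs \<le> n}"
      using s xs by auto
  qed
  show "finite (mset ` {xs :: nat list. set xs \<subseteq> {..n} \<and> length xs \<le> n})"
    by (intro finite_imageI finite_lists_length_le) auto
qed

lemma partitions_0: "partitions 0 = {{#}}"
  by (auto simp: partitions_def) (metis multiset_nonemptyE)

lemma zee_pos:
  assumes "lam \<in> partitions n" shows "zee lam > 0"
  using assms by (auto simp: zee_def partitions_def intro!: prod_pos)
    (metis gr0I)


section \<open>Rational functions in the formal parameter\<close>

type_synonym ratfun = "rat poly fract"

definition b_par :: ratfun where
  "b_par = to_fract [:0, 1:]"

definition alpha :: ratfun where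
  "alpha = b_par + 1"

text \<open>\<open>has_value f x v\<close>: the rational function \<open>f\<close> of \<open>b\<close> is regular at \<open>b = x\<close>, with value \<open>v\<close>.
  For a polynomial this is the usual evaluation (\<open>has_value_poly\<close> below).\<close>

definition has_value :: "ratfun \<Rightarrow> rat \<Rightarrow> rat \<Rightarrow> bool" where
  "has_value f x v \<longleftrightarrow>
     (\<exists>p q. f = to_fract p / to_fract q \<and> poly q x \<noteq> 0 \<and> v = poly p x / poly q x)"

lemma has_value_unique:
  assumes "has_value f x v" "has_value f x w" shows "v = w"
proof -
  obtain p q where pq: "f = to_fract p / to_fract q" "poly q x \<noteq> 0" "v = poly p x / poly q x"
    using assms(1) by (auto simp: has_value_def)
  obtain r s where rs: "f = to_fract r / to_fract s" "poly s x \<noteq> 0" "w = poly r x / poly s x"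
    using assms(2) by (auto simp: has_value_def)
  have nz: "q \<noteq> 0" "s \<noteq> 0" using pq rs by auto
  have "to_fract (p * s) = to_fract (r * q)"
    using pq(1) rs(1) nz by (simp add: frac_eq_eq)
  hence "p * s = r * q" by (simp only: to_fract_eq_iff)
  hence "poly p x * poly s x = poly r x * poly q x" by (metis poly_mult)
  thus ?thesis using pq rs by (simp add: frac_eq_eq)
qed

lemma has_value_poly: "has_value (to_fract P) x v \<longleftrightarrow> v = poly P x"
proof -
  have "has_value (to_fract P) x (poly P x)"
    unfolding has_value_def by (rule exI[of _ P], rule exI[of _ 1]) simp
  thus ?thesis using has_value_unique by blast
qed

lemma alpha_nonzero: "alpha \<noteq> 0"
proof -
  have "alpha = to_fract ([:0, 1:] + 1)" by (simp add: alpha_def b_par_def)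
  also have "[:0, 1:] + 1 = ([:1, 1:] :: rat poly)" by (simp add: one_pCons)
  finally have "alpha = to_fract [:1, 1:]" .
  moreover have "to_fract [:1, 1 :: rat:] \<noteq> 0" by (subst to_fract_eq_0_iff) simp
  ultimately show ?thesis by metis
qed


section \<open>Symmetric functions\<close>

text \<open>The ring of symmetric functions over \<open>\<rat>(b)\<close> is the polynomial ring in the power sums
  \<open>p\<^sub>1, p\<^sub>2, \<dots>\<close>; the monomial \<open>p\<^sub>\<lambda>\<close> is \<open>Poly_Mapping.single \<lambda> 1\<close>, so that an element of the
  type below is a symmetric function written as a polynomial in the power sums. Multisets
  containing \<open>0\<close> play no role: only elements supported on partitions are considered.\<close>

type_synonym symfun = "nat multiset \<Rightarrow>\<^sub>0 ratfun"

definition scalar_prod :: "symfun \<Rightarrow> symfun \<Rightarrow> ratfun" where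
  "scalar_prod f g = (\<Sum>lam\<in>Poly_Mapping.keys f. \<Sum>mu\<in>Poly_Mapping.keys g.
     Poly_Mapping.lookup f lam * Poly_Mapping.lookup g mu *
     (if lam = mu then of_nat (zee lam) * alpha ^ size lam else 0))"

text \<open>Polynomials in the variables \<open>x\<^sub>0, x\<^sub>1, \<dots>\<close>: a monomial is its finitely supported exponent
  vector. \<open>in_vars N f\<close> is \<open>f(x\<^sub>0, \<dots>, x\<^sub>N\<^sub>-\<^sub>1)\<close>; an identity of symmetric functions is one that holds
  for every number \<open>N\<close> of variables.\<close>

type_synonym xpoly = "(nat \<Rightarrow>\<^sub>0 nat) \<Rightarrow>\<^sub>0 ratfun"

definition power_sum :: "nat \<Rightarrow> nat \<Rightarrow> xpoly" where
  "power_sum N k = (\<Sum>i<N. Poly_Mapping.single (Poly_Mapping.single i k) 1)"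

definition in_vars :: "nat \<Rightarrow> symfun \<Rightarrow> xpoly" where
  "in_vars N f = (\<Sum>lam\<in>Poly_Mapping.keys f.
     Poly_Mapping.single 0 (Poly_Mapping.lookup f lam) * (\<Prod>k\<in>#lam. power_sum N k))"

definition exponents :: "(nat \<Rightarrow>\<^sub>0 nat) \<Rightarrow> nat multiset" where
  "exponents e = image_mset (Poly_Mapping.lookup e) (mset_set (Poly_Mapping.keys e))"

definition monomial_sym :: "nat \<Rightarrow> nat multiset \<Rightarrow> xpoly" where
  "monomial_sym N mu =
     (\<Sum>e\<in>{e. Poly_Mapping.keys e \<subseteq> {..<N} \<and> exponents e = mu}. Poly_Mapping.single e 1)"

lemma finite_monomials: "finite {e. Poly_Mapping.keys e \<subseteq> {..<N} \<and> exponents e = mu}"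
proof -
  let ?S = "{e. Poly_Mapping.keys e \<subseteq> {..<N} \<and> exponents e = mu}"
  have "Poly_Mapping.lookup ` ?S \<subseteq>
      {h. \<forall>i. (i \<in> {..<N} \<longrightarrow> h i \<in> set_mset mu \<union> {0}) \<and> (i \<notin> {..<N} \<longrightarrow> h i = 0)}"
  proof (rule image_subsetI, intro CollectI allI conjI impI)
    fix e i assume e: "e \<in> ?S"
    show "Poly_Mapping.lookup e i \<in> set_mset mu \<union> {0}"
    proof (cases "i \<in> Poly_Mapping.keys e")
      case True
      hence "Poly_Mapping.lookup e i \<in># exponents e" by (simp add: exponents_def)
      thus ?thesis using e by simp
    qed (simp add: in_keys_iff)
    assume "i \<notin> {..<N}"
    hence "i \<notin> Poly_Mapping.keys e" using e by blast
    thus "Poly_Mapping.lookup e i = 0" by (simp add: in_keys_iff)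
  qed
  moreover have "finite {h :: nat \<Rightarrow> nat. \<forall>i. (i \<in> {..<N} \<longrightarrow> h i \<in> set_mset mu \<union> {0}) \<and>
      (i \<notin> {..<N} \<longrightarrow> h i = 0)}"
    by (rule finite_set_of_finite_funs) auto
  ultimately have "finite (Poly_Mapping.lookup ` ?S)" by (rule finite_subset)
  thus ?thesis by (rule finite_imageD) (auto simp: inj_on_def poly_mapping_eqI)
qed


section \<open>Jack polynomials in the integral normalization\<close>

text \<open>The defining properties of the family \<open>\<theta> \<mapsto> J\<^sub>\<theta>\<close>, which determine it on all partitions.
  \<open>u mu\<close> is the coefficient of \<open>m\<^sub>\<mu>\<close> in \<open>J\<^sub>\<theta>\<close>.\<close>

definition jack_family :: "(nat multiset \<Rightarrow> symfun) \<Rightarrow> bool" where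
  "jack_family J \<longleftrightarrow>
     (\<forall>n. \<forall>theta\<in>partitions n.
        Poly_Mapping.keys (J theta) \<subseteq> partitions n \<and>
        (\<exists>u. (\<forall>N. in_vars N (J theta) =
                 (\<Sum>mu\<in>{mu \<in> partitions n. dominated mu theta}.
                    Poly_Mapping.single 0 (u mu) * monomial_sym N mu)) \<and>
             u (replicate_mset n 1) = fact n)) \<and>
     (\<forall>m n. \<forall>theta\<in>partitions m. \<forall>xi\<in>partitions n.
        theta \<noteq> xi \<longrightarrow> scalar_prod (J theta) (J xi) = 0)"

definition jack_norm :: "(nat multiset \<Rightarrow> symfun) \<Rightarrow> nat multiset \<Rightarrow> ratfun" where
  "jack_norm J theta = scalar_prod (J theta) (J theta)"


section \<open>The coefficients $c^\lambda_{\mu,\nu}$\<close>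

text \<open>Polynomials in three sequences \<open>p, q, r\<close> of variables; the monomial \<open>p\<^sub>\<lambda> q\<^sub>\<mu> r\<^sub>\<nu>\<close> is
  \<open>Poly_Mapping.single (\<lambda>, \<mu>, \<nu>) 1\<close>.\<close>

type_synonym pqr_poly = "(nat multiset \<times> nat multiset \<times> nat multiset) \<Rightarrow>\<^sub>0 ratfun"

definition in_p :: "symfun \<Rightarrow> pqr_poly" where
  "in_p f = (\<Sum>lam\<in>Poly_Mapping.keys f. Poly_Mapping.single (lam, 0, 0) (Poly_Mapping.lookup f lam))"

definition in_q :: "symfun \<Rightarrow> pqr_poly" where
  "in_q f = (\<Sum>lam\<in>Poly_Mapping.keys f. Poly_Mapping.single (0, lam, 0) (Poly_Mapping.lookup f lam))"

definition in_r :: "symfun \<Rightarrow> pqr_poly" where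
  "in_r f = (\<Sum>lam\<in>Poly_Mapping.keys f. Poly_Mapping.single (0, 0, lam) (Poly_Mapping.lookup f lam))"

definition jack_series :: "(nat multiset \<Rightarrow> symfun) \<Rightarrow> pqr_poly fps" where
  "jack_series J = Abs_fps (\<lambda>n. \<Sum>theta\<in>partitions n.
     Poly_Mapping.single 0 (1 / jack_norm J theta) *
     in_p (J theta) * in_q (J theta) * in_r (J theta))"

text \<open>\<open>c\<^sup>\<lambda>\<^sub>\<mu>\<^sub>\<nu>\<close> is read off from the coefficient of \<open>t\<^sup>n p\<^sub>\<lambda> q\<^sub>\<mu> r\<^sub>\<nu>\<close>; its defining identity is
  \<open>jack_series_expansion\<close> below.\<close>

definition jack_coeff ::
  "(nat multiset \<Rightarrow> symfun) \<Rightarrow> nat multiset \<Rightarrow> nat multiset \<Rightarrow> nat multiset \<Rightarrow> ratfun" where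
  "jack_coeff J lam mu nu = of_nat (zee lam) * (1 + b_par) ^ size lam *
     Poly_Mapping.lookup (fps_nth (jack_series J) (sum_mset lam)) (lam, mu, nu)"

lemma in_pqr_mult:
  "Poly_Mapping.single 0 a * in_p f * in_q g * in_r h =
     (\<Sum>lam\<in>Poly_Mapping.keys f. \<Sum>mu\<in>Poly_Mapping.keys g. \<Sum>nu\<in>Poly_Mapping.keys h.
        Poly_Mapping.single (lam, mu, nu)
          (a * Poly_Mapping.lookup f lam * Poly_Mapping.lookup g mu * Poly_Mapping.lookup h nu))"
proof -
  have "Poly_Mapping.single 0 a * in_p f * in_q g * in_r h =
     (\<Sum>lam\<in>Poly_Mapping.keys f. \<Sum>mu\<in>Poly_Mapping.keys g. \<Sum>nu\<in>Poly_Mapping.keys h.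
        Poly_Mapping.single 0 a * Poly_Mapping.single (lam, 0, 0) (Poly_Mapping.lookup f lam) *
        Poly_Mapping.single (0, mu, 0) (Poly_Mapping.lookup g mu) *
        Poly_Mapping.single (0, 0, nu) (Poly_Mapping.lookup h nu))"
    unfolding in_p_def in_q_def in_r_def
    by (simp only: sum_distrib_left[of "Poly_Mapping.single 0 a"] sum_distrib_right)
      (simp only: sum_distrib_left sum_distrib_right, rule sum.cong[OF refl], rule sum.swap)
  thus ?thesis by (simp add: Poly_Mapping.mult_single plus_prod_def zero_prod_def)
qed

lemma jack_series_nth:
  assumes "jack_family J"
  shows "fps_nth (jack_series J) n =
     (\<Sum>lam\<in>partitions n. \<Sum>mu\<in>partitions n. \<Sum>nu\<in>partitions n.
        Poly_Mapping.single (lam, mu, nu)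
          (\<Sum>theta\<in>partitions n. 1 / jack_norm J theta * Poly_Mapping.lookup (J theta) lam *
             Poly_Mapping.lookup (J theta) mu * Poly_Mapping.lookup (J theta) nu))"
proof -
  let ?l = "\<lambda>theta lam. Poly_Mapping.lookup (J theta) lam"
  let ?P = "partitions n"
  have keys: "Poly_Mapping.keys (J theta) \<subseteq> ?P" if "theta \<in> ?P" for theta
    using assms that by (auto simp: jack_family_def)
  have sum_single: "(\<Sum>i\<in>A. Poly_Mapping.single k (h i)) = Poly_Mapping.single k (sum h A)"
    for A and k :: "nat multiset \<times> nat multiset \<times> nat multiset" and h :: "nat multiset \<Rightarrow> ratfun"
    by (induction A rule: infinite_finite_induct) (auto simp: Poly_Mapping.single_add)
  have extend: "(\<Sum>lam\<in>Poly_Mapping.keys (J theta). H lam) = (\<Sum>lam\<in>?P. H lam)"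
    if "theta \<in> ?P" "\<And>lam. ?l theta lam = 0 \<Longrightarrow> H lam = 0"
    for theta and H :: "nat multiset \<Rightarrow> pqr_poly"
    by (rule sum.mono_neutral_left) (use that keys finite_partitions in \<open>auto simp: in_keys_iff\<close>)
  have "fps_nth (jack_series J) n =
      (\<Sum>theta\<in>?P. \<Sum>lam\<in>?P. \<Sum>mu\<in>?P. \<Sum>nu\<in>?P.
         Poly_Mapping.single (lam, mu, nu)
           (1 / jack_norm J theta * ?l theta lam * ?l theta mu * ?l theta nu))"
    unfolding jack_series_def fps_nth_Abs_fps in_pqr_mult
  proof (rule sum.cong[OF refl])
    fix theta assume th: "theta \<in> ?P"
    show "(\<Sum>lam\<in>Poly_Mapping.keys (J theta). \<Sum>mu\<in>Poly_Mapping.keys (J theta).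
             \<Sum>nu\<in>Poly_Mapping.keys (J theta). Poly_Mapping.single (lam, mu, nu)
               (1 / jack_norm J theta * ?l theta lam * ?l theta mu * ?l theta nu)) =
          (\<Sum>lam\<in>?P. \<Sum>mu\<in>?P. \<Sum>nu\<in>?P. Poly_Mapping.single (lam, mu, nu)
               (1 / jack_norm J theta * ?l theta lam * ?l theta mu * ?l theta nu))"
      by (simp add: extend[OF th])
  qed
  also have "\<dots> = (\<Sum>lam\<in>?P. \<Sum>mu\<in>?P. \<Sum>nu\<in>?P. \<Sum>theta\<in>?P.
         Poly_Mapping.single (lam, mu, nu)
           (1 / jack_norm J theta * ?l theta lam * ?l theta mu * ?l theta nu))"
    by (rule trans[OF sum.swap], rule sum.cong[OF refl],
        rule trans[OF sum.swap], rule sum.cong[OF refl], rule sum.swap)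
  finally show ?thesis unfolding sum_single .
qed

lemma jack_series_lookup:
  assumes "jack_family J" "lam \<in> partitions n" "mu \<in> partitions n" "nu \<in> partitions n"
  shows "Poly_Mapping.lookup (fps_nth (jack_series J) n) (lam, mu, nu) =
     (\<Sum>theta\<in>partitions n. 1 / jack_norm J theta * Poly_Mapping.lookup (J theta) lam *
        Poly_Mapping.lookup (J theta) mu * Poly_Mapping.lookup (J theta) nu)"
proof -
  let ?P = "partitions n"
  have *: "Poly_Mapping.lookup (\<Sum>x\<in>?P. \<Sum>y\<in>?P. \<Sum>z\<in>?P. Poly_Mapping.single (x, y, z) (S x y z))
      (lam, mu, nu) = S lam mu nu" for S :: "_ \<Rightarrow> _ \<Rightarrow> _ \<Rightarrow> ratfun"
  proof -
    have "Poly_Mapping.lookup (\<Sum>x\<in>?P. \<Sum>y\<in>?P. \<Sum>z\<in>?P. Poly_Mapping.single (x, y, z) (S x y z))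
        (lam, mu, nu) =
        (\<Sum>x\<in>?P. \<Sum>y\<in>?P. \<Sum>z\<in>?P. if x = lam \<and> y = mu \<and> z = nu then S x y z else 0)"
      by (simp add: lookup_sum lookup_single when_def)
    also have "\<dots> = (\<Sum>x\<in>?P. if x = lam then (\<Sum>y\<in>?P. if y = mu then
        (\<Sum>z\<in>?P. if z = nu then S x y z else 0) else 0) else 0)"
      by (auto intro!: sum.cong)
    also have "\<dots> = S lam mu nu"
      using assms(2-4) by (simp add: sum.delta finite_partitions)
    finally show ?thesis .
  qed
  show ?thesis unfolding jack_series_nth[OF assms(1)] * ..
qed

lemma jack_empty:
  assumes "jack_family J"
  shows "J {#} = Poly_Mapping.single {#} 1"
proof -
  have "{#} \<in> partitions 0" by (simp add: partitions_0)
  then obtain u where keys: "Poly_Mapping.keys (J {#}) \<subseteq> partitions 0"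
    and u: "in_vars 0 (J {#}) = (\<Sum>mu\<in>{mu \<in> partitions 0. dominated mu {#}}.
              Poly_Mapping.single 0 (u mu) * monomial_sym 0 mu)"
    and u1: "u (replicate_mset 0 1) = fact 0"
    using assms unfolding jack_family_def by meson
  define c where "c = Poly_Mapping.lookup (J {#}) {#}"
  have J: "J {#} = Poly_Mapping.single {#} c"
    using keys by (intro poly_mapping_eqI)
      (auto simp: c_def lookup_single when_def partitions_0 in_keys_iff)
  have "{mu \<in> partitions 0. dominated mu {#}} = {{#}}"
    by (auto simp: partitions_0 dominated_def)
  moreover have "monomial_sym 0 {#} = 1"
  proof -
    have "{e. Poly_Mapping.keys e \<subseteq> {..<0::nat} \<and> exponents e = {#}} = {0}"
      by (auto simp: exponents_def)
    thus ?thesis by (simp add: monomial_sym_def)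
  qed
  ultimately have "in_vars 0 (J {#}) = Poly_Mapping.single 0 1" using u u1 by simp
  moreover have "in_vars 0 (J {#}) = Poly_Mapping.single 0 c"
    by (cases "c = 0") (auto simp: J in_vars_def)
  ultimately have "c = 1" by (metis lookup_single_eq)
  thus ?thesis using J by simp
qed

lemma jack_series_expansion:
  assumes "jack_family J"
  shows "jack_series J = 1 + Abs_fps (\<lambda>n. if n = 0 then 0 else
           (\<Sum>lam\<in>partitions n. \<Sum>mu\<in>partitions n. \<Sum>nu\<in>partitions n.
              Poly_Mapping.single (lam, mu, nu)
                (jack_coeff J lam mu nu / (of_nat (zee lam) * (1 + b_par) ^ size lam))))"
    (is "_ = ?R")
proof (rule fps_ext)
  fix n
  show "fps_nth (jack_series J) n = fps_nth ?R n"
  proof (cases "n = 0")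
    case True
    have "jack_norm J {#} = 1"
      by (simp add: jack_norm_def jack_empty[OF assms] scalar_prod_def zee_def)
    hence "fps_nth (jack_series J) 0 = Poly_Mapping.single 0 1"
      unfolding jack_series_nth[OF assms]
      by (simp add: partitions_0 jack_empty[OF assms] zero_prod_def)
    thus ?thesis using True by simp
  next
    case False
    have eq: "jack_coeff J lam mu nu / (of_nat (zee lam) * (1 + b_par) ^ size lam) =
        (\<Sum>theta\<in>partitions n. 1 / jack_norm J theta * Poly_Mapping.lookup (J theta) lam *
           Poly_Mapping.lookup (J theta) mu * Poly_Mapping.lookup (J theta) nu)"
      if "lam \<in> partitions n" "mu \<in> partitions n" "nu \<in> partitions n" for lam mu nu
    proof -
      have "of_nat (zee lam) \<noteq> (0 :: rat poly)" using zee_pos[OF that(1)] by simp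
      hence "to_fract (of_nat (zee lam)) \<noteq> (0 :: ratfun)" by simp
      hence z: "of_nat (zee lam) \<noteq> (0 :: ratfun)"
        by (metis of_nat_fract to_fract_def)
      have a: "1 + b_par \<noteq> 0" using alpha_nonzero by (simp add: alpha_def add.commute)
      have "sum_mset lam = n" using that by (simp add: partitions_def)
      thus ?thesis using z a jack_series_lookup[OF assms that] by (simp add: jack_coeff_def)
    qed
    show ?thesis using False by (simp add: jack_series_nth[OF assms] eq)
  qed
qed


section \<open>Matchings\<close>

text \<open>The vertices \<open>i\<close> and \<open>\<hat>i\<close> are \<open>Inl i\<close> and \<open>Inr i\<close>.\<close>

type_synonym vertex = "nat + nat"

definition vertices :: "nat \<Rightarrow> vertex set" where
  "vertices n = {1..n} <+> {1..n}"

definition matching :: "nat \<Rightarrow> vertex set set \<Rightarrow> bool" where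
  "matching n d \<longleftrightarrow> partition_on (vertices n) d \<and> (\<forall>e\<in>d. card e = 2)"

definition bipartite_matching :: "nat \<Rightarrow> vertex set set \<Rightarrow> bool" where
  "bipartite_matching n d \<longleftrightarrow> matching n d \<and> (\<forall>e\<in>d. \<exists>i j. e = {Inl i, Inr j})"

definition components :: "nat \<Rightarrow> vertex set set \<Rightarrow> vertex set set" where
  "components n E = vertices n // {(x, y). {x, y} \<in> E}\<^sup>*"

definition coset_type :: "nat \<Rightarrow> vertex set set \<Rightarrow> vertex set set \<Rightarrow> nat multiset" where
  "coset_type n d1 d2 = image_mset (\<lambda>C. card C div 2) (mset_set (components n (d1 \<union> d2)))"

text \<open>\<open>a\<^sup>\<lambda>\<^sub>\<mu>\<^sub>\<nu>\<close> and its bipartite analogue, as computed from a pair \<open>d1, d2\<close> with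
  \<open>coset_type n d1 d2 = \<lambda>\<close>.\<close>

definition num_matchings ::
  "nat \<Rightarrow> vertex set set \<Rightarrow> vertex set set \<Rightarrow> nat multiset \<Rightarrow> nat multiset \<Rightarrow> nat" where
  "num_matchings n d1 d2 mu nu =
     card {d. matching n d \<and> coset_type n d1 d = mu \<and> coset_type n d d2 = nu}"

definition num_bipartite_matchings ::
  "nat \<Rightarrow> vertex set set \<Rightarrow> vertex set set \<Rightarrow> nat multiset \<Rightarrow> nat multiset \<Rightarrow> nat" where
  "num_bipartite_matchings n d1 d2 mu nu =
     card {d. bipartite_matching n d \<and> coset_type n d1 d = mu \<and> coset_type n d d2 = nu}"

end

theory Submission
  imports Defs "HOL-Combinatorics.Permutations"
begin

text \<open>Let \<open>\<alpha>\<close> be \<open>1\<close> or \<open>2\<close>. The class sums of bipartite, respectively arbitrary, matchings act on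
  symmetric functions of degree \<open>n\<close> by commuting operators \<open>T\<^sub>\<mu>\<close>, with matrix entries \<open>a\<^sup>\<lambda>\<^sub>\<mu>\<^sub>\<nu>\<close> in
  the power sum basis; counting isomorphisms of pairs of matchings shows that they are well defined and
  self-adjoint for \<open>\<langle>\<cdot>,\<cdot>\<rangle>\<^sub>\<alpha>\<close>. The space \<open>L\<^sub>\<theta>\<close> spanned by the \<open>m\<^sub>\<kappa>\<close> with \<open>\<kappa> \<le> \<theta>\<close> is spanned by the
  antisymmetrised elements \<open>e\<^sub>\<kappa>\<^sub>'\<close> with \<open>\<kappa> \<le> \<theta>\<close>. The operators \<open>T\<^sub>\<mu>\<close> preserve antisymmetry, hence \<open>L\<^sub>\<theta>\<close>,
  and being self-adjoint they have the orthogonal basis \<open>J\<^sub>\<theta>\<close> as joint eigenvectors. Comparing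
  coefficients of \<open>p\<^sub>1\<^sup>n\<close>, the eigenvalue of \<open>T\<^sub>\<mu>\<close> on \<open>J\<^sub>\<theta>\<close> is the coefficient of \<open>p\<^sub>\<mu>\<close> in \<open>J\<^sub>\<theta>\<close>, and
  expanding in the basis \<open>J\<^sub>\<theta>\<close> gives the formula that defines \<open>c\<^sup>\<lambda>\<^sub>\<mu>\<^sub>\<nu>\<close>.\<close>

section \<open>Evaluation of rational functions\<close>

text \<open>The family is known only through its defining properties over the field of rational
  functions, so its coefficients might have poles at b = 0 or b = 1. Each J is therefore multiplied
  by a factor of its own that makes all coefficients polynomial and not all zero at the chosen value
  of b. Triangularity and orthogonality are polynomial identities and survive evaluation. The
  evaluated form is positive definite over the rationals, so nonzero orthogonal vectors stay
  independent. The eigenvalue equation then shows that the coefficient of p_1^n cannot have become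
  0, since it would force every other coefficient to be 0. Dividing by it undoes the rescaling, so
  regularity at b is a consequence rather than an input. What the antisymmetrised matchings
  contribute is a second basis adapted to dominance, independent of Jack polynomials, on which the
  action of the class sums can be computed.\<close>

lemma has_valueI:
  "f = to_fract p / to_fract q \<Longrightarrow> poly q x \<noteq> 0 \<Longrightarrow> v = poly p x / poly q x \<Longrightarrow> has_value f x v"
  unfolding has_value_def by blast

lemma has_value_add:
  assumes "has_value f x v" "has_value g x w" shows "has_value (f + g) x (v + w)"
proof -
  obtain p q where pq: "f = to_fract p / to_fract q" "poly q x \<noteq> 0" "v = poly p x / poly q x"
    using assms(1) by (auto simp: has_value_def)
  obtain r s where rs: "g = to_fract r / to_fract s" "poly s x \<noteq> 0" "w = poly r x / poly s x"
    using assms(2) by (auto simp: has_value_def)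
  have nz: "q \<noteq> 0" "s \<noteq> 0" using pq rs by auto
  show ?thesis
    by (rule has_valueI[where p = "p * s + r * q" and q = "q * s"])
      (use pq rs nz in \<open>simp_all add: add_frac_eq to_fract_add[symmetric] to_fract_mult[symmetric] del: to_fract_add to_fract_mult\<close>)
qed

lemma has_value_mult:
  assumes "has_value f x v" "has_value g x w" shows "has_value (f * g) x (v * w)"
proof -
  obtain p q where pq: "f = to_fract p / to_fract q" "poly q x \<noteq> 0" "v = poly p x / poly q x"
    using assms(1) by (auto simp: has_value_def)
  obtain r s where rs: "g = to_fract r / to_fract s" "poly s x \<noteq> 0" "w = poly r x / poly s x"
    using assms(2) by (auto simp: has_value_def)
  show ?thesis
    by (rule has_valueI[where p = "p * r" and q = "q * s"]) (use pq rs in simp_all)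
qed

lemma has_value_divide:
  assumes "has_value f x v" "has_value g x w" "w \<noteq> 0" shows "has_value (f / g) x (v / w)"
proof -
  obtain p q where pq: "f = to_fract p / to_fract q" "poly q x \<noteq> 0" "v = poly p x / poly q x"
    using assms(1) by (auto simp: has_value_def)
  obtain r s where rs: "g = to_fract r / to_fract s" "poly s x \<noteq> 0" "w = poly r x / poly s x"
    using assms(2) by (auto simp: has_value_def)
  show ?thesis
    by (rule has_valueI[where p = "p * s" and q = "q * r"]) (use pq rs assms(3) in simp_all)
qed

lemma has_value_to_fract: "has_value (to_fract p) x (poly p x)"
  by (simp add: has_value_poly)

lemma has_value_of_nat: "has_value (of_nat k) x (of_nat k)"
proof -
  have "(of_nat k :: ratfun) = to_fract (of_nat k)"
    by (metis of_nat_fract to_fract_def)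
  thus ?thesis using has_value_to_fract[of "of_nat k" x] by simp
qed

lemma has_value_power: "has_value f x v \<Longrightarrow> has_value (f ^ k) x (v ^ k)"
proof (induction k)
  case 0
  show ?case using has_value_of_nat[of 1 x] by simp
qed (simp add: has_value_mult)

lemma has_value_sum:
  "(\<And>i. i \<in> I \<Longrightarrow> has_value (f i) x (g i)) \<Longrightarrow> has_value (sum f I) x (sum g I)"
proof (induction I rule: infinite_finite_induct)
  case (insert i I)
  thus ?case by (simp add: has_value_add)
qed (use has_value_of_nat[of 0 x] in simp_all)

lemma has_value_alpha: "has_value alpha x (x + 1)"
  using has_value_add[OF has_value_to_fract[of "[:0,1:]" x] has_value_of_nat[of 1 x]]
  by (simp add: alpha_def b_par_def)

lemma common_denominator:
  fixes f :: "'i \<Rightarrow> ratfun"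
  assumes "finite I"
  shows "\<exists>C p. C \<noteq> 0 \<and> (\<forall>i\<in>I. to_fract C * f i = to_fract (p i))"
  using assms
proof (induction I rule: finite_induct)
  case empty
  show ?case by (rule exI[of _ 1]) simp
next
  case (insert j I)
  then obtain C p where C: "C \<noteq> 0" "\<forall>i\<in>I. to_fract C * f i = to_fract (p i)" by blast
  obtain m q where q: "f j = Fract m q" "q \<noteq> 0" by (cases "f j") auto
  have fj: "to_fract q * f j = to_fract m"
    using q by (simp add: Fract_conv_to_fract)
  let ?p = "\<lambda>i. if i = j then C * m else q * p i"
  have "to_fract (C * q) * f i = to_fract (?p i)" if "i \<in> insert j I" for i
  proof (cases "i = j")
    case True
    thus ?thesis using fj by (simp add: mult.assoc)
  next
    case False
    hence "to_fract C * f i = to_fract (p i)" using C that by blast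
    thus ?thesis using False by (simp add: mult.commute mult.left_commute)
  qed
  moreover have "C * q \<noteq> 0" using C q by simp
  ultimately show ?case by (intro exI[of _ "C * q"] exI[of _ ?p]) auto
qed

text \<open>This replaces the integrality theory of Jack polynomials: after rescaling, the coefficient vector of
  \<open>J\<^sub>\<theta>\<close> specialises at \<open>b = x\<close> to a nonzero vector.\<close>

lemma regular_rescaling:
  fixes f :: "'i \<Rightarrow> ratfun" and x :: rat
  assumes fin: "finite I" and j: "j \<in> I" "f j \<noteq> 0"
  shows "\<exists>c p. c \<noteq> 0 \<and> (\<forall>i\<in>I. c * f i = to_fract (p i)) \<and> (\<exists>i\<in>I. poly (p i) x \<noteq> 0)"
proof -
  define Q where "Q = (\<lambda>cp. fst cp \<noteq> 0 \<and> (\<forall>i\<in>I. fst cp * f i = to_fract (snd cp i)))"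
  obtain C p where "C \<noteq> 0" "\<forall>i\<in>I. to_fract C * f i = to_fract (p i)"
    using common_denominator[OF fin] by blast
  hence "Q (to_fract C, p)" by (simp add: Q_def)
  \<comment> \<open>Among all polynomial rescalings take one whose \<open>j\<close>-th entry has
    least degree. If every entry vanished at \<open>x\<close>, cancelling the common factor b - x
    would lower that degree.\<close>
  from ex_has_least_nat[of Q, OF this, of "\<lambda>cp. degree (snd cp j)"]
  obtain cp where Qcp: "Q cp" and least: "\<And>cq. Q cq \<Longrightarrow> degree (snd cp j) \<le> degree (snd cq j)"
    by blast
  obtain c p where cp: "cp = (c, p)" by (cases cp)
  have c: "c \<noteq> 0" "\<And>i. i \<in> I \<Longrightarrow> c * f i = to_fract (p i)" using Qcp by (auto simp: Q_def cp)
  have "\<exists>i\<in>I. poly (p i) x \<noteq> 0"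
  proof (rule ccontr)
    assume "\<not> ?thesis"
    hence "\<forall>i\<in>I. \<exists>q. p i = [:-x, 1:] * q" by (auto simp: poly_eq_0_iff_dvd dvd_def)
    then obtain q where q: "\<And>i. i \<in> I \<Longrightarrow> p i = [:-x, 1:] * q i" by metis
    have nz: "to_fract [:-x, 1:] \<noteq> 0" by (subst to_fract_eq_0_iff) simp
    let ?l = "to_fract [:-x, 1:] :: ratfun"
    have "c / ?l * f i = to_fract (q i)" if "i \<in> I" for i
    proof -
      have "c * f i = ?l * to_fract (q i)" using c(2) q that by (metis to_fract_mult)
      thus ?thesis by (simp only: times_divide_eq_left nonzero_mult_div_cancel_left[OF nz])
    qed
    hence "Q (c / ?l, q)" using c(1) nz unfolding Q_def fst_conv snd_conv
      by (simp only: divide_eq_0_iff de_Morgan_disj) simp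
    from least[OF this] have "degree (p j) \<le> degree (q j)" by (simp only: cp snd_conv)
    moreover have "p j \<noteq> 0" using c j by force
    hence "degree (p j) = Suc (degree (q j))" using q[OF j(1)] by (auto simp: degree_mult_eq simp del: mult_pCons_left)
    ultimately show False by simp
  qed
  thus ?thesis using c by blast
qed

section \<open>Pairs of fixed-point-free involutions\<close>

text \<open>A matching on \<open>V\<close> is encoded by its partner map, a fixed-point-free involution of \<open>V\<close>; the
  components of the union of two matchings are the orbits of the dihedral group generated by
  their partner maps.\<close>

definition fpf_inv :: "'a set \<Rightarrow> ('a \<Rightarrow> 'a) \<Rightarrow> bool" where
  "fpf_inv V s \<longleftrightarrow> (\<forall>x\<in>V. s x \<in> V \<and> s (s x) = x \<and> s x \<noteq> x)"

inductive_set cyc :: "('a \<Rightarrow> 'a) \<Rightarrow> ('a \<Rightarrow> 'a) \<Rightarrow> 'a \<Rightarrow> 'a set" for s t x where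
  cyc_base: "x \<in> cyc s t x"
| cyc_fst: "y \<in> cyc s t x \<Longrightarrow> s y \<in> cyc s t x"
| cyc_snd: "y \<in> cyc s t x \<Longrightarrow> t y \<in> cyc s t x"

definition ctype :: "'a set \<Rightarrow> ('a \<Rightarrow> 'a) \<Rightarrow> ('a \<Rightarrow> 'a) \<Rightarrow> nat multiset" where
  "ctype V s t = image_mset (\<lambda>C. card C div 2) (mset_set (cyc s t ` V))"

section \<open>Dihedral coordinates on a component of two matchings\<close>

primrec rot :: "('a \<Rightarrow> 'a) \<Rightarrow> ('a \<Rightarrow> 'a) \<Rightarrow> nat \<Rightarrow> 'a \<Rightarrow> 'a" where
  "rot s t 0 v = v"
| "rot s t (Suc i) v = t (s (rot s t i v))"

lemma rot_add: "rot s t (i + j) v = rot s t i (rot s t j v)"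
  by (induction i) auto

lemma rot_Suc_shift: "rot s t (Suc i) v = rot s t i (t (s v))"
  by (induction i) auto

text \<open>Coordinates on the component of \<open>v\<close>: the vertices met in turn are v, s v, t
  s v, s t s v, and so on. \<open>i\<close> counts rotations, to be read modulo the period, and
  \<open>b\<close> tells whether one more \<open>s\<close>-edge has been crossed.\<close>

definition walk :: "('a \<Rightarrow> 'a) \<Rightarrow> ('a \<Rightarrow> 'a) \<Rightarrow> 'a \<Rightarrow> nat \<Rightarrow> bool \<Rightarrow> 'a" where
  "walk s t v i b = (if b then s (rot s t i v) else rot s t i v)"

lemma walk_0 [simp]: "walk s t v 0 False = v"
  by (simp add: walk_def)

context
  fixes V :: "'a set" and s t :: "'a \<Rightarrow> 'a"
  assumes fin: "finite V" and s: "fpf_inv V s" and t: "fpf_inv V t"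
begin

lemma in_V: "x \<in> V \<Longrightarrow> s x \<in> V" "x \<in> V \<Longrightarrow> t x \<in> V"
  and invol: "x \<in> V \<Longrightarrow> s (s x) = x" "x \<in> V \<Longrightarrow> t (t x) = x"
  and no_fix: "x \<in> V \<Longrightarrow> s x \<noteq> x" "x \<in> V \<Longrightarrow> t x \<noteq> x"
  using s t by (auto simp: fpf_inv_def)

lemma rot_in_V: "x \<in> V \<Longrightarrow> rot s t i x \<in> V"
  by (induction i) (auto simp: in_V)

lemma rot_inj: "\<lbrakk>x \<in> V; y \<in> V; rot s t i x = rot s t i y\<rbrakk> \<Longrightarrow> x = y"
proof (induction i)
  case (Suc i)
  have inj: "a = b" if "a \<in> V" "b \<in> V" "t (s a) = t (s b)" for a b
    using arg_cong[OF that(3), of "\<lambda>x. s (t x)"] that(1,2) by (simp add: in_V invol)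
  have "rot s t i x = rot s t i y"
    using inj[of "rot s t i x" "rot s t i y"] Suc.prems rot_in_V by simp
  thus ?case using Suc.IH Suc.prems(1,2) by simp
qed simp

text \<open>The dihedral relation r^i s r^i = s for the rotation r = t s.\<close>

lemma rot_reflect: "x \<in> V \<Longrightarrow> rot s t i (s (rot s t i x)) = s x"
proof (induction i)
  case (Suc i)
  let ?y = "rot s t i x"
  have y: "?y \<in> V" using Suc.prems rot_in_V by blast
  have "rot s t (Suc i) (s (rot s t (Suc i) x)) = rot s t i (t (s (s (t (s ?y)))))"
    by (subst rot_Suc_shift) simp
  also have "\<dots> = rot s t i (s ?y)" using y by (simp add: in_V invol)
  finally show ?case using Suc by simp
qed simp

text \<open>Otherwise \<open>s v\<close> would be a rotation of \<open>v\<close>, and halving that rotation yields a fixed point of \<open>s\<close>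
  or of \<open>t\<close>.\<close>

lemma rot_neq_reflect:
  assumes v: "v \<in> V" shows "s (rot s t i v) \<noteq> rot s t j v"
proof
  assume eq: "s (rot s t i v) = rot s t j v"
  have sv: "s v = rot s t (i + j) v"
    using rot_reflect[OF v, of i] eq by (simp add: rot_add)
  show False
  proof (cases "even (i + j)")
    case True
    then obtain l where l: "i + j = l + l" by (metis evenE mult_2)
    have "rot s t l (s (rot s t l v)) = rot s t l (rot s t l v)"
      using rot_reflect[OF v, of l] sv l by (simp add: rot_add)
    hence "s (rot s t l v) = rot s t l v"
      using rot_inj rot_in_V[OF v, of l] in_V(1) by blast
    thus False using no_fix(1) rot_in_V[OF v] by blast
  next
    case False
    then obtain l where l: "i + j = l + Suc l" by (metis oddE mult_2 add_Suc_right Suc_eq_plus1)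
    have "rot s t l (s (rot s t l v)) = rot s t l (rot s t (Suc l) v)"
      using rot_reflect[OF v, of l] sv by (simp only: l rot_add)
    hence "s (rot s t l v) = rot s t (Suc l) v"
      by (rule rot_inj[rotated 2]) (intro in_V rot_in_V v)+
    thus False using no_fix(2)[OF in_V(1)[OF rot_in_V[OF v]], of l] by simp
  qed
qed

text \<open>Finiteness forces a repetition, and injectivity of the rotation moves it back to the
  starting point, so the orbit is purely periodic; \<open>p\<close> is the first return
  time.\<close>

lemma period_exists:
  assumes v: "v \<in> V"
  shows "\<exists>p>0. \<forall>i j. rot s t i v = rot s t j v \<longleftrightarrow> i mod p = j mod p"
proof -
  have cancel: "rot s t (j - i) v = v" if "i \<le> j" "rot s t i v = rot s t j v" for i j
  proof -
    have "rot s t i (rot s t (j - i) v) = rot s t i v"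
      using that rot_add[of s t i "j - i" v] by simp
    thus ?thesis using rot_inj rot_in_V v by blast
  qed
  have "finite (range (\<lambda>i. rot s t i v))"
    by (rule finite_subset[OF _ fin]) (use rot_in_V[OF v] in auto)
  hence "\<not> inj (\<lambda>i. rot s t i v)" using finite_imageD infinite_UNIV_nat by blast
  then obtain i j where ij: "i < j" "rot s t i v = rot s t j v"
    unfolding inj_def by (metis linorder_neqE_nat)
  define p where "p = (LEAST p. p > 0 \<and> rot s t p v = v)"
  have "j - i > 0 \<and> rot s t (j - i) v = v" using ij cancel by auto
  hence p: "p > 0 \<and> rot s t p v = v" unfolding p_def by (rule LeastI)
  have least: "\<not> (q > 0 \<and> rot s t q v = v)" if "q < p" for q
    using that unfolding p_def by (rule not_less_Least)
  have red: "rot s t i v = rot s t (i mod p) v" for i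
  proof -
    have "rot s t (p * k) v = v" for k
      by (induction k) (use p in \<open>auto simp: rot_add\<close>)
    thus ?thesis using rot_add[of s t "i mod p" "p * (i div p)" v] by simp
  qed
  have mono: "i = j" if "i < p" "j < p" "i \<le> j" "rot s t i v = rot s t j v" for i j
    using cancel[OF that(3,4)] least[of "j - i"] that by auto
  have "i = j" if "i < p" "j < p" "rot s t i v = rot s t j v" for i j
    using mono[of i j] mono[of j i] that by (cases "i \<le> j") auto
  hence "rot s t i v = rot s t j v \<longleftrightarrow> i mod p = j mod p" for i j
    using red p by (metis mod_less_divisor)
  thus ?thesis using p by blast
qed

lemma walk_in_V: "v \<in> V \<Longrightarrow> walk s t v i b \<in> V"
  by (simp add: walk_def rot_in_V in_V)

lemma cyc_subset: "v \<in> V \<Longrightarrow> cyc s t v \<subseteq> V"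
proof
  fix x assume v: "v \<in> V" and "x \<in> cyc s t v"
  from this(2) show "x \<in> V" by induction (auto simp: v in_V)
qed

lemma walk_fst: "v \<in> V \<Longrightarrow> s (walk s t v i b) = walk s t v i (\<not> b)"
  by (auto simp: walk_def invol rot_in_V)

lemma walk_snd: "t (walk s t v i True) = walk s t v (Suc i) False"
  by (simp add: walk_def)

lemma walk_in_cyc: "walk s t v i b \<in> cyc s t v"
proof -
  have "rot s t i v \<in> cyc s t v" for i
    by (induction i) (auto intro: cyc.intros)
  thus ?thesis by (auto simp: walk_def intro: cyc.intros)
qed

text \<open>Crossing a \<open>t\<close>-edge backwards. The index i - 1 is written i + p - 1 because
  truncated subtraction would go wrong at i = 0.\<close>

lemma walk_snd':
  assumes v: "v \<in> V" and p: "p > 0" "\<forall>i j. rot s t i v = rot s t j v \<longleftrightarrow> i mod p = j mod p"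
  shows "t (walk s t v i False) = walk s t v (i + p - 1) True"
proof -
  have "walk s t v i False = walk s t v (Suc (i + p - 1)) False"
    using p by (simp add: walk_def)
  also have "\<dots> = t (walk s t v (i + p - 1) True)" by (rule walk_snd[symmetric])
  finally show ?thesis using walk_in_V[OF v] invol by metis
qed

lemma walk_eq_iff:
  assumes v: "v \<in> V" and p: "\<forall>i j. rot s t i v = rot s t j v \<longleftrightarrow> i mod p = j mod p"
  shows "walk s t v i b = walk s t v j b' \<longleftrightarrow> b = b' \<and> i mod p = j mod p"
proof -
  have "s (rot s t i v) = s (rot s t j v) \<longleftrightarrow> rot s t i v = rot s t j v"
    using invol(1) rot_in_V[OF v] by metis
  thus ?thesis using p rot_neq_reflect[OF v, of i j] rot_neq_reflect[OF v, of j i]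
    by (auto simp: walk_def)
qed

lemma cyc_eq_walk:
  assumes v: "v \<in> V"
  shows "cyc s t v = range (\<lambda>(i, b). walk s t v i b)"
proof
  show "cyc s t v \<subseteq> range (\<lambda>(i, b). walk s t v i b)"
  proof
    obtain p where p: "p > 0" "\<forall>i j. rot s t i v = rot s t j v \<longleftrightarrow> i mod p = j mod p"
      using period_exists[OF v] by blast
    fix x assume "x \<in> cyc s t v"
    thus "x \<in> range (\<lambda>(i, b). walk s t v i b)"
    proof induction
      case cyc_base
      show ?case by (rule image_eqI[of _ _ "(0, False)"]) auto
    next
      case (cyc_fst y)
      then obtain i b where "y = walk s t v i b" by auto
      thus ?case using walk_fst[OF v] by (intro image_eqI[of _ _ "(i, \<not> b)"]) auto
    next
      case (cyc_snd y)
      then obtain i b where y: "y = walk s t v i b" by auto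
      show ?case
      proof (cases b)
        case True
        thus ?thesis using walk_snd y by (intro image_eqI[of _ _ "(Suc i, False)"]) auto
      next
        case False
        thus ?thesis using walk_snd'[OF v p] y
          by (intro image_eqI[of _ _ "(i + p - 1, True)"]) auto
      qed
    qed
  qed
  show "range (\<lambda>(i, b). walk s t v i b) \<subseteq> cyc s t v"
    using walk_in_cyc by auto
qed

lemma cyc_eq_image:
  assumes v: "v \<in> V" and p: "p > 0" "\<forall>i j. rot s t i v = rot s t j v \<longleftrightarrow> i mod p = j mod p"
  shows "bij_betw (\<lambda>(i, b). walk s t v i b) ({..<p} \<times> UNIV) (cyc s t v)"
proof (rule bij_betw_imageI)
  show "inj_on (\<lambda>(i, b). walk s t v i b) ({..<p} \<times> UNIV)"
    by (auto simp: inj_on_def walk_eq_iff[OF v p(2)])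
  have "walk s t v i b = walk s t v (i mod p) b" for i b
    by (simp add: walk_eq_iff[OF v p(2)])
  hence "walk s t v i b \<in> (\<lambda>(i, b). walk s t v i b) ` ({..<p} \<times> UNIV)" for i b
    using p(1) by (intro image_eqI[of _ _ "(i mod p, b)"]) auto
  thus "(\<lambda>(i, b). walk s t v i b) ` ({..<p} \<times> UNIV) = cyc s t v"
    unfolding cyc_eq_walk[OF v] by auto
qed

lemma card_cyc:
  assumes v: "v \<in> V" and p: "p > 0" "\<forall>i j. rot s t i v = rot s t j v \<longleftrightarrow> i mod p = j mod p"
  shows "card (cyc s t v) = 2 * p"
  using bij_betw_same_card[OF cyc_eq_image[OF assms]] by (simp add: card_cartesian_product)

lemma cyc_sym:
  assumes v: "v \<in> V" and x: "x \<in> cyc s t v" shows "v \<in> cyc s t x"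
proof -
  have trans: "c \<in> cyc s t a" if "c \<in> cyc s t b" "b \<in> cyc s t a" for a b c
    using that by induction (auto intro: cyc.intros)
  have "v \<in> cyc s t x \<and> x \<in> V" using x
  proof induction
    case (cyc_fst y)
    hence "y \<in> cyc s t (s y)" using cyc.cyc_fst[OF cyc.cyc_base[of "s y" s t]] by (simp add: invol)
    thus ?case using cyc_fst trans by (auto simp: in_V)
  next
    case (cyc_snd y)
    hence "y \<in> cyc s t (t y)" using cyc.cyc_snd[OF cyc.cyc_base[of "t y" s t]] by (simp add: invol)
    thus ?case using cyc_snd trans by (auto simp: in_V)
  qed (simp add: v cyc.cyc_base)
  thus ?thesis ..
qed

lemma cyc_eq:
  assumes v: "v \<in> V" and x: "x \<in> cyc s t v" shows "cyc s t x = cyc s t v"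
proof -
  have trans: "c \<in> cyc s t a" if "c \<in> cyc s t b" "b \<in> cyc s t a" for a b c
    using that by induction (auto intro: cyc.intros)
  show ?thesis using trans x cyc_sym[OF v x] by blast
qed

lemma fpf_inv_diff_cyc:
  assumes v: "v \<in> V" shows "fpf_inv (V - cyc s t v) s" "fpf_inv (V - cyc s t v) t"
proof -
  have "s x \<notin> cyc s t v" if "x \<in> V" "x \<notin> cyc s t v" for x
    using that cyc.cyc_fst[of "s x" s t v] invol by metis
  moreover have "t x \<notin> cyc s t v" if "x \<in> V" "x \<notin> cyc s t v" for x
    using that cyc.cyc_snd[of "t x" s t v] invol by metis
  ultimately show "fpf_inv (V - cyc s t v) s" "fpf_inv (V - cyc s t v) t"
    by (auto simp: fpf_inv_def in_V invol no_fix)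
qed

lemma cycs_diff_cyc:
  assumes v: "v \<in> V" shows "cyc s t ` (V - cyc s t v) = cyc s t ` V - {cyc s t v}"
proof -
  have "cyc s t x \<noteq> cyc s t v" if "x \<notin> cyc s t v" for x
    using that cyc.cyc_base[of x s t] by auto
  moreover have "cyc s t x = cyc s t v" if "x \<in> cyc s t v" for x
    using cyc_eq[OF v that] .
  ultimately show ?thesis by auto
qed

lemma ctype_diff_cyc:
  assumes v: "v \<in> V"
  shows "ctype V s t = add_mset (card (cyc s t v) div 2) (ctype (V - cyc s t v) s t)"
proof -
  have "mset_set (cyc s t ` V) = add_mset (cyc s t v) (mset_set (cyc s t ` V - {cyc s t v}))"
    using fin v by (intro mset_set.remove) auto
  thus ?thesis by (simp add: ctype_def cycs_diff_cyc[OF v])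
qed

end

text \<open>The flag \<open>bip\<close> switches between the two halves of the theorem: bipartite matchings (\<open>\<alpha> = 1\<close>) if it is
  set, arbitrary matchings (\<open>\<alpha> = 2\<close>) otherwise. \<open>side\<close> tells the two colour classes apart.\<close>

definition matching_map :: "bool \<Rightarrow> ('a \<Rightarrow> bool) \<Rightarrow> 'a set \<Rightarrow> ('a \<Rightarrow> 'a) \<Rightarrow> bool" where
  "matching_map bip side V s \<longleftrightarrow> fpf_inv V s \<and> (bip \<longrightarrow> (\<forall>x\<in>V. side (s x) \<noteq> side x))"

section \<open>Counting isomorphisms between two pairs of matchings\<close>

definition isos :: "bool \<Rightarrow> ('a \<Rightarrow> bool) \<Rightarrow> 'a set \<Rightarrow> ('a \<Rightarrow> 'a) \<Rightarrow> ('a \<Rightarrow> 'a) \<Rightarrow>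
    'a set \<Rightarrow> ('a \<Rightarrow> 'a) \<Rightarrow> ('a \<Rightarrow> 'a) \<Rightarrow> ('a \<Rightarrow> 'a) set" where
  "isos bip side V s t V' s' t' = {f \<in> extensional V. bij_betw f V V' \<and>
     (\<forall>x\<in>V. f (s x) = s' (f x) \<and> f (t x) = t' (f x) \<and> (bip \<longrightarrow> side (f x) = side x))}"

lemma matching_mapD: "matching_map bip side V s \<Longrightarrow> fpf_inv V s"
  by (simp add: matching_map_def)

lemma side_walk:
  assumes "matching_map True side V s" "matching_map True side V t" "v \<in> V"
  shows "side (walk s t v i b) = (side v \<noteq> b)"
proof -
  have "rot s t i v \<in> V \<and> side (rot s t i v) = side v"
    by (induction i) (use assms in \<open>auto simp: matching_map_def fpf_inv_def\<close>)
  thus ?thesis using assms by (auto simp: walk_def matching_map_def)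
qed

text \<open>Equal size means equal period, so matching the walk coordinates taken from
  \<open>v\<close> with those taken from \<open>v'\<close> is a well-defined bijection; both partner
  maps change the coordinates in the same way on the two cycles.\<close>

lemma cycle_iso_exists:
  assumes fin: "finite V" "finite V'"
    and s: "matching_map bip side V s" and t: "matching_map bip side V t"
    and s': "matching_map bip side V' s'" and t': "matching_map bip side V' t'"
    and v: "v \<in> V" "v' \<in> V'" and side: "bip \<longrightarrow> side v' = side v"
    and card: "card (cyc s t v) = card (cyc s' t' v')"
  shows "\<exists>f. f v = v' \<and> bij_betw f (cyc s t v) (cyc s' t' v') \<and>
     (\<forall>x\<in>cyc s t v. f (s x) = s' (f x) \<and> f (t x) = t' (f x) \<and> (bip \<longrightarrow> side (f x) = side x))"
proof -
  note fp = matching_mapD[OF s] matching_mapD[OF t]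
  note fp' = matching_mapD[OF s'] matching_mapD[OF t']
  obtain p where p: "p > 0" "\<forall>i j. rot s t i v = rot s t j v \<longleftrightarrow> i mod p = j mod p"
    using period_exists[OF fin(1) fp v(1)] by blast
  obtain p' where p': "p' > 0" "\<forall>i j. rot s' t' i v' = rot s' t' j v' \<longleftrightarrow> i mod p' = j mod p'"
    using period_exists[OF fin(2) fp' v(2)] by blast
  have "p' = p"
    using card card_cyc[OF fin(1) fp v(1) p] card_cyc[OF fin(2) fp' v(2) p'] by simp
  note p' = p'[unfolded this]
  \<comment> \<open>Any coordinates of \<open>x\<close> will do: their indices differ by multiples
    of the common period, which the walk from \<open>v'\<close> does not see.\<close>
  define f where "f = (\<lambda>x. case (SOME (i, b). x = walk s t v i b) of (i, b) \<Rightarrow> walk s' t' v' i b)"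
  have f: "f (walk s t v i b) = walk s' t' v' i b" for i b
  proof -
    have "case (SOME (j, c). walk s t v i b = walk s t v j c) of (j, c) \<Rightarrow> walk s t v i b = walk s t v j c"
      by (rule someI[of _ "(i, b)"]) simp
    thus ?thesis
      by (auto simp: f_def walk_eq_iff[OF fin(1) fp v(1) p(2)] walk_eq_iff[OF fin(2) fp' v(2) p'(2)]
          split: prod.splits)
  qed
  have "f v = v'" using f[of 0 False] by simp
  moreover have "bij_betw f (cyc s t v) (cyc s' t' v')"
    unfolding cyc_eq_walk[OF fin(1) fp v(1)] cyc_eq_walk[OF fin(2) fp' v(2)]
  proof (rule bij_betw_imageI)
    show "inj_on f (range (\<lambda>(i, b). walk s t v i b))"
      by (auto simp: inj_on_def f walk_eq_iff[OF fin(1) fp v(1) p(2)] walk_eq_iff[OF fin(2) fp' v(2) p'(2)])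
    show "f ` range (\<lambda>(i, b). walk s t v i b) = range (\<lambda>(i, b). walk s' t' v' i b)"
      by (auto simp: image_image f case_prod_beta)
  qed
  moreover have "f (s x) = s' (f x) \<and> f (t x) = t' (f x) \<and> (bip \<longrightarrow> side (f x) = side x)"
    if xC: "x \<in> cyc s t v" for x
  proof -
    obtain i b where x: "x = walk s t v i b" using xC unfolding cyc_eq_walk[OF fin(1) fp v(1)] by auto
    have "f (s x) = s' (f x)" by (simp add: x f walk_fst[OF fin(1) fp v(1)] walk_fst[OF fin(2) fp' v(2)])
    moreover have "f (t x) = t' (f x)"
      using f walk_snd[OF fin(1) fp] walk_snd[OF fin(2) fp'] walk_snd'[OF fin(1) fp v(1) p] walk_snd'[OF fin(2) fp' v(2) p']
      by (cases b) (simp_all add: x)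
    moreover have "side (f x) = side x" if bip
      using side_walk[of side V s t v i b] side_walk[of side V' s' t' v' i b] s t s' t' v side that
      by (simp add: x f)
    ultimately show ?thesis by blast
  qed
  ultimately show ?thesis by blast
qed

lemma equivariant_unique:
  assumes "x \<in> cyc s t v" "f v = g v"
    and "\<And>x. x \<in> cyc s t v \<Longrightarrow> f (s x) = s' (f x) \<and> f (t x) = t' (f x)"
    and "\<And>x. x \<in> cyc s t v \<Longrightarrow> g (s x) = s' (g x) \<and> g (t x) = t' (g x)"
  shows "f x = g x"
  using assms(1) by induction (use assms in auto)

lemma equivariant_image_cyc:
  assumes "\<And>x. x \<in> cyc s t v \<Longrightarrow> f (s x) = s' (f x) \<and> f (t x) = t' (f x)"
  shows "f ` cyc s t v = cyc s' t' (f v)"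
proof
  have "f x \<in> cyc s' t' (f v)" if "x \<in> cyc s t v" for x
    using that by induction (use assms in \<open>auto intro: cyc.intros\<close>)
  thus "f ` cyc s t v \<subseteq> cyc s' t' (f v)" by auto
  show "cyc s' t' (f v) \<subseteq> f ` cyc s t v"
  proof
    fix y assume "y \<in> cyc s' t' (f v)"
    thus "y \<in> f ` cyc s t v"
    proof induction
      case (cyc_fst y)
      then obtain x where x: "x \<in> cyc s t v" "y = f x" by auto
      thus ?case using assms by (intro image_eqI[of _ _ "s x"]) (auto intro: cyc.intros)
    next
      case (cyc_snd y)
      then obtain x where x: "x \<in> cyc s t v" "y = f x" by auto
      thus ?case using assms by (intro image_eqI[of _ _ "t x"]) (auto intro: cyc.intros)
    qed (auto intro: cyc.intros)
  qed
qed

text \<open>Equivariance forces an isomorphism with f v = v' to agree on the cycle of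
  \<open>v\<close> with the one from \<open>cycle_iso_exists\<close>, and every isomorphism of the
  complements can be glued to that one.\<close>

lemma card_isos_fibre:
  assumes fin: "finite V" "finite V'"
    and s: "matching_map bip side V s" and t: "matching_map bip side V t"
    and s': "matching_map bip side V' s'" and t': "matching_map bip side V' t'"
    and v: "v \<in> V" "v' \<in> V'" and side: "bip \<longrightarrow> side v' = side v"
    and card: "card (cyc s t v) = card (cyc s' t' v')"
  shows "card {f \<in> isos bip side V s t V' s' t'. f v = v'} =
    card (isos bip side (V - cyc s t v) s t (V' - cyc s' t' v') s' t')"
proof -
  let ?C = "cyc s t v" and ?C' = "cyc s' t' v'"
  note fp = matching_mapD[OF s] matching_mapD[OF t]
  note fp' = matching_mapD[OF s'] matching_mapD[OF t']
  have sub: "?C \<subseteq> V" "?C' \<subseteq> V'"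
    using cyc_subset[OF fin(1) fp v(1)] cyc_subset[OF fin(2) fp' v(2)] by auto
  have outside: "s x \<in> V - ?C" "t x \<in> V - ?C" if "x \<in> V - ?C" for x
    using fpf_inv_diff_cyc[OF fin(1) fp v(1)] that by (auto simp: fpf_inv_def)
  obtain g where g: "g v = v'" "bij_betw g ?C ?C'"
    "\<And>x. x \<in> ?C \<Longrightarrow> g (s x) = s' (g x) \<and> g (t x) = t' (g x) \<and> (bip \<longrightarrow> side (g x) = side x)"
    using cycle_iso_exists[OF assms] by blast
  have "bij_betw (\<lambda>f. restrict f (V - ?C)) {f \<in> isos bip side V s t V' s' t'. f v = v'}
          (isos bip side (V - ?C) s t (V' - ?C') s' t')"
  proof (rule bij_betw_imageI)
    have uniq: "f x = g x" if "f \<in> isos bip side V s t V' s' t'" "f v = v'" "x \<in> ?C" for f x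
      by (rule equivariant_unique[OF that(3)]) (use that g sub in \<open>auto simp: isos_def\<close>)
    show "inj_on (\<lambda>f. restrict f (V - ?C)) {f \<in> isos bip side V s t V' s' t'. f v = v'}"
    proof (intro inj_onI ext)
      fix f h x
      assume f: "f \<in> {f \<in> isos bip side V s t V' s' t'. f v = v'}"
        and h: "h \<in> {f \<in> isos bip side V s t V' s' t'. f v = v'}"
        and eq: "restrict f (V - ?C) = restrict h (V - ?C)"
      consider "x \<notin> V" | "x \<in> ?C" | "x \<in> V - ?C" by blast
      thus "f x = h x"
      proof cases
        case 1
        thus ?thesis using f h by (auto simp: isos_def extensional_def)
      next
        case 2
        have "f x = g x" by (rule uniq) (use f 2 in auto)
        moreover have "h x = g x" by (rule uniq) (use h 2 in auto)
        ultimately show ?thesis by simp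
      next
        case 3
        thus ?thesis using fun_cong[OF eq, of x] by simp
      qed
    qed
    show "(\<lambda>f. restrict f (V - ?C)) ` {f \<in> isos bip side V s t V' s' t'. f v = v'} =
        isos bip side (V - ?C) s t (V' - ?C') s' t'"
    proof (intro equalityI subsetI)
      fix h assume "h \<in> (\<lambda>f. restrict f (V - ?C)) ` {f \<in> isos bip side V s t V' s' t'. f v = v'}"
      then obtain f where f: "f \<in> isos bip side V s t V' s' t'" "f v = v'"
        and h: "h = restrict f (V - ?C)" by auto
      have "f ` ?C = ?C'"
        using equivariant_image_cyc[of s t v f s' t'] f sub by (auto simp: isos_def)
      moreover have "f ` V = V'" "inj_on f V" using f by (auto simp: isos_def bij_betw_def)
      ultimately have "bij_betw f (V - ?C) (V' - ?C')"
        using sub by (auto simp: bij_betw_def inj_on_image_set_diff[of f V V ?C] intro: inj_on_subset)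
      hence "bij_betw h (V - ?C) (V' - ?C')"
        by (rule bij_betw_cong[THEN iffD1, rotated]) (simp add: h)
      thus "h \<in> isos bip side (V - ?C) s t (V' - ?C') s' t'"
        using f outside unfolding isos_def by (auto simp: h)
    next
      fix h assume h: "h \<in> isos bip side (V - ?C) s t (V' - ?C') s' t'"
      define f where "f = (\<lambda>x. if x \<in> ?C then g x else h x)"
      have "bij_betw f (?C \<union> (V - ?C)) (?C' \<union> (V' - ?C'))"
        unfolding f_def by (rule bij_betw_disjoint_Un) (use g(2) h in \<open>auto simp: isos_def\<close>)
      hence "bij_betw f V V'" using sub by (simp add: Un_absorb1)
      moreover have "f \<in> extensional V"
        using h sub by (auto simp: f_def isos_def extensional_def)
      moreover have "f (s x) = s' (f x) \<and> f (t x) = t' (f x) \<and> (bip \<longrightarrow> side (f x) = side x)"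
        if "x \<in> V" for x
      proof (cases "x \<in> ?C")
        case True
        thus ?thesis using g(3)[of x] cyc_fst[OF True] cyc_snd[OF True] by (simp add: f_def)
      next
        case False
        thus ?thesis using that h outside[of x] by (auto simp: f_def isos_def)
      qed
      moreover have "f v = v'" by (simp add: f_def g cyc_base)
      ultimately have "f \<in> {f \<in> isos bip side V s t V' s' t'. f v = v'}"
        by (simp add: isos_def)
      moreover have "h = restrict f (V - ?C)"
        using h by (auto simp: f_def isos_def extensional_def fun_eq_iff restrict_def)
      ultimately show "h \<in> (\<lambda>f. restrict f (V - ?C)) ` {f \<in> isos bip side V s t V' s' t'. f v = v'}"
        by blast
    qed
  qed
  thus ?thesis by (rule bij_betw_same_card)
qed

text \<open>The candidates for the image of a base point. This is where \<alpha> enters: on a cycle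
  of half-size \<open>k\<close> all 2k vertices qualify for arbitrary matchings, but only the k
  vertices on the prescribed side in the bipartite case.\<close>

lemma card_basepoints:
  assumes fin: "finite V" and s: "matching_map bip side V s" and t: "matching_map bip side V t"
  shows "card {x \<in> V. card (cyc s t x) = 2 * k \<and> (bip \<longrightarrow> side x = z)} =
    (if bip then 1 else 2) * k * count (ctype V s t) k"
proof -
  note fp = matching_mapD[OF s] matching_mapD[OF t]
  let ?K = "{C \<in> cyc s t ` V. card C div 2 = k}"
  have even: "\<exists>p. card (cyc s t v) = 2 * p" if "v \<in> V" for v
    using period_exists[OF fin fp that] card_cyc[OF fin fp that] by metis
  have "{x \<in> V. card (cyc s t x) = 2 * k \<and> (bip \<longrightarrow> side x = z)} = (\<Union>C\<in>?K. {x \<in> C. bip \<longrightarrow> side x = z})"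
  proof (intro equalityI subsetI)
    fix x assume "x \<in> {x \<in> V. card (cyc s t x) = 2 * k \<and> (bip \<longrightarrow> side x = z)}"
    thus "x \<in> (\<Union>C\<in>?K. {x \<in> C. bip \<longrightarrow> side x = z})"
      by (intro UN_I[of "cyc s t x"]) (auto intro: cyc_base)
  next
    fix x assume "x \<in> (\<Union>C\<in>?K. {x \<in> C. bip \<longrightarrow> side x = z})"
    then obtain v where v: "v \<in> V" "card (cyc s t v) div 2 = k" "x \<in> cyc s t v" "bip \<longrightarrow> side x = z"
      by auto
    thus "x \<in> {x \<in> V. card (cyc s t x) = 2 * k \<and> (bip \<longrightarrow> side x = z)}"
      using even[OF v(1)] cyc_eq[OF fin fp v(1,3)] cyc_subset[OF fin fp v(1)] by auto
  qed
  also have "card \<dots> = (\<Sum>C\<in>?K. card {x \<in> C. bip \<longrightarrow> side x = z})"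
  proof (rule card_UN_disjoint)
    show "finite ?K" using fin by auto
    show "\<forall>C\<in>?K. finite {x \<in> C. bip \<longrightarrow> side x = z}"
      using cyc_subset[OF fin fp] fin by (auto intro!: finite_subset[OF _ fin])
    have "C = D" if "C \<in> ?K" "D \<in> ?K" "x \<in> C" "x \<in> D" for C D x
      using that cyc_eq[OF fin fp] by (metis (no_types, lifting) imageE mem_Collect_eq)
    thus "\<forall>C\<in>?K. \<forall>D\<in>?K. C \<noteq> D \<longrightarrow> {x \<in> C. bip \<longrightarrow> side x = z} \<inter> {x \<in> D. bip \<longrightarrow> side x = z} = {}"
      by blast
  qed
  also have "\<dots> = (\<Sum>C\<in>?K. (if bip then 1 else 2) * k)"
  proof (rule sum.cong[OF refl])
    fix C assume "C \<in> ?K"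
    then obtain v where v: "v \<in> V" "card (cyc s t v) div 2 = k" "C = cyc s t v" by auto
    obtain p where p: "p > 0" "\<forall>i j. rot s t i v = rot s t j v \<longleftrightarrow> i mod p = j mod p"
      using period_exists[OF fin fp v(1)] by blast
    note bij = cyc_eq_image[OF fin fp v(1) p]
    have card: "card C = 2 * p" using card_cyc[OF fin fp v(1) p] v by simp
    hence pk: "p = k" using v by simp
    show "card {x \<in> C. bip \<longrightarrow> side x = z} = (if bip then 1 else 2) * k"
    proof (cases bip)
      case False
      thus ?thesis using card pk by simp
    next
      case True
      have sw: "side (walk s t v i b) = (side v \<noteq> b)" for i b
        using side_walk[of side V s t v i b] s t v(1) True by simp
      have "{x \<in> C. side x = z} = (\<lambda>(i, b). walk s t v i b) ` ({..<p} \<times> {side v \<noteq> z})"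
        (is "?L = ?R")
      proof (intro equalityI subsetI)
        fix x assume x: "x \<in> ?L"
        hence "x \<in> (\<lambda>(i, b). walk s t v i b) ` ({..<p} \<times> UNIV)"
          using bij by (simp add: v(3) bij_betw_def)
        then obtain i b where "i < p" "x = walk s t v i b" by auto
        thus "x \<in> ?R" using x sw[of i b] by (intro image_eqI[of _ _ "(i, b)"]) auto
      next
        fix x assume "x \<in> ?R"
        then obtain i where "i < p" "x = walk s t v i (side v \<noteq> z)" by auto
        thus "x \<in> ?L" using walk_in_cyc[OF fin fp] sw by (auto simp: v(3))
      qed
      moreover have "inj_on (\<lambda>(i, b). walk s t v i b) ({..<p} \<times> {side v \<noteq> z})"
        using bij by (auto simp: bij_betw_def intro: inj_on_subset)
      ultimately have "card {x \<in> C. side x = z} = p" by (simp add: card_image card_cartesian_product)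
      thus ?thesis using True pk by simp
    qed
  qed
  also have "\<dots> = (if bip then 1 else 2) * k * card ?K" by simp
  also have "card ?K = count (ctype V s t) k"
  proof -
    have "count (ctype V s t) k = card ((\<lambda>C. card C div 2) -` {k} \<inter> cyc s t ` V)"
      using fin by (simp add: ctype_def count_image_mset)
    thus ?thesis by (simp add: Int_def vimage_def conj_commute)
  qed
  finally show ?thesis .
qed

lemma zee_prod_superset:
  assumes "finite S" "set_mset lam \<subseteq> S"
  shows "zee lam = (\<Prod>i\<in>S. fact (count lam i) * i ^ count lam i)"
  unfolding zee_def by (rule prod.mono_neutral_left) (use assms in \<open>auto simp: not_in_iff\<close>)

text \<open>The recursion that mirrors the removal of one cycle: the factors are the number of
  rotations of a cycle of half-size \<open>k\<close> and the number of such cycles.\<close>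

lemma zee_add_mset: "zee (add_mset k lam) = k * Suc (count lam k) * zee lam"
proof -
  let ?S = "insert k (set_mset lam)" and ?h = "\<lambda>lam i. fact (count lam i) * i ^ count lam i :: nat"
  have rest: "(\<Prod>i\<in>?S - {k}. ?h (add_mset k lam) i) = (\<Prod>i\<in>?S - {k}. ?h lam i)"
    by (rule prod.cong) auto
  have "zee (add_mset k lam) = ?h (add_mset k lam) k * (\<Prod>i\<in>?S - {k}. ?h lam i)"
    unfolding rest[symmetric] by (subst prod.remove[symmetric]) (auto simp: zee_prod_superset[of ?S])
  also have "?h (add_mset k lam) k = k * Suc (count lam k) * ?h lam k" by (simp add: algebra_simps)
  also have "\<dots> * (\<Prod>i\<in>?S - {k}. ?h lam i) = k * Suc (count lam k) * (\<Prod>i\<in>?S. ?h lam i)"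
    by (subst (2) prod.remove[of _ k]) (auto simp: mult.assoc)
  also have "(\<Prod>i\<in>?S. ?h lam i) = zee lam" by (rule zee_prod_superset[symmetric]) auto
  finally show ?thesis .
qed

lemma finite_isos:
  assumes "finite V" "finite V'" shows "finite (isos bip side V s t V' s' t')"
proof (rule finite_subset)
  show "isos bip side V s t V' s' t' \<subseteq> V \<rightarrow>\<^sub>E V'"
    by (auto simp: isos_def PiE_def bij_betw_def)
  show "finite (V \<rightarrow>\<^sub>E V')" using assms by (intro finite_PiE) auto
qed

text \<open>Fix a vertex \<open>v\<close> on a cycle of half-size \<open>k\<close>: an isomorphism is determined on this cycle by the image
  of \<open>v\<close>, for which there are \<open>\<alpha> k m\<^sub>k\<close> choices, and is arbitrary on the remaining cycles.\<close>

lemma card_isos: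
  assumes "finite V" "finite V'"
    and "matching_map bip side V s" "matching_map bip side V t"
    and "matching_map bip side V' s'" "matching_map bip side V' t'"
    and "ctype V s t = ctype V' s' t'"
  shows "card (isos bip side V s t V' s' t') =
    zee (ctype V s t) * (if bip then 1 else 2) ^ size (ctype V s t)"
  using assms
proof (induction "card V" arbitrary: V V' rule: less_induct)
  case less
  note fin = less.prems(1,2) and mm = less.prems(3,4) and mm' = less.prems(5,6)
  note fp = matching_mapD[OF mm(1)] matching_mapD[OF mm(2)]
  note fp' = matching_mapD[OF mm'(1)] matching_mapD[OF mm'(2)]
  show ?case
  proof (cases "V = {}")
    case True
    have "ctype V' s' t' = {#}" using less.prems(7) True by (simp add: ctype_def)
    hence "V' = {}" using fin(2) by (simp add: ctype_def mset_set_empty_iff)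
    hence "isos bip side V s t V' s' t' = {\<lambda>_. undefined}"
      using True by (auto simp: isos_def bij_betw_def)
    thus ?thesis using True by (simp add: ctype_def zee_def)
  next
    case False
    then obtain v where v: "v \<in> V" by blast
    let ?a = "if bip then 1 else 2 :: nat"
    define C where "C = cyc s t v"
    obtain k where k: "card C = 2 * k"
      using period_exists[OF fin(1) fp v] card_cyc[OF fin(1) fp v] unfolding C_def by metis
    define lam where "lam = ctype (V - C) s t"
    have lam: "ctype V s t = add_mset k lam"
      using ctype_diff_cyc[OF fin(1) fp v] k by (simp add: lam_def C_def)
    define B where "B = {x \<in> V'. card (cyc s' t' x) = 2 * k \<and> (bip \<longrightarrow> side x = side v)}"
    have cardB: "card B = ?a * k * Suc (count lam k)"
      unfolding B_def card_basepoints[OF fin(2) mm'] less.prems(7)[symmetric] lam by simp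
    let ?I = "isos bip side V s t V' s' t'"
    have fibre: "card {f \<in> ?I. f v = v'} = zee lam * ?a ^ size lam" if v': "v' \<in> B" for v'
    proof -
      have v'V: "v' \<in> V'" and side: "bip \<longrightarrow> side v' = side v" and c: "card (cyc s' t' v') = 2 * k"
        using v' by (auto simp: B_def)
      have "v \<in> C" by (simp add: C_def cyc_base)
      hence "card (V - C) < card V" using v fin(1) by (intro psubset_card_mono) auto
      moreover have "matching_map bip side (V - C) s" "matching_map bip side (V - C) t"
        using fpf_inv_diff_cyc[OF fin(1) fp v] mm by (auto simp: matching_map_def C_def)
      moreover have "matching_map bip side (V' - cyc s' t' v') s'"
          "matching_map bip side (V' - cyc s' t' v') t'"
        using fpf_inv_diff_cyc[OF fin(2) fp' v'V] mm' by (auto simp: matching_map_def)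
      moreover have "ctype (V - C) s t = ctype (V' - cyc s' t' v') s' t'"
        using ctype_diff_cyc[OF fin(2) fp' v'V] less.prems(7) lam by (simp add: c lam_def)
      ultimately have "card (isos bip side (V - C) s t (V' - cyc s' t' v') s' t') =
          zee lam * ?a ^ size lam"
        unfolding lam_def using less.hyps fin by blast
      moreover have "card {f \<in> ?I. f v = v'} = card (isos bip side (V - C) s t (V' - cyc s' t' v') s' t')"
        using card_isos_fibre[OF fin mm mm' v v'V side] k c by (simp add: C_def)
      ultimately show ?thesis by simp
    qed
    have "f v \<in> B" if "f \<in> ?I" for f
    proof -
      have sub: "cyc s t v \<subseteq> V" by (rule cyc_subset[OF fin(1) fp v])
      have "f ` cyc s t v = cyc s' t' (f v)"
        by (rule equivariant_image_cyc) (use that sub in \<open>auto simp: isos_def\<close>)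
      moreover have "inj_on f (cyc s t v)"
        using that sub by (auto simp: isos_def bij_betw_def intro: inj_on_subset)
      ultimately have "card (cyc s' t' (f v)) = card (cyc s t v)" by (metis card_image)
      thus ?thesis using that v k by (auto simp: B_def isos_def C_def bij_betw_def)
    qed
    hence "?I = (\<Union>v'\<in>B. {f \<in> ?I. f v = v'})" by auto
    also have "card \<dots> = (\<Sum>v'\<in>B. card {f \<in> ?I. f v = v'})"
    proof (rule card_UN_disjoint)
      show "finite B" using fin by (simp add: B_def)
      show "\<forall>v'\<in>B. finite {f \<in> ?I. f v = v'}" using finite_isos[OF fin] by simp
    qed auto
    also have "\<dots> = card B * (zee lam * ?a ^ size lam)" by (simp add: fibre)
    finally show ?thesis by (simp add: cardB lam zee_add_mset)
  qed
qed

section \<open>Matchings as involutions\<close>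

text \<open>\<open>permutes\<close> fixes the values outside the vertices, so that distinct
  involutions give distinct matchings.\<close>

definition matching_invols :: "bool \<Rightarrow> nat \<Rightarrow> (vertex \<Rightarrow> vertex) set" where
  "matching_invols bip n = {s. s permutes vertices n \<and> matching_map bip isl (vertices n) s}"

definition edges :: "nat \<Rightarrow> (vertex \<Rightarrow> vertex) \<Rightarrow> vertex set set" where
  "edges n s = (\<lambda>x. {x, s x}) ` vertices n"

lemma finite_vertices: "finite (vertices n)"
  by (simp add: vertices_def)

lemma finite_matching_invols: "finite (matching_invols bip n)"
  by (rule finite_subset[OF _ finite_permutations[OF finite_vertices]]) (auto simp: matching_invols_def)

lemma matching_involsD:
  assumes "s \<in> matching_invols bip n"
  shows "s permutes vertices n" "matching_map bip isl (vertices n) s" "fpf_inv (vertices n) s"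
  using assms by (auto simp: matching_invols_def matching_map_def)

lemma matching_invols_invol:
  assumes "s \<in> matching_invols bip n"
  shows "s (s x) = x"
  using matching_involsD(1,3)[OF assms] by (cases "x \<in> vertices n") (auto simp: fpf_inv_def permutes_def)

lemma matching_invols_in: "s \<in> matching_invols bip n \<Longrightarrow> x \<in> vertices n \<Longrightarrow> s x \<in> vertices n \<and> s x \<noteq> x"
  using matching_involsD(3)[of s bip n] by (auto simp: fpf_inv_def)

lemma matching_invols_weaken: "s \<in> matching_invols True n \<Longrightarrow> s \<in> matching_invols bip n"
  by (auto simp: matching_invols_def matching_map_def)

lemma doubleton_in_edges:
  assumes "s \<in> matching_invols bip n"
  shows "{x, y} \<in> edges n s \<longleftrightarrow> x \<in> vertices n \<and> y = s x"
  using matching_invols_invol[OF assms] matching_invols_in[OF assms] by (auto simp: edges_def doubleton_eq_iff)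

lemma edges_inj: "inj_on (edges n) (matching_invols bip n)"
proof (intro inj_onI ext)
  fix s t x assume s: "s \<in> matching_invols bip n" and t: "t \<in> matching_invols bip n" and eq: "edges n s = edges n t"
  show "s x = t x"
  proof (cases "x \<in> vertices n")
    case True
    thus ?thesis using doubleton_in_edges[OF s, of x "s x"] doubleton_in_edges[OF t, of x "s x"] eq by simp
  next
    case False
    thus ?thesis using matching_involsD(1)[OF s] matching_involsD(1)[OF t] by (simp add: permutes_def)
  qed
qed

lemma matching_edges:
  assumes s: "s \<in> matching_invols bip n" shows "matching n (edges n s)"
  unfolding matching_def
proof
  show "partition_on (vertices n) (edges n s)"
  proof (rule partition_onI)
    show "\<Union> (edges n s) = vertices n" using matching_invols_in[OF s] by (auto simp: edges_def)
    fix p q assume "p \<in> edges n s" "q \<in> edges n s" "p \<noteq> q"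
    then obtain x y where xy: "p = {x, s x}" "q = {y, s y}" "{x, s x} \<noteq> {y, s y}"
      by (auto simp: edges_def)
    show "disjnt p q"
    proof -
      have "x \<noteq> y" using xy(3) by auto
      moreover have "x \<noteq> s y" "y \<noteq> s x" using xy(3) matching_invols_invol[OF s] by (metis insert_commute)+
      moreover have "s x \<noteq> s y" using matching_invols_invol[OF s, of x] matching_invols_invol[OF s, of y] \<open>x \<noteq> y\<close> by auto
      ultimately show ?thesis by (auto simp: xy disjnt_def)
    qed
  qed (auto simp: edges_def)
  show "\<forall>e\<in>edges n s. card e = 2"
    using matching_invols_in[OF s] by (force simp: edges_def card_2_iff)
qed

lemma edges_surj:
  assumes d: "matching n d"
  obtains s where "s \<in> matching_invols False n" "edges n s = d"
proof -
  have part: "partition_on (vertices n) d" and c2: "\<And>e. e \<in> d \<Longrightarrow> card e = 2"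
    using d by (auto simp: matching_def)
  have ex: "\<exists>y. y \<noteq> x \<and> {x, y} \<in> d" if x: "x \<in> vertices n" for x
  proof -
    obtain e where e: "e \<in> d" "x \<in> e" using part x by (auto simp: partition_on_def)
    then obtain a b where "e = {a, b}" "a \<noteq> b" using c2 by (meson card_2_iff)
    thus ?thesis using e by (cases "x = a") (auto simp: insert_commute)
  qed
  have uniq: "y = z" if "{x, y} \<in> d" "{x, z} \<in> d" for x y z
  proof -
    have "{x, y} = {x, z}" using disjointD[OF partition_onD2[OF part] that] by auto
    thus ?thesis by (auto simp: doubleton_eq_iff)
  qed
  define s where "s = (\<lambda>x. if x \<in> vertices n then SOME y. y \<noteq> x \<and> {x, y} \<in> d else x)"
  have s: "s x \<noteq> x" "{x, s x} \<in> d" if "x \<in> vertices n" for x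
    using someI_ex[OF ex[OF that]] that by (auto simp: s_def)
  have sV: "s x \<in> vertices n" if "x \<in> vertices n" for x
    using s(2)[OF that] part by (auto simp: partition_on_def)
  have ss: "s (s x) = x" if "x \<in> vertices n" for x
    using s(2)[OF that] s(2)[OF sV[OF that]] uniq by (metis insert_commute)
  have "s permutes vertices n"
    by (rule bij_imp_permutes, rule bij_betwI[where g = s]) (use sV ss in \<open>auto simp: s_def\<close>)
  hence "s \<in> matching_invols False n" using s sV ss by (auto simp: matching_invols_def matching_map_def fpf_inv_def)
  moreover have "edges n s = d"
  proof (intro equalityI subsetI)
    fix e assume "e \<in> edges n s" thus "e \<in> d" using s by (auto simp: edges_def)
  next
    fix e assume e: "e \<in> d"
    then obtain a b where ab: "e = {a, b}" "a \<noteq> b" using c2 by (meson card_2_iff)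
    have "a \<in> vertices n" using part e ab by (auto simp: partition_on_def)
    thus "e \<in> edges n s" using s(2)[of a] uniq[of a b "s a"] e ab by (auto simp: edges_def)
  qed
  ultimately show thesis using that by blast
qed

lemma bipartite_edges_iff:
  assumes s: "s \<in> matching_invols False n"
  shows "bipartite_matching n (edges n s) \<longleftrightarrow> s \<in> matching_invols True n"
proof
  assume b: "bipartite_matching n (edges n s)"
  have "isl (s x) \<noteq> isl x" if "x \<in> vertices n" for x
  proof -
    have "{x, s x} \<in> edges n s" using that by (simp add: edges_def)
    then obtain i j where "{x, s x} = {Inl i, Inr j}" using b unfolding bipartite_matching_def by blast
    thus ?thesis by (auto simp: doubleton_eq_iff)
  qed
  thus "s \<in> matching_invols True n" using s by (simp add: matching_invols_def matching_map_def)
next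
  assume s': "s \<in> matching_invols True n"
  have "\<exists>i j. e = {Inl i, Inr j}" if e: "e \<in> edges n s" for e
  proof -
    obtain x where x: "x \<in> vertices n" "e = {x, s x}" using e by (auto simp: edges_def)
    hence "isl (s x) \<noteq> isl x" using s' by (auto simp: matching_invols_def matching_map_def)
    thus ?thesis unfolding x(2) by (cases x; cases "s x") (auto simp: insert_commute)
  qed
  thus "bipartite_matching n (edges n s)"
    using matching_edges[OF s] by (simp add: bipartite_matching_def)
qed

lemma bij_edges: "bij_betw (edges n) (matching_invols bip n) {d. if bip then bipartite_matching n d else matching n d}"
proof (rule bij_betw_imageI[OF edges_inj], intro equalityI subsetI)
  fix d assume "d \<in> edges n ` matching_invols bip n"
  then obtain s where "s \<in> matching_invols bip n" "d = edges n s" by auto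
  moreover from this(1) have "s \<in> matching_invols False n" by (auto simp: matching_invols_def matching_map_def)
  ultimately show "d \<in> {d. if bip then bipartite_matching n d else matching n d}"
    using bipartite_edges_iff[of s n] matching_edges[of s bip n] by (cases bip) auto
next
  fix d assume d: "d \<in> {d. if bip then bipartite_matching n d else matching n d}"
  hence "matching n d" by (auto simp: bipartite_matching_def split: if_splits)
  then obtain s where "s \<in> matching_invols False n" "edges n s = d" using edges_surj by blast
  thus "d \<in> edges n ` matching_invols bip n"
    using d bipartite_edges_iff[of s n] by (cases bip) (auto intro: rev_image_eqI)
qed

text \<open>Reachability along edges is generated by the two partner maps, so connected components
  are orbits. The flags are separate because a bipartite matching gets compared with an arbitrary
  one.\<close>

lemma coset_type_edges:
  assumes s: "s \<in> matching_invols bip n" and t: "t \<in> matching_invols bip' n"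
  shows "coset_type n (edges n s) (edges n t) = ctype (vertices n) s t"
proof -
  let ?R = "{(x, y). {x, y} \<in> edges n s \<union> edges n t}"
  have R: "(x, y) \<in> ?R \<longleftrightarrow> x \<in> vertices n \<and> (y = s x \<or> y = t x)" for x y
    using doubleton_in_edges[OF s, of x y] doubleton_in_edges[OF t, of x y] by auto
  have "?R\<^sup>* `` {x} = cyc s t x" if x: "x \<in> vertices n" for x
  proof (intro equalityI subsetI)
    fix y assume "y \<in> ?R\<^sup>* `` {x}"
    hence "(x, y) \<in> ?R\<^sup>*" by simp
    thus "y \<in> cyc s t x"
      by induction (use R in \<open>auto intro: cyc.intros\<close>)
  next
    fix y assume "y \<in> cyc s t x"
    hence "(x, y) \<in> ?R\<^sup>* \<and> y \<in> vertices n"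
    proof induction
      case (cyc_fst y)
      thus ?case using R[of y "s y"] matching_invols_in[OF s] by (meson rtrancl.rtrancl_into_rtrancl)
    next
      case (cyc_snd y)
      thus ?case using R[of y "t y"] matching_invols_in[OF t] by (meson rtrancl.rtrancl_into_rtrancl)
    qed (simp add: x)
    thus "y \<in> ?R\<^sup>* `` {x}" by simp
  qed
  hence "components n (edges n s \<union> edges n t) = cyc s t ` vertices n"
    unfolding components_def quotient_def by auto
  thus ?thesis by (simp add: coset_type_def ctype_def)
qed

lemma cyc_commute: "cyc s t x = cyc t s x"
proof -
  have "y \<in> cyc t s x" if "y \<in> cyc s t x" for s t y
    using that by induction (auto intro: cyc.intros)
  thus ?thesis by blast
qed

lemma ctype_commute: "ctype V s t = ctype V t s"
  unfolding ctype_def cyc_commute[of s t] ..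

section \<open>Relabelling the vertices by conjugation\<close>

definition conj_by :: "('a \<Rightarrow> 'a) \<Rightarrow> ('a \<Rightarrow> 'a) \<Rightarrow> 'a \<Rightarrow> 'a" where
  "conj_by g s = g \<circ> s \<circ> inv g"

lemma conj_by_apply: "bij g \<Longrightarrow> conj_by g s (g x) = g (s x)"
  by (simp add: conj_by_def bij_is_inj)

lemma conj_by_inv: "bij g \<Longrightarrow> conj_by (inv g) (conj_by g s) = s"
  by (simp add: conj_by_def fun_eq_iff bij_is_inj inv_inv_eq)

lemma conj_by_eqI: "bij g \<Longrightarrow> (\<And>x. g (s x) = s' (g x)) \<Longrightarrow> conj_by g s = s'"
  by (auto simp: conj_by_def fun_eq_iff bij_is_surj surj_f_inv_f)

text \<open>The group acting on matchings: all of S_2n, or S_n x S_n when \<open>bip\<close> holds.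
  The stabiliser of one matching is the hyperoctahedral group, respectively a diagonal S_n; these
  are the Gelfand pairs behind \<alpha> = 2 and \<alpha> = 1.\<close>

definition side_perm :: "bool \<Rightarrow> nat \<Rightarrow> (vertex \<Rightarrow> vertex) \<Rightarrow> bool" where
  "side_perm bip n g \<longleftrightarrow> g permutes vertices n \<and> (bip \<longrightarrow> (\<forall>x\<in>vertices n. isl (g x) = isl x))"

lemma side_perm_bij: "side_perm bip n g \<Longrightarrow> bij g"
  by (auto simp: side_perm_def intro: permutes_bij)

lemma side_perm_inv:
  assumes "side_perm bip n g" shows "side_perm bip n (inv g)"
proof -
  have g: "g permutes vertices n" using assms by (simp add: side_perm_def)
  have "isl (inv g x) = isl x" if "bip" "x \<in> vertices n" for x
  proof -
    have "inv g x \<in> vertices n" using permutes_inv[OF g] that by (simp add: permutes_in_image)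
    thus ?thesis using assms that permutes_inverses(1)[OF g, of x] unfolding side_perm_def by metis
  qed
  thus ?thesis using permutes_inv[OF g] by (simp add: side_perm_def)
qed

lemma conj_by_matching_invols:
  assumes g: "side_perm bip n g" and s: "s \<in> matching_invols bip n" shows "conj_by g s \<in> matching_invols bip n"
proof -
  have gp: "g permutes vertices n" using g by (simp add: side_perm_def)
  have "conj_by g s permutes vertices n"
    unfolding conj_by_def by (intro permutes_compose permutes_inv gp matching_involsD(1)[OF s])
  moreover have "matching_map bip isl (vertices n) (conj_by g s)"
    unfolding matching_map_def fpf_inv_def
  proof (intro conjI ballI impI)
    fix y assume y: "y \<in> vertices n"
    define x where "x = inv g y"
    have yx: "y = g x" using permutes_inverses(1)[OF gp] by (simp add: x_def)
    have x: "x \<in> vertices n" using y permutes_in_image[OF gp] by (simp add: yx)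
    note [simp] = yx conj_by_apply[OF side_perm_bij[OF g]]
    have sx: "s x \<in> vertices n" "s x \<noteq> x" using matching_invols_in[OF s x] by auto
    show "conj_by g s y \<in> vertices n" using sx permutes_in_image[OF gp] by simp
    show "conj_by g s (conj_by g s y) = y" using matching_invols_invol[OF s] by simp
    show "conj_by g s y \<noteq> y" using sx permutes_inj[OF gp] by (simp add: inj_eq)
    show "isl (conj_by g s y) \<noteq> isl y" if bip
      using g s that x sx by (simp add: side_perm_def matching_invols_def matching_map_def)
  qed
  ultimately show ?thesis by (simp add: matching_invols_def)
qed

lemma conj_by_bij:
  assumes g: "side_perm bip n g" shows "bij_betw (conj_by g) (matching_invols bip n) (matching_invols bip n)"
proof (rule bij_betwI[where g = "conj_by (inv g)"])
  show "conj_by g \<in> matching_invols bip n \<rightarrow> matching_invols bip n" using conj_by_matching_invols[OF g] by blast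
  show "conj_by (inv g) \<in> matching_invols bip n \<rightarrow> matching_invols bip n" using conj_by_matching_invols[OF side_perm_inv[OF g]] by blast
  show "conj_by (inv g) (conj_by g s) = s" for s by (rule conj_by_inv[OF side_perm_bij[OF g]])
  show "conj_by g (conj_by (inv g) s) = s" for s
    using conj_by_inv[OF side_perm_bij[OF side_perm_inv[OF g]]] by (simp add: inv_inv_eq[OF side_perm_bij[OF g]])
qed

lemma ctype_conj_by:
  assumes g: "g permutes V"
  shows "ctype V (conj_by g s) (conj_by g t) = ctype V s t"
proof -
  have b: "bij g" using g by (rule permutes_bij)
  have "cyc (conj_by g s) (conj_by g t) (g x) = g ` cyc s t x" for x
    by (rule equivariant_image_cyc[symmetric]) (simp add: conj_by_apply[OF b])
  hence "(\<lambda>x. cyc (conj_by g s) (conj_by g t) (g x)) ` V = (`) g ` (cyc s t ` V)"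
    by (simp add: image_image)
  hence eq: "cyc (conj_by g s) (conj_by g t) ` V = (`) g ` (cyc s t ` V)"
    using permutes_image[OF g] by (metis image_image)
  have "inj_on ((`) g) (cyc s t ` V)" by (auto simp: inj_on_def inj_image_eq_iff[OF bij_is_inj[OF b]])
  thus ?thesis unfolding ctype_def eq
    by (simp add: image_mset_mset_set[symmetric] multiset.map_comp comp_def
        card_image[OF inj_on_subset[OF bij_is_inj[OF b]]])
qed

text \<open>Turns an isomorphism of pairs into an element of the acting group, so that pairs of
  equal type lie in one orbit.\<close>

lemma iso_permutation:
  assumes s: "s \<in> matching_invols bip n" and t: "t \<in> matching_invols bip n" and s': "s' \<in> matching_invols bip n" and t': "t' \<in> matching_invols bip n"
    and f: "f \<in> isos bip isl (vertices n) s t (vertices n) s' t'"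
  defines "g \<equiv> \<lambda>x. if x \<in> vertices n then f x else x"
  shows "side_perm bip n g" "conj_by g s = s'" "conj_by g t = t'"
proof -
  have "bij_betw g (vertices n) (vertices n)"
    using f by (auto simp: isos_def g_def cong: bij_betw_cong)
  hence g: "g permutes vertices n" by (rule bij_imp_permutes) (simp add: g_def)
  show "side_perm bip n g" using g f by (simp add: side_perm_def isos_def g_def)
  have out: "h x = x" if "h \<in> matching_invols bip n" "x \<notin> vertices n" for h x
    using matching_involsD(1)[OF that(1)] that(2) by (simp add: permutes_def)
  have eqv: "g (h x) = h' (g x)"
    if "h \<in> matching_invols bip n" "h' \<in> matching_invols bip n" "\<And>x. x \<in> vertices n \<Longrightarrow> f (h x) = h' (f x)" for h h' x
    using that matching_invols_in[OF that(1), of x] out[of h x] out[of h' x] by (simp add: g_def)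
  show "conj_by g s = s'" "conj_by g t = t'"
    by (rule conj_by_eqI[OF permutes_bij[OF g]], rule eqv; use s t s' t' f in \<open>simp add: isos_def\<close>)+
qed

section \<open>The numbers a^lam_(mu,nu) as structure constants of involutions\<close>

definition num_middle :: "bool \<Rightarrow> nat \<Rightarrow> (vertex \<Rightarrow> vertex) \<Rightarrow> (vertex \<Rightarrow> vertex) \<Rightarrow> nat multiset \<Rightarrow> nat multiset \<Rightarrow> nat" where
  "num_middle bip n s t mu nu =
     card {u \<in> matching_invols bip n. ctype (vertices n) s u = mu \<and> ctype (vertices n) u t = nu}"

lemma card_matchings_eq_num_middle:
  assumes s: "s \<in> matching_invols bip' n" and t: "t \<in> matching_invols bip' n"
  shows "card {d. (if bip then bipartite_matching n d else matching n d) \<and>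
      coset_type n (edges n s) d = mu \<and> coset_type n d (edges n t) = nu} = num_middle bip n s t mu nu"
proof -
  have "bij_betw (edges n) {u \<in> matching_invols bip n. ctype (vertices n) s u = mu \<and> ctype (vertices n) u t = nu}
     {d \<in> {d. if bip then bipartite_matching n d else matching n d}.
        coset_type n (edges n s) d = mu \<and> coset_type n d (edges n t) = nu}"
    by (rule bij_betw_Collect[OF bij_edges]) (simp add: coset_type_edges[OF s] coset_type_edges[OF _ t])
  from bij_betw_same_card[OF this] show ?thesis by (simp add: num_middle_def)
qed

text \<open>Two roles meet here: the squared norm of \<open>p_lam\<close> for \<alpha> = 1 or 2, and
  the number of automorphisms of a pair of matchings of type \<open>lam\<close>.\<close>

definition zeta :: "bool \<Rightarrow> nat multiset \<Rightarrow> nat" where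
  "zeta bip lam = zee lam * (if bip then 1 else 2) ^ size lam"

lemma card_isos_matching_invols:
  assumes "s \<in> matching_invols bip n" "t \<in> matching_invols bip n" "s' \<in> matching_invols bip n" "t' \<in> matching_invols bip n"
    and "ctype (vertices n) s t = ctype (vertices n) s' t'"
  shows "card (isos bip isl (vertices n) s t (vertices n) s' t') = zeta bip (ctype (vertices n) s t)"
  unfolding zeta_def by (rule card_isos) (use assms finite_vertices matching_involsD in auto)

lemma ctype_in_partitions:
  assumes "s \<in> matching_invols bip n" "t \<in> matching_invols bip' n"
  shows "ctype (vertices n) s t \<in> partitions n"
proof -
  note fp = matching_involsD(3)[OF assms(1)] matching_involsD(3)[OF assms(2)]
  note fin = finite_vertices[of n]
  have even: "\<exists>p>0. card (cyc s t v) = 2 * p" if "v \<in> vertices n" for v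
    using period_exists[OF fin fp that] card_cyc[OF fin fp that] by metis
  have "0 \<notin># ctype (vertices n) s t"
    using even by (force simp: ctype_def fin)
  moreover have "sum_mset (ctype (vertices n) s t) = n"
  proof -
    have "2 * sum_mset (ctype (vertices n) s t) = (\<Sum>C\<in>cyc s t ` vertices n. 2 * (card C div 2))"
      by (simp add: ctype_def sum_unfold_sum_mset[symmetric] sum_distrib_left)
    also have "\<dots> = (\<Sum>C\<in>cyc s t ` vertices n. card C)"
      by (rule sum.cong) (use even in fastforce)+
    also have "\<dots> = card (\<Union> (cyc s t ` vertices n))"
    proof (rule card_Union_disjoint[symmetric])
      show "pairwise disjnt (cyc s t ` vertices n)"
        unfolding pairwise_def disjnt_def
      proof (intro ballI impI equals0I)
        fix C D x assume "C \<in> cyc s t ` vertices n" "D \<in> cyc s t ` vertices n" "C \<noteq> D" "x \<in> C \<inter> D"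
        moreover from this obtain v w where "v \<in> vertices n" "C = cyc s t v" "w \<in> vertices n" "D = cyc s t w"
          by blast
        ultimately show False using cyc_eq[OF fin fp, of v x] cyc_eq[OF fin fp, of w x] by simp
      qed
      show "finite C" if "C \<in> cyc s t ` vertices n" for C
        using that cyc_subset[OF fin fp] fin by (auto intro: finite_subset)
    qed
    also have "\<Union> (cyc s t ` vertices n) = vertices n"
      using cyc_subset[OF fin fp] by (auto intro: cyc_base)
    also have "card (vertices n) = 2 * n" by (simp add: vertices_def card_Plus)
    finally show ?thesis by simp
  qed
  ultimately show ?thesis by (simp add: partitions_def)
qed

lemma zeta_pos: "lam \<in> partitions n \<Longrightarrow> zeta bip lam > 0"
  using zee_pos by (simp add: zeta_def)

text \<open>The positive number of isomorphisms yields a relabelling that fixes \<open>s\<close> and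
  takes \<open>t\<close> to \<open>t'\<close>; conjugation by it carries the middle matchings
  over.\<close>

lemma num_middle_cong:
  assumes s: "s \<in> matching_invols bip n" and t: "t \<in> matching_invols bip n" and t': "t' \<in> matching_invols bip n"
    and eq: "ctype (vertices n) s t = ctype (vertices n) s t'"
  shows "num_middle bip n s t mu nu = num_middle bip n s t' mu nu"
proof -
  have "card (isos bip isl (vertices n) s t (vertices n) s t') > 0"
    using card_isos_matching_invols[OF s t s t' eq] zeta_pos[OF ctype_in_partitions[OF s t]] by simp
  then obtain f where f: "f \<in> isos bip isl (vertices n) s t (vertices n) s t'"
    by (metis card.empty ex_in_conv less_numeral_extra(3))
  obtain g where g: "side_perm bip n g" "conj_by g s = s" "conj_by g t = t'"
    using iso_permutation[OF s t s t' f] by blast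
  have gp: "g permutes vertices n" using g by (simp add: side_perm_def)
  have "bij_betw (conj_by g) {u \<in> matching_invols bip n. ctype (vertices n) s u = mu \<and> ctype (vertices n) u t = nu}
      {u \<in> matching_invols bip n. ctype (vertices n) s u = mu \<and> ctype (vertices n) u t' = nu}"
    by (rule bij_betw_Collect[OF conj_by_bij[OF g(1)]])
      (use ctype_conj_by[OF gp] g(2,3) in metis)
  from bij_betw_same_card[OF this] show ?thesis by (simp add: num_middle_def)
qed

text \<open>With \<open>lam\<close> varying, this says that the number of \<open>u\<close> of type \<open>\<lambda>\<close> relative to \<open>s\<close> is proportional to
  \<open>1 / (z\<^sub>\<lambda> \<alpha>\<^bsup>\<ell>(\<lambda>)\<^esup>)\<close>.\<close>

lemma card_class:
  assumes s: "s \<in> matching_invols bip n" and t: "t \<in> matching_invols bip n" and lam: "ctype (vertices n) s t = lam"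
  shows "card {u \<in> matching_invols bip n. ctype (vertices n) s u = lam} * zeta bip lam =
    zeta bip (ctype (vertices n) s s)"
proof -
  let ?V = "vertices n" let ?B = "{u \<in> matching_invols bip n. ctype (vertices n) s u = lam}"
  \<comment> \<open>Orbit-stabiliser: the automorphisms of \<open>s\<close> are sorted by the
    matching \<open>u\<close> to which they send \<open>t\<close>.\<close>
  have "isos bip isl ?V s s ?V s s = (\<Union>u\<in>?B. isos bip isl ?V s t ?V s u)"
  proof (intro equalityI subsetI)
    fix f assume f: "f \<in> isos bip isl ?V s s ?V s s"
    define g where "g = (\<lambda>x. if x \<in> ?V then f x else x)"
    have g: "side_perm bip n g" "conj_by g s = s"
      using iso_permutation[OF s s s s f] unfolding g_def by blast+
    have "conj_by g t \<in> ?B"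
      using conj_by_matching_invols[OF g(1) t] ctype_conj_by[of g ?V s t] g lam by (simp add: side_perm_def)
    moreover have "f \<in> isos bip isl ?V s t ?V s (conj_by g t)"
    proof -
      have "f (t x) = conj_by g t (f x)" if "x \<in> ?V" for x
        using conj_by_apply[OF side_perm_bij[OF g(1)], of t x] that matching_invols_in[OF t that] by (simp add: g_def)
      thus ?thesis using f by (simp add: isos_def)
    qed
    ultimately show "f \<in> (\<Union>u\<in>?B. isos bip isl ?V s t ?V s u)" by blast
  next
    fix f assume "f \<in> (\<Union>u\<in>?B. isos bip isl ?V s t ?V s u)"
    thus "f \<in> isos bip isl ?V s s ?V s s" by (auto simp: isos_def)
  qed
  moreover have "card (\<Union>u\<in>?B. isos bip isl ?V s t ?V s u) = (\<Sum>u\<in>?B. card (isos bip isl ?V s t ?V s u))"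
  proof (rule card_UN_disjoint)
    show "finite ?B" using finite_matching_invols by simp
    show "\<forall>u\<in>?B. finite (isos bip isl ?V s t ?V s u)" using finite_isos finite_vertices by blast
    have "u = w" if u: "u \<in> ?B" and w: "w \<in> ?B"
      and f: "f \<in> isos bip isl ?V s t ?V s u" "f \<in> isos bip isl ?V s t ?V s w" for u w f
      using iso_permutation(3)[OF s t s _ f(1)] iso_permutation(3)[OF s t s _ f(2)] u w by simp
    thus "\<forall>u\<in>?B. \<forall>w\<in>?B. u \<noteq> w \<longrightarrow> isos bip isl ?V s t ?V s u \<inter> isos bip isl ?V s t ?V s w = {}"
      by blast
  qed
  moreover have "card (isos bip isl ?V s t ?V s u) = zeta bip lam" if "u \<in> ?B" for u
    using card_isos_matching_invols[OF s t s, of u] that lam by auto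
  ultimately show ?thesis using card_isos_matching_invols[OF s s s s refl] by simp
qed

text \<open>Self-adjointness of multiplication by a class sum with respect to \<open>\<langle>\<cdot>,\<cdot>\<rangle>\<^sub>\<alpha>\<close>.\<close>

lemma num_middle_swap:
  assumes s: "s \<in> matching_invols bip n" and t: "t \<in> matching_invols bip n" and u: "u \<in> matching_invols bip n"
    and lam: "ctype (vertices n) s t = lam" and nu: "ctype (vertices n) s u = nu"
  shows "zeta bip nu * num_middle bip n s t nu mu = zeta bip lam * num_middle bip n s u lam mu"
proof -
  let ?V = "vertices n" and ?M = "matching_invols bip n"
  let ?B = "\<lambda>lam. {t \<in> ?M. ctype ?V s t = lam}"
  \<comment> \<open>Double counting of the pairs (t, u) with types \<open>lam\<close> and
    \<open>nu\<close> relative to \<open>s\<close> and type \<open>mu\<close> relative to each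
    other, a condition that is symmetric under swapping the two.\<close>
  let ?T = "\<lambda>lam nu. (SIGMA t:?B lam. {u \<in> ?M. ctype ?V s u = nu \<and> ctype ?V u t = mu})"
  have cT: "card (?T lam nu) = card (?B lam) * num_middle bip n s t nu mu"
    if t: "t \<in> ?M" "ctype ?V s t = lam" for t lam nu
  proof -
    have "card (?T lam nu) = (\<Sum>t\<in>?B lam. num_middle bip n s t nu mu)"
      unfolding num_middle_def by (rule card_SigmaI) (use finite_matching_invols in auto)
    also have "\<dots> = (\<Sum>t'\<in>?B lam. num_middle bip n s t nu mu)"
      by (rule sum.cong[OF refl]) (use num_middle_cong[OF s _ t(1)] t(2) in auto)
    finally show ?thesis by simp
  qed
  have "card (?T lam nu) = card (?T nu lam)"
    by (rule bij_betw_same_card[of prod.swap])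
      (auto simp: bij_betw_def inj_on_def ctype_commute[of ?V _ ] image_iff)
  hence "card (?B lam) * num_middle bip n s t nu mu = card (?B nu) * num_middle bip n s u lam mu"
    using cT[OF t lam] cT[OF u nu] by simp
  hence "(card (?B lam) * zeta bip lam) * (zeta bip nu * num_middle bip n s t nu mu) =
      (card (?B nu) * zeta bip nu) * (zeta bip lam * num_middle bip n s u lam mu)"
    by (simp add: algebra_simps)
  thus ?thesis
    using card_class[OF s t lam] card_class[OF s u nu] zeta_pos[OF ctype_in_partitions[OF s s], of bip] by simp
qed

text \<open>A part 1 is a component with two vertices, that is, an edge common to both matchings.
  Hence the class sum of type 1^n acts as the identity.\<close>

lemma ctype_self_iff:
  assumes s: "s \<in> matching_invols bip n" and t: "t \<in> matching_invols bip' n"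
  shows "ctype (vertices n) s t = replicate_mset n 1 \<longleftrightarrow> t = s"
proof
  note fin = finite_vertices[of n]
  note fp = matching_involsD(3)[OF s] matching_involsD(3)[OF t]
  assume eq: "ctype (vertices n) s t = replicate_mset n 1"
  show "t = s"
  proof
    fix x
    show "t x = s x"
    proof (cases "x \<in> vertices n")
      case True
      have "card (cyc s t x) div 2 \<in># ctype (vertices n) s t" using True fin by (auto simp: ctype_def)
      hence "card (cyc s t x) div 2 = 1" using eq by (simp split: if_splits)
      moreover obtain p where "p > 0" "card (cyc s t x) = 2 * p"
        using period_exists[OF fin fp True] card_cyc[OF fin fp True] by blast
      ultimately have "card (cyc s t x) = 2" by simp
      moreover have "{x, s x} \<subseteq> cyc s t x" by (auto intro: cyc.intros)
      moreover have "finite (cyc s t x)" using cyc_subset[OF fin fp True] fin by (rule finite_subset)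
      moreover have "card {x, s x} = 2" using matching_invols_in[OF s True] by (auto simp: card_2_iff)
      ultimately have "cyc s t x = {x, s x}" by (metis card_subset_eq)
      moreover have "t x \<in> cyc s t x" by (auto intro: cyc.intros)
      ultimately show ?thesis using matching_invols_in[OF t True] by auto
    next
      case False
      thus ?thesis using matching_involsD(1)[OF s] matching_involsD(1)[OF t] by (simp add: permutes_def)
    qed
  qed
next
  assume "t = s"
  have c: "cyc s s x = {x, s x}" if "x \<in> vertices n" for x
  proof
    have "y \<in> {x, s x}" if "y \<in> cyc s s x" for y
      using that by induction (auto simp: matching_invols_invol[OF s])
    thus "cyc s s x \<subseteq> {x, s x}" by blast
  qed (auto intro: cyc.intros)
  have "k = 1" if "k \<in># ctype (vertices n) s s" for k
  proof -
    obtain x where x: "x \<in> vertices n" "k = card (cyc s s x) div 2"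
      using \<open>k \<in># _\<close> finite_vertices by (auto simp: ctype_def)
    moreover have "card {x, s x} = 2" using matching_invols_in[OF s x(1)] by (auto simp: card_2_iff)
    ultimately show "k = 1" using c by simp
  qed
  hence "set_mset (ctype (vertices n) s s) \<subseteq> {1}" by blast
  define k where "k = size (ctype (vertices n) s s)"
  have k: "ctype (vertices n) s s = replicate_mset k 1"
    unfolding k_def by (rule set_mset_subset_singletonD) fact
  have "sum_mset (ctype (vertices n) s s) = n"
    using ctype_in_partitions[OF s s] by (simp add: partitions_def)
  hence "k = n" by (simp add: k)
  thus "ctype (vertices n) s t = replicate_mset n 1" using k \<open>t = s\<close> by simp
qed

section \<open>Power sums and colourings\<close>

lemma lookup_const_mult: "Poly_Mapping.lookup (Poly_Mapping.single 0 c * f) e = c * Poly_Mapping.lookup f e"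
  by (simp add: mult_map_scale_conv_mult[symmetric] Poly_Mapping.map.rep_eq when_def)

lemma prod_single:
  "(\<Prod>C\<in>S. Poly_Mapping.single (h C) (1 :: 'b :: comm_semiring_1)) =
     Poly_Mapping.single (\<Sum>C\<in>S. h C :: nat \<Rightarrow>\<^sub>0 nat) 1"
  by (induction S rule: infinite_finite_induct) (simp_all add: mult_single)

text \<open>Expanding the product means choosing a variable, with index \<open>g C\<close>, from
  each factor.\<close>

lemma lookup_prod_power_sum:
  assumes "finite S"
  shows "Poly_Mapping.lookup (\<Prod>C\<in>S. power_sum N (k C)) e =
    of_nat (card {g \<in> S \<rightarrow>\<^sub>E {..<N}. (\<Sum>C\<in>S. Poly_Mapping.single (g C) (k C)) = e})"
proof -
  have "(\<Prod>C\<in>S. power_sum N (k C)) =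
      (\<Sum>g\<in>S \<rightarrow>\<^sub>E {..<N}. Poly_Mapping.single (\<Sum>C\<in>S. Poly_Mapping.single (g C) (k C)) 1)"
    unfolding power_sum_def by (subst prod_sum_PiE) (use assms in \<open>simp_all add: prod_single\<close>)
  moreover have "finite (S \<rightarrow>\<^sub>E {..<N})" using assms by (intro finite_PiE) auto
  ultimately show ?thesis
    by (simp add: lookup_sum lookup_single when_def sum.If_cases Int_def)
qed

lemma mset_parts_desc: "mset (parts_desc lam) = lam"
  by (simp add: parts_desc_def)

lemma length_parts_desc: "length (parts_desc lam) = size lam"
  by (metis mset_parts_desc size_mset)

lemma parts_desc_image: "image_mset ((!) (parts_desc lam)) (mset_set {..<size lam}) = lam"
proof -
  have "mset (map ((!) (parts_desc lam)) [0..<length (parts_desc lam)]) = lam"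
    by (simp only: map_nth mset_parts_desc)
  thus ?thesis by (simp add: length_parts_desc mset_upt atLeast0LessThan)
qed

text \<open>\<open>pcoef N lam e\<close> is the coefficient of \<open>x\<^sup>e\<close> in \<open>p\<^sub>\<lambda>(x\<^sub>0, \<dots>, x\<^sub>N\<^sub>-\<^sub>1)\<close>.\<close>

definition pcoef :: "nat \<Rightarrow> nat multiset \<Rightarrow> (nat \<Rightarrow>\<^sub>0 nat) \<Rightarrow> nat" where
  "pcoef N lam e = card {g \<in> {..<size lam} \<rightarrow>\<^sub>E {..<N}.
     (\<Sum>j<size lam. Poly_Mapping.single (g j) (parts_desc lam ! j)) = e}"

lemma lookup_power_sums:
  "Poly_Mapping.lookup (\<Prod>k\<in>#lam. power_sum N k) e = of_nat (pcoef N lam e)"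
proof -
  have "(\<Prod>k\<in>#lam. power_sum N k) = (\<Prod>j<size lam. power_sum N (parts_desc lam ! j))"
    by (subst parts_desc_image[of lam, symmetric])
      (simp add: prod_unfold_prod_mset multiset.map_comp comp_def)
  thus ?thesis unfolding pcoef_def by (simp add: lookup_prod_power_sum)
qed

lemma pcoef_image_mset:
  assumes "finite S"
  shows "pcoef N (image_mset k (mset_set S)) e =
    card {g \<in> S \<rightarrow>\<^sub>E {..<N}. (\<Sum>C\<in>S. Poly_Mapping.single (g C) (k C)) = e}"
proof -
  have "(\<Prod>k\<in>#image_mset k (mset_set S). power_sum N k) = (\<Prod>C\<in>S. power_sum N (k C))"
    by (simp add: prod_unfold_prod_mset multiset.map_comp comp_def)
  hence "(of_nat (pcoef N (image_mset k (mset_set S)) e) :: ratfun) =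
      of_nat (card {g \<in> S \<rightarrow>\<^sub>E {..<N}. (\<Sum>C\<in>S. Poly_Mapping.single (g C) (k C)) = e})"
    unfolding lookup_power_sums[symmetric] lookup_prod_power_sum[OF assms, symmetric] by simp
  thus ?thesis by (simp only: of_nat_eq_iff)
qed

text \<open>The exponent vector at which the coefficient of the monomial symmetric function of
  \<open>lam\<close> is read off: parts in decreasing order on the variables of index 0, 1, and so
  on.\<close>

definition cexp :: "nat multiset \<Rightarrow> nat \<Rightarrow>\<^sub>0 nat" where
  "cexp lam = (\<Sum>j<size lam. Poly_Mapping.single j (parts_desc lam ! j))"

lemma lookup_sum_single:
  assumes "finite S"
  shows "Poly_Mapping.lookup (\<Sum>j\<in>S. Poly_Mapping.single (g j) (k j)) i = (\<Sum>j\<in>{j\<in>S. g j = i}. k j)"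
  using assms by (simp add: lookup_sum lookup_single when_def sum.If_cases Int_def)

lemma lookup_cexp: "Poly_Mapping.lookup (cexp lam) i = (if i < size lam then parts_desc lam ! i else 0)"
proof -
  have "{j. j < size lam \<and> j = i} = (if i < size lam then {i} else {})" by auto
  thus ?thesis unfolding cexp_def by (subst lookup_sum_single) auto
qed

lemma parts_desc_pos: "0 \<notin># lam \<Longrightarrow> i < size lam \<Longrightarrow> parts_desc lam ! i > 0"
  using nth_mem[of i "parts_desc lam"]
  by (simp add: length_parts_desc flip: set_mset_mset) (metis gr0I mset_parts_desc)

lemma keys_cexp: "0 \<notin># lam \<Longrightarrow> Poly_Mapping.keys (cexp lam) = {..<size lam}"
  using parts_desc_pos by (auto simp: in_keys_iff lookup_cexp split: if_splits)

lemma exponents_cexp: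
  assumes "0 \<notin># lam" shows "exponents (cexp lam) = lam"
proof -
  have "exponents (cexp lam) = image_mset ((!) (parts_desc lam)) (mset_set {..<size lam})"
    unfolding exponents_def keys_cexp[OF assms]
    by (rule image_mset_cong) (simp add: lookup_cexp)
  thus ?thesis by (simp only: parts_desc_image)
qed

lemma size_exponents: "size (exponents e) = card (Poly_Mapping.keys e)"
  by (simp add: exponents_def)

text \<open>The exponents arise from \<open>lam\<close> by adding up the parts that are given the
  same variable; equal length means that no two parts were merged.\<close>

lemma pcoef_nonzero:
  assumes lam: "0 \<notin># lam" and nz: "pcoef N lam e \<noteq> 0"
  shows "size (exponents e) \<le> size lam" "size (exponents e) = size lam \<Longrightarrow> exponents e = lam"
proof -
  let ?S = "{..<size lam}" and ?k = "\<lambda>j. parts_desc lam ! j"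
  obtain g where g: "e = (\<Sum>j<size lam. Poly_Mapping.single (g j) (?k j))"
    using nz unfolding pcoef_def by (metis (mono_tags, lifting) card.empty empty_Collect_eq)
  have le: "Poly_Mapping.lookup e i = (\<Sum>j\<in>{j\<in>?S. g j = i}. ?k j)" for i
    unfolding g by (rule lookup_sum_single) simp
  have keys: "Poly_Mapping.keys e = g ` ?S"
    using parts_desc_pos[OF lam] by (force simp: in_keys_iff le)
  show "size (exponents e) \<le> size lam"
    unfolding size_exponents keys using card_image_le[of ?S g] by simp
  assume "size (exponents e) = size lam"
  hence inj: "inj_on g ?S"
    unfolding size_exponents keys by (intro eq_card_imp_inj_on) auto
  have "exponents e = image_mset (Poly_Mapping.lookup e) (image_mset g (mset_set ?S))"
    unfolding exponents_def keys by (simp add: image_mset_mset_set[OF inj])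
  also have "\<dots> = image_mset ?k (mset_set ?S)"
    unfolding multiset.map_comp
  proof (rule image_mset_cong)
    fix j assume "j \<in># mset_set ?S"
    hence "{i\<in>?S. g i = g j} = {j}" using inj by (auto simp: inj_on_def)
    thus "(Poly_Mapping.lookup e \<circ> g) j = ?k j" by (simp add: le)
  qed
  finally show "exponents e = lam" by (simp only: parts_desc_image)
qed

lemma pcoef_diag:
  assumes "size lam \<le> N" shows "pcoef N lam (cexp lam) > 0"
proof -
  let ?A = "{g \<in> {..<size lam} \<rightarrow>\<^sub>E {..<N}.
     (\<Sum>j<size lam. Poly_Mapping.single (g j) (parts_desc lam ! j)) = cexp lam}"
  have "restrict id {..<size lam} \<in> ?A" using assms by (auto simp: cexp_def)
  moreover have "finite ?A" by (rule finite_subset[of _ "{..<size lam} \<rightarrow>\<^sub>E {..<N}"]) (auto intro: finite_PiE)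
  ultimately show ?thesis unfolding pcoef_def card_gt_0_iff by blast
qed

lemma size_le_partition:
  assumes "lam \<in> partitions n" shows "size lam \<le> n"
proof -
  have "0 \<notin># lam \<Longrightarrow> size lam \<le> sum_mset lam"
    by (induction lam) (auto simp: Suc_le_eq add_less_le_mono add_strict_increasing)
  thus ?thesis using assms by (simp add: partitions_def)
qed

text \<open>\<open>p\<^sub>\<lambda>\<close> only involves monomials with at most \<open>\<ell>(\<lambda>)\<close> variables, and those with exactly \<open>\<ell>(\<lambda>)\<close>
  variables have exponents \<open>\<lambda>\<close>; look at a longest \<open>\<lambda>\<close> with \<open>y\<^sub>\<lambda> \<noteq> 0\<close>.\<close>

lemma power_sum_independent:
  fixes y :: "nat multiset \<Rightarrow> 'a :: {idom, ring_char_0}"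
  assumes y: "\<And>kap. kap \<in> partitions n \<Longrightarrow> (\<Sum>lam\<in>partitions n. y lam * of_nat (pcoef n lam (cexp kap))) = 0"
    and lam: "lam \<in> partitions n"
  shows "y lam = 0"
proof (rule ccontr)
  assume nz: "y lam \<noteq> 0"
  let ?B = "{lam \<in> partitions n. y lam \<noteq> 0}"
  have "finite ?B" "?B \<noteq> {}" using finite_partitions nz lam by auto
  hence "Max (size ` ?B) \<in> size ` ?B" by (intro Max_in) auto
  then obtain mu where mu: "mu \<in> partitions n" "y mu \<noteq> 0" "size mu = Max (size ` ?B)" by auto
  have max: "size la \<le> size mu" if "la \<in> partitions n" "y la \<noteq> 0" for la
    unfolding mu(3) using that \<open>finite ?B\<close> by (intro Max_ge) auto
  have zero: "y la * of_nat (pcoef n la (cexp mu)) = 0" if la: "la \<in> partitions n" "la \<noteq> mu" for la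
  proof (rule ccontr)
    assume "\<not> ?thesis"
    hence la': "y la \<noteq> 0" "pcoef n la (cexp mu) \<noteq> 0" by auto
    have z: "0 \<notin># la" "0 \<notin># mu" using la(1) mu(1) by (auto simp: partitions_def)
    show False using pcoef_nonzero[OF z(1) la'(2)] max[OF la(1) la'(1)] la(2)
      by (simp add: exponents_cexp[OF z(2)])
  qed
  have "(\<Sum>la\<in>partitions n - {mu}. y la * of_nat (pcoef n la (cexp mu))) = 0"
    by (rule sum.neutral) (use zero in blast)
  hence "(\<Sum>la\<in>partitions n. y la * of_nat (pcoef n la (cexp mu))) = y mu * of_nat (pcoef n mu (cexp mu))"
    using sum.remove[OF finite_partitions mu(1), of "\<lambda>la. y la * of_nat (pcoef n la (cexp mu))"] by simp
  thus False using y[OF mu(1)] mu(2) pcoef_diag[OF size_le_partition[OF mu(1)]] by simp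
qed

text \<open>For a bipartite \<open>s\<close>, \<open>lab s x\<close> is the index of the unhatted end of the \<open>s\<close>-edge through \<open>x\<close>, so that
  colourings of the \<open>s\<close>-edges become functions on \<open>{1..n}\<close>.\<close>

definition lab :: "(vertex \<Rightarrow> vertex) \<Rightarrow> vertex \<Rightarrow> nat" where
  "lab s x = projl (if isl x then x else s x)"

lemma Inl_vertices: "Inl i \<in> vertices n \<longleftrightarrow> i \<in> {1..n}" and Inr_vertices: "Inr i \<in> vertices n \<longleftrightarrow> i \<in> {1..n}"
  by (auto simp: vertices_def)

context
  fixes n :: nat and s :: "vertex \<Rightarrow> vertex"
  assumes s: "s \<in> matching_invols True n"
begin

lemma lab_Inl: "lab s (Inl i) = i"
  by (simp add: lab_def)

lemma isl_s: "x \<in> vertices n \<Longrightarrow> isl (s x) \<longleftrightarrow> \<not> isl x"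
  using s by (simp add: matching_invols_def matching_map_def)

lemma Inl_lab: "x \<in> vertices n \<Longrightarrow> Inl (lab s x) = (if isl x then x else s x)"
  using isl_s[of x] by (simp add: lab_def)

lemma lab_in: "x \<in> vertices n \<Longrightarrow> lab s x \<in> {1..n}"
  using Inl_lab[of x] matching_invols_in[OF s, of x] Inl_vertices[of "lab s x" n] by (auto split: if_splits)

lemma lab_s: "x \<in> vertices n \<Longrightarrow> lab s (s x) = lab s x"
  using isl_s[of x] matching_invols_invol[OF s, of x] by (auto simp: lab_def)

lemma lab_cyc: "x \<in> vertices n \<Longrightarrow> Inl (lab s x) \<in> cyc s t x"
  unfolding Inl_lab by (auto intro: cyc.intros)

text \<open>A component of half-size k contains k edges of \<open>s\<close>, so colouring it
  contributes one term of p_k. The coefficient therefore counts colourings \<open>w\<close> of the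
  \<open>s\<close>-edges that are constant along the edges of \<open>t\<close> too.\<close>

lemma pcoef_ctype:
  assumes t: "t \<in> matching_invols bip n"
  shows "pcoef N (ctype (vertices n) s t) e = card {w \<in> {1..n} \<rightarrow>\<^sub>E {..<N}.
     (\<forall>x\<in>vertices n. w (lab s (t x)) = w (lab s x)) \<and> (\<Sum>i\<in>{1..n}. Poly_Mapping.single (w i) 1) = e}"
proof -
  let ?V = "vertices n"
  let ?K = "cyc s t ` ?V"
  note fin = finite_vertices[of n]
  note fp = matching_involsD(3)[OF s] matching_involsD(3)[OF t]
  let ?G = "{g \<in> ?K \<rightarrow>\<^sub>E {..<N}. (\<Sum>C\<in>?K. Poly_Mapping.single (g C) (card C div 2)) = e}"
  let ?W = "{w \<in> {1..n} \<rightarrow>\<^sub>E {..<N}.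
     (\<forall>x\<in>?V. w (lab s (t x)) = w (lab s x)) \<and> (\<Sum>i\<in>{1..n}. Poly_Mapping.single (w i) 1) = e}"
  let ?F = "\<lambda>g. \<lambda>i\<in>{1..n}. g (cyc s t (Inl i))"
  \<comment> \<open>\<open>s\<close> exchanges the hatted and unhatted vertices of a component, so
    half its size is its number of unhatted vertices.\<close>
  have half: "card C div 2 = card {i\<in>{1..n}. cyc s t (Inl i) = C}" if C: "C \<in> ?K" for C
  proof -
    obtain v where v: "v \<in> ?V" "C = cyc s t v" using C by auto
    have CV: "C \<subseteq> ?V" using cyc_subset[OF fin fp] v by simp
    let ?I = "{i\<in>{1..n}. cyc s t (Inl i) = C}"
    have ICeq: "cyc s t x = C" if "x \<in> C" for x using cyc_eq[OF fin fp v(1)] that v(2) by simp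
    have 1: "{x \<in> C. isl x} = (Inl :: nat \<Rightarrow> vertex) ` ?I"
    proof (intro equalityI subsetI)
      fix x assume x: "x \<in> {x \<in> C. isl x}"
      then obtain i where i: "x = Inl i" by (cases x) auto
      moreover have "i \<in> {1..n}" using x CV i Inl_vertices by blast
      ultimately show "x \<in> (Inl :: nat \<Rightarrow> vertex) ` ?I" using x ICeq by auto
    next
      fix x assume "x \<in> (Inl :: nat \<Rightarrow> vertex) ` ?I"
      thus "x \<in> {x \<in> C. isl x}" by (auto intro: cyc_base)
    qed
    have "{x \<in> C. \<not> isl x} = s ` {x \<in> C. isl x}"
    proof (intro equalityI subsetI)
      fix x assume x: "x \<in> {x \<in> C. \<not> isl x}"
      hence "x \<in> ?V" using CV by blast
      hence "isl (s x)" "s x \<in> C" using x isl_s v(2) by (auto intro: cyc_fst)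
      thus "x \<in> s ` {x \<in> C. isl x}" using matching_invols_invol[OF s, of x] by (intro image_eqI[of _ _ "s x"]) auto
    next
      fix x assume "x \<in> s ` {x \<in> C. isl x}"
      then obtain z where "z \<in> C" "isl z" "x = s z" by auto
      thus "x \<in> {x \<in> C. \<not> isl x}" using isl_s[of z] CV v(2) by (auto intro: cyc_fst)
    qed
    moreover have "inj_on s {x \<in> C. isl x}" using matching_invols_invol[OF s] by (auto intro: inj_on_inverseI[of _ s])
    ultimately have "card {x \<in> C. \<not> isl x} = card {x \<in> C. isl x}" by (simp add: card_image)
    moreover have "card C = card {x \<in> C. isl x} + card {x \<in> C. \<not> isl x}"
    proof -
      have "finite C" using CV fin by (rule finite_subset)
      hence "card ({x \<in> C. isl x} \<union> {x \<in> C. \<not> isl x}) = card {x \<in> C. isl x} + card {x \<in> C. \<not> isl x}"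
        by (intro card_Un_disjoint) auto
      moreover have "{x \<in> C. isl x} \<union> {x \<in> C. \<not> isl x} = C" by auto
      ultimately show ?thesis by simp
    qed
    moreover have "card {x \<in> C. isl x} = card ?I" unfolding 1 by (simp add: card_image)
    ultimately show ?thesis by simp
  qed
  have content: "(\<Sum>C\<in>?K. Poly_Mapping.single (g C) (card C div 2)) =
      (\<Sum>i\<in>{1..n}. Poly_Mapping.single (g (cyc s t (Inl i))) 1)" for g :: "vertex set \<Rightarrow> nat"
  proof -
    have const: "(\<Sum>i\<in>I. Poly_Mapping.single c 1) = Poly_Mapping.single c (card I)" for I :: "nat set" and c :: nat
      by (induction I rule: infinite_finite_induct) (simp_all add: single_add[symmetric] del: sum_constant)
    have "(\<Sum>i\<in>{1..n}. Poly_Mapping.single (g (cyc s t (Inl i))) (1::nat)) =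
        (\<Sum>C\<in>?K. \<Sum>i\<in>{i\<in>{1..n}. cyc s t (Inl i) = C}. Poly_Mapping.single (g (cyc s t (Inl i))) 1)"
      by (rule sum.group[symmetric]) (use fin Inl_vertices in auto)
    also have "\<dots> = (\<Sum>C\<in>?K. Poly_Mapping.single (g C) (card C div 2))"
    proof (rule sum.cong[OF refl])
      fix C assume C: "C \<in> ?K"
      have "(\<Sum>i\<in>{i\<in>{1..n}. cyc s t (Inl i) = C}. Poly_Mapping.single (g (cyc s t (Inl i))) (1::nat)) =
          (\<Sum>i\<in>{i\<in>{1..n}. cyc s t (Inl i) = C}. Poly_Mapping.single (g C) 1)"
        by (rule sum.cong) auto
      thus "(\<Sum>i\<in>{i\<in>{1..n}. cyc s t (Inl i) = C}. Poly_Mapping.single (g (cyc s t (Inl i))) (1::nat)) =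
          Poly_Mapping.single (g C) (card C div 2)"
        by (simp only: const half[OF C])
    qed
    finally show ?thesis ..
  qed
  have cyc_lab: "cyc s t (Inl (lab s x)) = cyc s t x" if "x \<in> ?V" for x
    by (rule cyc_eq[OF fin fp that lab_cyc[OF that]])
  have cyc_t: "cyc s t (t x) = cyc s t x" if "x \<in> ?V" for x
    by (rule cyc_eq[OF fin fp that]) (auto intro: cyc.intros)
  have "bij_betw ?F ?G ?W"
  proof (rule bij_betw_imageI)
    show "inj_on ?F ?G"
    proof (intro inj_onI)
      fix g h assume g: "g \<in> ?G" and h: "h \<in> ?G" and eq: "?F g = ?F h"
      show "g = h"
      proof (rule PiE_ext)
        show "g \<in> ?K \<rightarrow>\<^sub>E {..<N}" "h \<in> ?K \<rightarrow>\<^sub>E {..<N}" using g h by auto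
        fix C assume "C \<in> ?K"
        then obtain v where v: "v \<in> ?V" "C = cyc s t v" by auto
        show "g C = h C" using fun_cong[OF eq, of "lab s v"] lab_in[OF v(1)] cyc_lab[OF v(1)] v(2) by simp
      qed
    qed
    show "?F ` ?G = ?W"
    proof (intro equalityI subsetI)
      fix w assume "w \<in> ?F ` ?G"
      then obtain g where g: "g \<in> ?G" and w: "w = ?F g" by auto
      have "w \<in> {1..n} \<rightarrow>\<^sub>E {..<N}" using g Inl_vertices by (auto simp: w)
      moreover have "w (lab s (t x)) = w (lab s x)" if "x \<in> ?V" for x
        using that matching_invols_in[OF t that] lab_in cyc_lab cyc_t by (simp add: w)
      moreover have "(\<Sum>i\<in>{1..n}. Poly_Mapping.single (w i) 1) = e"
        using g content[of g] by (simp add: w)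
      ultimately show "w \<in> ?W" by blast
    next
      fix w assume w: "w \<in> ?W"
      define g where "g = (\<lambda>C\<in>?K. w (lab s (SOME v. v \<in> C)))"
      have const: "w (lab s y) = w (lab s v)" if v: "v \<in> ?V" and "y \<in> cyc s t v" for v y
      proof -
        from that(2) have "w (lab s y) = w (lab s v) \<and> y \<in> ?V"
          by induction (use v w lab_s matching_invols_in[OF s] matching_invols_in[OF t] in auto)
        thus ?thesis ..
      qed
      have g: "g (cyc s t v) = w (lab s v)" if v: "v \<in> ?V" for v
      proof -
        have "(SOME y. y \<in> cyc s t v) \<in> cyc s t v" by (rule someI[of _ v]) (rule cyc_base)
        thus ?thesis using const[OF v] v by (simp add: g_def)
      qed
      have Fg: "?F g = w"
      proof
        fix i show "?F g i = w i"
        proof (cases "i \<in> {1..n}")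
          case True
          thus ?thesis using g[of "Inl i"] Inl_vertices[of i n] by (simp add: lab_Inl)
        next
          case False
          moreover have "w \<in> extensional {1..n}" using w by (auto simp: PiE_def)
          ultimately show ?thesis by (simp add: extensional_def del: atLeastAtMost_iff)
        qed
      qed
      have "g \<in> ?K \<rightarrow>\<^sub>E {..<N}"
      proof (rule PiE_I)
        fix C assume "C \<in> ?K"
        then obtain v where v: "v \<in> ?V" "C = cyc s t v" by auto
        have "w \<in> {1..n} \<rightarrow>\<^sub>E {..<N}" using w by simp
        hence "w (lab s v) \<in> {..<N}" using lab_in[OF v(1)] by (rule PiE_mem)
        thus "g C \<in> {..<N}" using g[OF v(1)] v(2) by simp
      qed (simp add: g_def)
      moreover have "(\<Sum>C\<in>?K. Poly_Mapping.single (g C) (card C div 2)) = e"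
      proof -
        have "(\<Sum>i\<in>{1..n}. Poly_Mapping.single (g (cyc s t (Inl i))) (1::nat)) = (\<Sum>i\<in>{1..n}. Poly_Mapping.single (w i) 1)"
          by (rule sum.cong[OF refl]) (use g Inl_vertices in \<open>auto simp: lab_Inl\<close>)
        thus ?thesis using w by (simp add: content)
      qed
      ultimately have "g \<in> ?G" by blast
      thus "w \<in> ?F ` ?G" using Fg by (intro image_eqI[of _ _ g]) auto
    qed
  qed
  hence "card ?G = card ?W" by (rule bij_betw_same_card)
  moreover have "pcoef N (ctype ?V s t) e = card ?G"
    unfolding ctype_def by (rule pcoef_image_mset) (simp add: fin)
  ultimately show ?thesis by simp
qed

end

section \<open>Antisymmetrised matchings\<close>

text \<open>The Young diagram in (row, column) coordinates starting from 0; a tableau is a bijection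
  from {1..n} onto it.\<close>

definition shape :: "nat multiset \<Rightarrow> (nat \<times> nat) set" where
  "shape nu = (SIGMA r:{..<size nu}. {..<parts_desc nu ! r})"

lemma sum_parts_desc: "(\<Sum>r<size nu. parts_desc nu ! r) = sum_mset nu"
  by (metis (no_types) length_parts_desc mset_parts_desc sum_mset_sum_list atLeast0LessThan sum_list_sum_nth)

lemma tableau_exists:
  assumes "nu \<in> partitions n"
  obtains row col where "bij_betw (\<lambda>i. (row i, col i)) {1..n} (shape nu)"
proof -
  have "card (shape nu) = n"
    using assms by (simp add: shape_def sum_parts_desc partitions_def)
  moreover have "finite (shape nu)" by (simp add: shape_def)
  ultimately obtain h where "bij_betw h {1..n} (shape nu)"
    using ex_bij_betw_nat_finite_1 by blast
  thus thesis using that[of "fst \<circ> h" "snd \<circ> h"] by (simp add: comp_def)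
qed

lemma sum_take_parts_desc:
  "sum_list (take k (parts_desc lam)) = (\<Sum>j<k. Poly_Mapping.lookup (cexp lam) j)"
proof -
  have "sum_list (take k xs) = (\<Sum>j<k. if j < length xs then xs ! j else 0)" for xs :: "nat list"
  proof (induction k)
    case (Suc k)
    thus ?case by (cases "k < length xs") (simp_all add: take_Suc_conv_app_nth)
  qed simp
  thus ?thesis by (simp add: lookup_cexp length_parts_desc)
qed

lemma card_content_less:
  fixes w :: "'a \<Rightarrow> nat"
  assumes "finite I" "(\<Sum>i\<in>I. Poly_Mapping.single (w i) 1) = e"
  shows "card {i \<in> I. w i < k} = (\<Sum>j<k. Poly_Mapping.lookup e j)"
proof -
  have "(\<Sum>j<k. Poly_Mapping.lookup e j) = (\<Sum>j<k. card {i \<in> I. w i = j})"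
    unfolding assms(2)[symmetric] using assms(1) by (simp add: lookup_sum_single)
  also have "\<dots> = card (\<Union>j<k. {i \<in> I. w i = j})"
    by (rule card_UN_disjoint[symmetric]) (use assms(1) in auto)
  also have "(\<Union>j<k. {i \<in> I. w i = j}) = {i \<in> I. w i < k}" by auto
  finally show ?thesis ..
qed

lemma card_by_columns:
  assumes "finite I" "\<And>i. P i \<Longrightarrow> i \<in> I"
  shows "card {i. P i} = (\<Sum>c\<in>col ` I. card {i. P i \<and> col i = c})"
proof -
  have "{i. P i} = (\<Union>c\<in>col ` I. {i. P i \<and> col i = c})" using assms by auto
  also have "card \<dots> = (\<Sum>c\<in>col ` I. card {i. P i \<and> col i = c})"
    by (rule card_UN_disjoint) (use assms in \<open>auto intro: finite_subset[of _ I]\<close>)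
  finally show ?thesis .
qed

lemma row_content:
  fixes row col :: "nat \<Rightarrow> nat"
  assumes "bij_betw (\<lambda>i. (row i, col i)) {1..n} (shape nu)"
  shows "(\<Sum>i\<in>{1..n}. Poly_Mapping.single (row i) 1) = cexp nu"
proof (rule poly_mapping_eqI)
  fix j
  have "Poly_Mapping.lookup (\<Sum>i\<in>{1..n}. Poly_Mapping.single (row i) 1) j = card {i\<in>{1..n}. row i = j}"
    by (simp only: lookup_sum_single[OF finite_atLeastAtMost] card_eq_sum)
  also have "\<dots> = card ((\<lambda>i. (row i, col i)) ` {i\<in>{1..n}. row i = j})"
    using assms by (intro card_image[symmetric]) (auto simp: bij_betw_def intro: inj_on_subset)
  also have "(\<lambda>i. (row i, col i)) ` {i\<in>{1..n}. row i = j} = {x \<in> shape nu. fst x = j}"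
  proof (intro equalityI subsetI)
    fix x assume x: "x \<in> {x \<in> shape nu. fst x = j}"
    then obtain i where "i \<in> {1..n}" "x = (row i, col i)" using assms unfolding bij_betw_def by blast
    thus "x \<in> (\<lambda>i. (row i, col i)) ` {i\<in>{1..n}. row i = j}" using x by auto
  next
    fix x assume "x \<in> (\<lambda>i. (row i, col i)) ` {i\<in>{1..n}. row i = j}"
    thus "x \<in> {x \<in> shape nu. fst x = j}" using assms unfolding bij_betw_def by auto
  qed
  also have "\<dots> = (if j < size nu then {j} \<times> {..<parts_desc nu ! j} else {})"
    by (auto simp: shape_def)
  also have "card \<dots> = Poly_Mapping.lookup (cexp nu) j"
    by (simp add: lookup_cexp card_cartesian_product)
  finally show "Poly_Mapping.lookup (\<Sum>i\<in>{1..n}. Poly_Mapping.single (row i) 1) j = Poly_Mapping.lookup (cexp nu) j" .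
qed

text \<open>In a column, the cells with a colour below \<open>k\<close> number at most
  \<open>k\<close> and at most the column length, hence at most the cells in the top
  \<open>k\<close> rows. Summing over the columns compares the partial sums of the two
  partitions.\<close>

lemma dominated_if_injective_on_columns:
  assumes nu: "nu \<in> partitions n" and kap: "kap \<in> partitions n"
    and tab: "bij_betw (\<lambda>i. (row i, col i)) {1..n} (shape nu)"
    and w: "(\<Sum>i\<in>{1..n}. Poly_Mapping.single (w i) 1) = cexp kap"
    and inj: "\<And>i j. \<lbrakk>i \<in> {1..n}; j \<in> {1..n}; col i = col j; w i = w j\<rbrakk> \<Longrightarrow> i = j"
  shows "dominated kap nu"
  unfolding dominated_def
proof (intro conjI allI)
  show "sum_mset kap = sum_mset nu" using nu kap by (simp add: partitions_def)
  fix k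
  let ?I = "{1..n}"
  have cell: "(row i, col i) \<in> shape nu" if "i \<in> ?I" for i using tab that by (auto simp: bij_betw_def)
  have column: "card {i. (i \<in> ?I \<and> w i < k) \<and> col i = c} \<le> card {i. (i \<in> ?I \<and> row i < k) \<and> col i = c}" for c
  proof (cases "\<exists>i\<in>?I. col i = c \<and> row i \<ge> k")
    case True
    then obtain i where i: "i \<in> ?I" "col i = c" "row i \<ge> k" by blast
    have "{..<k} \<subseteq> row ` {i. (i \<in> ?I \<and> row i < k) \<and> col i = c}"
    proof
      fix r assume r: "r \<in> {..<k}"
      \<comment> \<open>Rows get no longer further down, so a column that reaches row
        \<open>k\<close> or beyond meets all rows above.\<close>
      have "parts_desc nu ! row i \<le> parts_desc nu ! r"
      proof (rule sorted_rev_nth_mono)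
        show "sorted (rev (parts_desc nu))" by (simp add: parts_desc_def)
        show "r \<le> row i" using r i by simp
        show "row i < length (parts_desc nu)"
          using cell[OF i(1)] by (auto simp: shape_def length_parts_desc)
      qed
      hence "(r, c) \<in> shape nu" using cell[OF i(1)] i r by (auto simp: shape_def)
      then obtain j where "j \<in> ?I" "(r, c) = (row j, col j)" using tab unfolding bij_betw_def by blast
      thus "r \<in> row ` {i. (i \<in> ?I \<and> row i < k) \<and> col i = c}" using r by auto
    qed
    hence "k \<le> card {i. (i \<in> ?I \<and> row i < k) \<and> col i = c}"
      using surj_card_le[of "{i. (i \<in> ?I \<and> row i < k) \<and> col i = c}" "{..<k}" row] by simp
    moreover have "card {i. (i \<in> ?I \<and> w i < k) \<and> col i = c} \<le> card {..<k}"
      by (rule card_inj_on_le[of w]) (use inj in \<open>auto simp: inj_on_def\<close>)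
    ultimately show ?thesis by simp
  next
    case False
    thus ?thesis by (intro card_mono) (auto simp: not_le)
  qed
  have "sum_list (take k (parts_desc kap)) = card {i \<in> ?I. w i < k}"
    unfolding sum_take_parts_desc by (rule card_content_less[symmetric, OF _ w]) simp
  also have "\<dots> = (\<Sum>c\<in>col ` ?I. card {i. (i \<in> ?I \<and> w i < k) \<and> col i = c})"
    by (rule card_by_columns) auto
  also have "\<dots> \<le> (\<Sum>c\<in>col ` ?I. card {i. (i \<in> ?I \<and> row i < k) \<and> col i = c})"
    by (rule sum_mono) (rule column)
  also have "\<dots> = card {i \<in> ?I. row i < k}"
    by (rule card_by_columns[symmetric]) auto
  also have "\<dots> = sum_list (take k (parts_desc nu))"
    unfolding sum_take_parts_desc by (rule card_content_less[OF _ row_content[OF tab]]) simp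
  finally show "sum_list (take k (parts_desc kap)) \<le> sum_list (take k (parts_desc nu))" .
qed

section \<open>Column groups and alternating sums\<close>

definition column_group :: "nat \<Rightarrow> (nat \<Rightarrow> nat) \<Rightarrow> (nat \<Rightarrow> nat) set" where
  "column_group n col = {p. p permutes {1..n} \<and> (\<forall>i. col (p i) = col i)}"

lemma finite_column_group: "finite (column_group n col)"
  by (rule finite_subset[OF _ finite_permutations[of "{1..n}"]]) (auto simp: column_group_def)

lemma transpose_column_group:
  assumes "i \<in> {1..n}" "j \<in> {1..n}" "col i = col j" "p \<in> column_group n col"
  shows "Transposition.transpose i j \<circ> p \<in> column_group n col"
proof -
  have "col (Transposition.transpose i j k) = col k" for k
    using assms(3) by (simp add: transpose_def)
  moreover have "Transposition.transpose i j \<circ> p permutes {1..n}"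
    using assms by (intro permutes_compose permutes_swap_id) (auto simp: column_group_def)
  ultimately show ?thesis using assms(4) by (simp add: column_group_def)
qed

text \<open>Composition with the transposition permutes the column group and reverses signs, so the
  sum equals its own negative.\<close>

lemma alternating_sum_eq_0:
  fixes B :: "(nat \<Rightarrow> nat) \<Rightarrow> rat"
  assumes ij: "i \<in> {1..n}" "j \<in> {1..n}" "i \<noteq> j" "col i = col j"
    and B: "\<And>p. p \<in> column_group n col \<Longrightarrow> B (Transposition.transpose i j \<circ> p) = B p"
  shows "(\<Sum>p\<in>column_group n col. of_int (sign p) * B p) = 0"
proof -
  let ?t = "Transposition.transpose i j"
  let ?C = "column_group n col"
  have tt: "?t \<circ> (?t \<circ> p) = p" for p by (simp add: fun_eq_iff)
  have "bij_betw ((\<circ>) ?t) ?C ?C"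
    by (rule bij_betwI[where g = "(\<circ>) ?t"]) (use transpose_column_group[OF ij(1,2,4)] tt in auto)
  hence "(\<Sum>p\<in>?C. of_int (sign p) * B p) = (\<Sum>p\<in>?C. of_int (sign (?t \<circ> p)) * B (?t \<circ> p))"
    by (rule sum.reindex_bij_betw[symmetric])
  also have "\<dots> = (\<Sum>p\<in>?C. - (of_int (sign p) * B p))"
  proof (rule sum.cong[OF refl])
    fix p assume p: "p \<in> ?C"
    hence "permutation p" unfolding column_group_def using permutes_imp_permutation[of "{1..n}"] by auto
    hence "sign (?t \<circ> p) = - sign p" using ij(3) by (simp add: sign_compose permutation_swap_id sign_swap_id)
    thus "of_int (sign (?t \<circ> p)) * B (?t \<circ> p) = - (of_int (sign p) * B p)" using B[OF p] by simp
  qed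
  finally show ?thesis by (simp add: sum_negf)
qed

text \<open>Only the unhatted vertices are permuted. Antisymmetrising over the column group acting in this one-sided way
  serves for \<open>\<alpha> = 1\<close> and for \<open>\<alpha> = 2\<close> alike.\<close>

definition twist :: "(nat \<Rightarrow> nat) \<Rightarrow> vertex \<Rightarrow> vertex" where
  "twist p = map_sum p id"

lemma twist_simps [simp]: "twist p (Inl i) = Inl (p i)" "twist p (Inr i) = Inr i"
  by (simp_all add: twist_def)

lemma twist_comp: "twist (p \<circ> q) = twist p \<circ> twist q"
  by (simp add: twist_def map_sum.comp)

lemma twist_side_perm:
  assumes p: "p permutes {1..n}" shows "side_perm bip n (twist p)"
proof -
  have inv: "twist p (twist (inv p) x) = x" "twist (inv p) (twist p x) = x" for x
    by (cases x; simp add: permutes_inverses[OF p])+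
  have "bij_betw (twist p) (vertices n) (vertices n)"
  proof (rule bij_betwI[where g = "twist (inv p)"])
    have "twist q x \<in> vertices n" if "q permutes {1..n}" "x \<in> vertices n" for q x
      using that(2) permutes_in_image[OF that(1)]
      by (cases x) (simp_all only: twist_simps Inl_vertices Inr_vertices)
    thus "twist p \<in> vertices n \<rightarrow> vertices n" "twist (inv p) \<in> vertices n \<rightarrow> vertices n"
      using p permutes_inv[OF p] by blast+
  qed (use inv in auto)
  moreover have "twist p x = x" if "x \<notin> vertices n" for x
    using that p by (cases x) (auto simp: Inl_vertices permutes_def)
  ultimately have "twist p permutes vertices n" by (rule bij_imp_permutes)
  moreover have "isl (twist p x) = isl x" for x by (cases x) auto
  ultimately show ?thesis by (simp add: side_perm_def)
qed

lemma conj_by_comp: "bij g \<Longrightarrow> bij h \<Longrightarrow> conj_by (g \<circ> h) s = conj_by g (conj_by h s)"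
  by (simp add: conj_by_def o_inv_distrib comp_assoc)

section \<open>Colourings of the edges of the fixed bipartite matching\<close>

definition colourings :: "nat \<Rightarrow> nat multiset \<Rightarrow> (nat \<Rightarrow> nat) set" where
  "colourings n kap = {w \<in> {1..n} \<rightarrow>\<^sub>E {..<n}. (\<Sum>i\<in>{1..n}. Poly_Mapping.single (w i) 1) = cexp kap}"

lemma finite_colourings: "finite (colourings n kap)"
  unfolding colourings_def by (rule finite_subset[of _ "{1..n} \<rightarrow>\<^sub>E {..<n}"]) (auto intro: finite_PiE)

text \<open>\<open>w\<close> colours the edges of \<open>s\<close> through their labels; the
  condition says that it is constant on the components of the union with \<open>t\<close>.\<close>

definition compat :: "nat \<Rightarrow> (vertex \<Rightarrow> vertex) \<Rightarrow> (nat \<Rightarrow> nat) \<Rightarrow> (vertex \<Rightarrow> vertex) \<Rightarrow> bool" where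
  "compat n s w t \<longleftrightarrow> (\<forall>x\<in>vertices n. w (lab s (t x)) = w (lab s x))"

definition num_compat :: "bool \<Rightarrow> nat \<Rightarrow> (vertex \<Rightarrow> vertex) \<Rightarrow> nat multiset \<Rightarrow> (nat \<Rightarrow> nat) \<Rightarrow> (vertex \<Rightarrow> vertex) \<Rightarrow> nat" where
  "num_compat bip n s mu w t = card {u \<in> matching_invols bip n. ctype (vertices n) u t = mu \<and> compat n s w u}"

text \<open>For \<open>mu = 1\<^sup>n\<close> these are the power sum coefficients of the antisymmetrised matchings \<open>e\<^sub>\<nu>\<^sub>'\<close> (up to a factor),
  and for general \<open>mu\<close> those of the product of \<open>e\<^sub>\<nu>\<^sub>'\<close> with the class sum of type \<open>mu\<close>.\<close>

definition alt_num_middle :: "bool \<Rightarrow> nat \<Rightarrow> (vertex \<Rightarrow> vertex) \<Rightarrow> (nat \<Rightarrow> nat) \<Rightarrow> nat multiset \<Rightarrow> nat multiset \<Rightarrow> rat" where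
  "alt_num_middle bip n s col mu lam =
     (\<Sum>p\<in>column_group n col. of_int (sign p) * of_nat (num_middle bip n s (conj_by (twist p) s) lam mu))"

context
  fixes n :: nat and s :: "vertex \<Rightarrow> vertex"
  assumes s: "s \<in> matching_invols True n"
begin

text \<open>The left-hand side is the coefficient of the monomial function of \<open>kap\<close> in
  the image of the power sum of type (s, t) under the class sum of type \<open>mu\<close>. By
  \<open>pcoef_ctype\<close> it counts pairs of a middle matching and a compatible colouring, which
  are then summed in the other order.\<close>

lemma sum_num_middle_pcoef:
  assumes t: "t \<in> matching_invols bip n"
  shows "(\<Sum>lam\<in>partitions n. num_middle bip n s t lam mu * pcoef n lam (cexp kap)) =
    (\<Sum>w\<in>colourings n kap. num_compat bip n s mu w t)"
proof -
  let ?V = "vertices n"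
  let ?U = "{u \<in> matching_invols bip n. ctype ?V u t = mu}"
  have finU: "finite ?U" using finite_matching_invols by simp
  have pc: "pcoef n (ctype ?V s u) (cexp kap) = card {w \<in> colourings n kap. compat n s w u}" if "u \<in> ?U" for u
    using pcoef_ctype[OF s, of u bip n "cexp kap"] that
    by (simp add: colourings_def compat_def conj_ac)
  have "(\<Sum>lam\<in>partitions n. num_middle bip n s t lam mu * pcoef n lam (cexp kap)) =
      (\<Sum>lam\<in>partitions n. \<Sum>u\<in>{u \<in> ?U. ctype ?V s u = lam}. pcoef n (ctype ?V s u) (cexp kap))"
  proof (rule sum.cong[OF refl])
    fix lam
    have "(\<Sum>u\<in>{u \<in> ?U. ctype ?V s u = lam}. pcoef n (ctype ?V s u) (cexp kap)) =
        (\<Sum>u\<in>{u \<in> ?U. ctype ?V s u = lam}. pcoef n lam (cexp kap))"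
      by (rule sum.cong) auto
    thus "num_middle bip n s t lam mu * pcoef n lam (cexp kap) =
        (\<Sum>u\<in>{u \<in> ?U. ctype ?V s u = lam}. pcoef n (ctype ?V s u) (cexp kap))"
      by (simp add: num_middle_def conj_ac)
  qed
  also have "\<dots> = (\<Sum>u\<in>?U. pcoef n (ctype ?V s u) (cexp kap))"
    by (rule sum.group) (use finU finite_partitions ctype_in_partitions[OF s] in auto)
  also have "\<dots> = (\<Sum>u\<in>?U. card {w \<in> colourings n kap. compat n s w u})"
    by (rule sum.cong) (use pc in auto)
  also have "\<dots> = (\<Sum>u\<in>?U. \<Sum>w\<in>colourings n kap. if compat n s w u then 1 else 0)"
    by (simp add: finite_colourings sum.If_cases Int_def)
  also have "\<dots> = (\<Sum>w\<in>colourings n kap. \<Sum>u\<in>?U. if compat n s w u then 1 else 0)"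
    by (rule sum.swap)
  also have "\<dots> = (\<Sum>w\<in>colourings n kap. num_compat bip n s mu w t)"
    using finU by (simp add: num_compat_def sum.If_cases Int_def conj_ac)
  finally show ?thesis .
qed

lemma conj_twist_matching_invols:
  assumes "p \<in> column_group n col" shows "conj_by (twist p) s \<in> matching_invols bip n"
  using conj_by_matching_invols[OF twist_side_perm s, of p] matching_invols_weaken assms by (auto simp: column_group_def)

lemma sum_alt_num_middle_pcoef:
  "(\<Sum>lam\<in>partitions n. alt_num_middle bip n s col mu lam * of_nat (pcoef n lam (cexp kap))) =
    (\<Sum>w\<in>colourings n kap. \<Sum>p\<in>column_group n col.
       of_int (sign p) * of_nat (num_compat bip n s mu w (conj_by (twist p) s)))"
proof -
  have "(\<Sum>lam\<in>partitions n. alt_num_middle bip n s col mu lam * of_nat (pcoef n lam (cexp kap))) =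
     (\<Sum>lam\<in>partitions n. \<Sum>p\<in>column_group n col. of_int (sign p) *
        of_nat (num_middle bip n s (conj_by (twist p) s) lam mu * pcoef n lam (cexp kap)))"
    by (simp add: alt_num_middle_def sum_distrib_right mult.assoc)
  also have "\<dots> = (\<Sum>p\<in>column_group n col. of_int (sign p) * of_nat (\<Sum>lam\<in>partitions n.
        num_middle bip n s (conj_by (twist p) s) lam mu * pcoef n lam (cexp kap)))"
    unfolding of_nat_sum sum_distrib_left by (rule sum.swap)
  also have "\<dots> = (\<Sum>p\<in>column_group n col. of_int (sign p) * of_nat (\<Sum>w\<in>colourings n kap.
        num_compat bip n s mu w (conj_by (twist p) s)))"
    by (rule sum.cong[OF refl]) (simp only: sum_num_middle_pcoef[OF conj_twist_matching_invols])
  also have "\<dots> = (\<Sum>w\<in>colourings n kap. \<Sum>p\<in>column_group n col.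
       of_int (sign p) * of_nat (num_compat bip n s mu w (conj_by (twist p) s)))"
    unfolding of_nat_sum sum_distrib_left by (rule sum.swap)
  finally show ?thesis .
qed

text \<open>Conjugation by the twisted transposition carries one set of counted matchings to the
  other: types are invariant, and compatibility is preserved because \<open>w\<close> does not
  distinguish \<open>i\<close> from \<open>j\<close>.\<close>

lemma num_compat_transpose:
  assumes ij: "i \<in> {1..n}" "j \<in> {1..n}" "w i = w j" and p: "p permutes {1..n}"
  shows "num_compat bip n s mu w (conj_by (twist (Transposition.transpose i j \<circ> p)) s) =
    num_compat bip n s mu w (conj_by (twist p) s)"
proof -
  let ?t = "Transposition.transpose i j" let ?g = "twist ?t"
  have t: "?t permutes {1..n}" using ij by (intro permutes_swap_id)
  have g: "side_perm bip n ?g" by (rule twist_side_perm[OF t])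
  have gp: "?g permutes vertices n" using g by (simp add: side_perm_def)
  have b: "bij ?g" "bij (twist p)" using twist_side_perm[OF t] twist_side_perm[OF p] side_perm_bij by blast+
  have lg: "w (lab s (?g x)) = w (lab s x)" for x
    using ij(3) by (cases x) (auto simp: lab_def transpose_def)
  have comp: "compat n s w (conj_by ?g u) \<longleftrightarrow> compat n s w u" for u
  proof -
    have "compat n s w (conj_by ?g u) \<longleftrightarrow> (\<forall>x\<in>?g ` vertices n. w (lab s (conj_by ?g u x)) = w (lab s x))"
      by (simp add: compat_def permutes_image[OF gp])
    thus ?thesis by (simp add: conj_by_apply[OF b(1)] lg compat_def)
  qed
  have "bij_betw (conj_by ?g)
      {u \<in> matching_invols bip n. ctype (vertices n) u (conj_by (twist p) s) = mu \<and> compat n s w u}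
      {u \<in> matching_invols bip n. ctype (vertices n) u (conj_by ?g (conj_by (twist p) s)) = mu \<and> compat n s w u}"
    by (rule bij_betw_Collect[OF conj_by_bij[OF g]]) (simp add: ctype_conj_by[OF gp] comp)
  from bij_betw_same_card[OF this] show ?thesis
    by (simp add: num_compat_def twist_comp conj_by_comp[OF b])
qed

lemma alternating_num_compat:
  assumes ij: "i \<in> {1..n}" "j \<in> {1..n}" "i \<noteq> j" "col i = col j" "w i = w j"
  shows "(\<Sum>p\<in>column_group n col.
       of_int (sign p) * of_nat (num_compat bip n s mu w (conj_by (twist p) s)) :: rat) = 0"
proof (rule alternating_sum_eq_0[OF ij(1-4)])
  fix p assume "p \<in> column_group n col"
  hence "p permutes {1..n}" by (simp add: column_group_def)
  from num_compat_transpose[OF ij(1,2,5) this]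
  show "(of_nat (num_compat bip n s mu w (conj_by (twist (Transposition.transpose i j \<circ> p)) s)) :: rat) =
    of_nat (num_compat bip n s mu w (conj_by (twist p) s))" by simp
qed

text \<open>A colouring with content \<open>\<kappa> \<not>\<le> \<nu>\<close> repeats a colour within a column; transposing these two cells
  cancels the alternating sum, and it still does so after multiplication by a class sum.\<close>

lemma alt_num_middle_triangular:
  assumes nu: "nu \<in> partitions n" and kap: "kap \<in> partitions n" and nd: "\<not> dominated kap nu"
    and tab: "bij_betw (\<lambda>i. (row i, col i)) {1..n} (shape nu)"
  shows "(\<Sum>lam\<in>partitions n. alt_num_middle bip n s col mu lam * of_nat (pcoef n lam (cexp kap))) = 0"
  unfolding sum_alt_num_middle_pcoef
proof (rule sum.neutral, rule ballI)
  fix w assume "w \<in> colourings n kap"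
  hence "(\<Sum>i\<in>{1..n}. Poly_Mapping.single (w i) 1) = cexp kap" by (simp add: colourings_def)
  then obtain i j where "i \<in> {1..n}" "j \<in> {1..n}" "col i = col j" "w i = w j" "i \<noteq> j"
    using dominated_if_injective_on_columns[OF nu kap tab] nd by blast
  thus "(\<Sum>p\<in>column_group n col.
       of_int (sign p) * of_nat (num_compat bip n s mu w (conj_by (twist p) s)) :: rat) = 0"
    using alternating_num_compat by blast
qed

text \<open>The twist moves only unhatted vertices, so the twisted matching joins \<open>p i\<close>
  to the hatted partner of \<open>i\<close>, whose label is \<open>i\<close>.\<close>

lemma compat_twist_iff:
  assumes p: "p permutes {1..n}"
  shows "compat n s w (conj_by (twist p) s) \<longleftrightarrow> (\<forall>i\<in>{1..n}. w (p i) = w i)"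
proof -
  have b: "bij (twist p)" using side_perm_bij[OF twist_side_perm[OF p]] .
  have gp: "twist p permutes vertices n" using twist_side_perm[OF p] by (simp add: side_perm_def)
  have ap: "lab s (conj_by (twist p) s (twist p x)) = (if isl x then lab s x else p (lab s x))"
    "lab s (twist p x) = (if isl x then p (lab s x) else lab s x)" if x: "x \<in> vertices n" for x
  proof -
    have sx: "isl (s x) \<longleftrightarrow> \<not> isl x" by (rule isl_s[OF s x])
    have l: "lab s (s x) = lab s x" by (rule lab_s[OF s x])
    have tw: "lab s (twist p y) = (if isl y then p (lab s y) else lab s y)" for y
      by (cases y) (auto simp: lab_def)
    show "lab s (twist p x) = (if isl x then p (lab s x) else lab s x)" by (rule tw)
    show "lab s (conj_by (twist p) s (twist p x)) = (if isl x then lab s x else p (lab s x))"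
      using tw[of "s x"] sx l by (simp add: conj_by_apply[OF b])
  qed
  have "compat n s w (conj_by (twist p) s) \<longleftrightarrow>
      (\<forall>x\<in>twist p ` vertices n. w (lab s (conj_by (twist p) s x)) = w (lab s x))"
    by (simp add: compat_def permutes_image[OF gp])
  also have "\<dots> \<longleftrightarrow> (\<forall>x\<in>vertices n. w (p (lab s x)) = w (lab s x))"
    using ap by (auto split: if_splits)
  also have "\<dots> \<longleftrightarrow> (\<forall>i\<in>{1..n}. w (p i) = w i)"
  proof -
    have "lab s ` vertices n = {1..n}"
    proof
      show "lab s ` vertices n \<subseteq> {1..n}" using lab_in[OF s] by blast
      show "{1..n} \<subseteq> lab s ` vertices n"
      proof
        fix i assume "i \<in> {1..n}"
        hence "Inl i \<in> vertices n" using Inl_vertices by blast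
        hence "lab s (Inl i) \<in> lab s ` vertices n" by (rule imageI)
        thus "i \<in> lab s ` vertices n" by (simp only: lab_Inl[OF s])
      qed
    qed
    hence "(\<forall>i\<in>{1..n}. w (p i) = w i) \<longleftrightarrow> (\<forall>i\<in>lab s ` vertices n. w (p i) = w i)" by (simp only:)
    thus ?thesis by (simp only: ball_simps)
  qed
  finally show ?thesis .
qed

text \<open>A colouring that repeats a colour within a column contributes 0. Any other contributes
  exactly 1, since only the identity of the column group preserves it. Colouring by row numbers is
  of the second kind, so nothing can cancel it.\<close>

lemma alt_num_middle_diagonal:
  assumes nu: "nu \<in> partitions n"
    and tab: "bij_betw (\<lambda>i. (row i, col i)) {1..n} (shape nu)"
  shows "(\<Sum>lam\<in>partitions n. alt_num_middle bip n s col (replicate_mset n 1) lam * of_nat (pcoef n lam (cexp nu))) > 0"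
proof -
  let ?f = "\<lambda>w. \<Sum>p\<in>column_group n col.
       of_int (sign p) * of_nat (num_compat bip n s (replicate_mset n 1) w (conj_by (twist p) s)) :: rat"
  \<comment> \<open>Type 1^n leaves \<open>t\<close> as the only middle matching, so the count
    reduces to the truth value of compatibility.\<close>
  have nc: "num_compat bip n s (replicate_mset n 1) w t = (if compat n s w t then 1 else 0)"
    if t: "t \<in> matching_invols bip n" for t w
  proof -
    have "{u \<in> matching_invols bip n. ctype (vertices n) u t = replicate_mset n 1 \<and> compat n s w u} =
        (if compat n s w t then {t} else {})"
      using ctype_self_iff[OF _ t, of _ bip] t by (auto simp del: replicate_mset_eq_empty_iff)
    thus ?thesis by (simp add: num_compat_def)
  qed
  have one: "?f w = 1"
    if inj: "\<And>i j. \<lbrakk>i \<in> {1..n}; j \<in> {1..n}; col i = col j; w i = w j\<rbrakk> \<Longrightarrow> i = j" for w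
  proof -
    have "of_int (sign p) * of_nat (num_compat bip n s (replicate_mset n 1) w (conj_by (twist p) s)) =
        (if p = id then 1 else 0 :: rat)" if p: "p \<in> column_group n col" for p
    proof -
      have pp: "p permutes {1..n}" and pc: "\<And>i. col (p i) = col i" using p by (auto simp: column_group_def)
      have "(\<forall>i\<in>{1..n}. w (p i) = w i) \<longleftrightarrow> p = id"
      proof
        assume eq: "\<forall>i\<in>{1..n}. w (p i) = w i"
        show "p = id"
        proof
          fix i show "p i = id i"
          proof (cases "i \<in> {1..n}")
            case True
            have "p i = i" by (rule inj) (use True eq pc permutes_in_image[OF pp] in auto)
            thus ?thesis by simp
          next
            case False
            thus ?thesis using pp by (simp add: permutes_def)
          qed
        qed
      qed simp
      thus ?thesis using nc[OF conj_twist_matching_invols[OF p]] compat_twist_iff[OF pp] by simp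
    qed
    hence "?f w = (\<Sum>p\<in>column_group n col. if p = id then 1 else 0)" by (intro sum.cong) auto
    also have "\<dots> = 1" using finite_column_group by (simp add: column_group_def permutes_id)
    finally show ?thesis .
  qed
  have nonneg: "?f w \<ge> 0" for w
  proof (cases "\<forall>i\<in>{1..n}. \<forall>j\<in>{1..n}. col i = col j \<and> w i = w j \<longrightarrow> i = j")
    case True
    hence "?f w = 1" by (intro one) blast
    thus ?thesis by (simp only: zero_le_one)
  next
    case False
    then obtain i j where "i \<in> {1..n}" "j \<in> {1..n}" "i \<noteq> j" "col i = col j" "w i = w j" by blast
    from alternating_num_compat[OF this] show ?thesis by simp
  qed
  let ?r = "restrict row {1..n}"
  have cell: "(row i, col i) \<in> shape nu" if "i \<in> {1..n}" for i using tab that by (auto simp: bij_betw_def)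
  have "?r \<in> colourings n nu"
  proof -
    have "row i < n" if "i \<in> {1..n}" for i
      using cell[OF that] size_le_partition[OF nu] by (auto simp: shape_def)
    moreover have "(\<Sum>i\<in>{1..n}. Poly_Mapping.single (?r i) 1) = cexp nu"
      using row_content[OF tab] by simp
    ultimately show ?thesis by (auto simp: colourings_def)
  qed
  hence le: "?f ?r \<le> (\<Sum>w\<in>colourings n nu. ?f w)"
    by (rule member_le_sum) (rule nonneg, rule finite_colourings)
  have "?f ?r = 1"
  proof (rule one)
    fix i j assume ij: "i \<in> {1..n}" "j \<in> {1..n}" "col i = col j" "?r i = ?r j"
    hence "(row i, col i) = (row j, col j)" by simp
    thus "i = j" using ij(1,2) tab unfolding bij_betw_def inj_on_def by blast
  qed
  from less_le_trans[OF zero_less_one le[unfolded this]]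
  show ?thesis unfolding sum_alt_num_middle_pcoef .
qed

end

section \<open>Self-adjoint operators preserving a triangular flag\<close>

text \<open>In the application \<open>P\<close> consists of the partitions of \<open>n\<close>, \<open>le\<close> is dominance, vectors are given by
  their power sum coefficients, and \<open>coef y k\<close> is the coefficient of the monomial symmetric function \<open>m\<^sub>k\<close>.\<close>

locale triangular_flag =
  fixes P :: "'i set" and le :: "'i \<Rightarrow> 'i \<Rightarrow> bool" and A :: "'i \<Rightarrow> 'i \<Rightarrow> rat"
  assumes finite_P: "finite P"
    and le_refl: "\<And>x. x \<in> P \<Longrightarrow> le x x"
    and le_trans: "\<And>x y z. \<lbrakk>le x y; le y z\<rbrakk> \<Longrightarrow> le x z"
    and le_antisym: "\<And>x y. \<lbrakk>x \<in> P; y \<in> P; le x y; le y x\<rbrakk> \<Longrightarrow> x = y"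
    and A_inj: "\<And>y l. \<lbrakk>\<And>k. k \<in> P \<Longrightarrow> (\<Sum>l\<in>P. y l * A l k) = 0; l \<in> P\<rbrakk> \<Longrightarrow> y l = 0"
begin

definition coef :: "('i \<Rightarrow> rat) \<Rightarrow> 'i \<Rightarrow> rat" where
  "coef y k = (\<Sum>l\<in>P. y l * A l k)"

text \<open>\<open>G m\<close> lies in the span of the monomial functions with index below or equal
  to \<open>m\<close>.\<close>

definition lower :: "('i \<Rightarrow> 'i \<Rightarrow> rat) \<Rightarrow> 'i \<Rightarrow> bool" where
  "lower G m \<longleftrightarrow> (\<forall>k\<in>P. \<not> le k m \<longrightarrow> coef (G m) k = 0)"

lemma coef_diff: "coef (\<lambda>l. y l - c * z l) k = coef y k - c * coef z k"
  by (simp add: coef_def algebra_simps sum_subtractf sum_distrib_left)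

lemma coef_sum: "coef (\<lambda>l. \<Sum>i\<in>I. c i * G i l) k = (\<Sum>i\<in>I. c i * coef (G i) k)"
  unfolding coef_def sum_distrib_right sum_distrib_left
  by (subst sum.swap) (simp add: mult.assoc)

text \<open>Elimination from the top of a down-closed set: subtracting a multiple of
  \<open>G m\<close> for a maximal \<open>m\<close> clears the coefficient at \<open>m\<close> and
  disturbs only coefficients inside \<open>D\<close>, and what remains of \<open>D\<close> is still
  down-closed. When \<open>D\<close> is exhausted, \<open>A_inj\<close> gives 0.\<close>

lemma spanning:
  assumes "D \<subseteq> P" "\<And>k m. \<lbrakk>k \<in> D; m \<in> P; le m k\<rbrakk> \<Longrightarrow> m \<in> D"
    and "\<And>m. m \<in> D \<Longrightarrow> lower G m" "\<And>m. m \<in> D \<Longrightarrow> coef (G m) m \<noteq> 0"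
    and "\<And>k. k \<in> P - D \<Longrightarrow> coef y k = 0"
  shows "\<exists>c. \<forall>l\<in>P. y l = (\<Sum>m\<in>D. c m * G m l)"
  using assms
proof (induction "card D" arbitrary: D y)
  case 0
  hence D: "D = {}" using finite_P finite_subset by fastforce
  have "y l = 0" if "l \<in> P" for l
    by (rule A_inj[OF _ that]) (use 0 D in \<open>simp add: coef_def\<close>)
  thus ?case using D by simp
next
  case (Suc d)
  have finD: "finite D" using Suc.prems(1) finite_P by (rule finite_subset)
  have "\<exists>m\<in>D. \<forall>x\<in>D. x \<noteq> m \<longrightarrow> \<not> (le m x \<and> m \<noteq> x)"
  proof (rule Finite_Set.bex_max_element[OF finD])
    show "asymp_on D (\<lambda>x y. le x y \<and> x \<noteq> y)"
      using le_antisym Suc.prems(1) by (auto simp: asymp_on_def)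
    show "transp_on D (\<lambda>x y. le x y \<and> x \<noteq> y)"
      using le_antisym le_trans Suc.prems(1) unfolding transp_on_def by blast
    show "D \<noteq> {}" using Suc.hyps(2) by auto
  qed
  then obtain m where m: "m \<in> D" and max: "\<And>x. x \<in> D \<Longrightarrow> le m x \<Longrightarrow> x = m" by blast
  let ?D = "D - {m}"
  define c where "c = coef y m / coef (G m) m"
  have "\<exists>c'. \<forall>l\<in>P. y l - c * G m l = (\<Sum>x\<in>?D. c' x * G x l)"
  proof (rule Suc.hyps(1))
    show "d = card ?D" using Suc.hyps(2) m finD by simp
    show "?D \<subseteq> P" using Suc.prems(1) by blast
    show "x \<in> ?D" if "k \<in> ?D" "x \<in> P" "le x k" for k x
      using Suc.prems(2)[of k x] that max by blast
    show "coef (\<lambda>l. y l - c * G m l) k = 0" if k: "k \<in> P - ?D" for k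
    proof (cases "k = m")
      case True
      thus ?thesis using Suc.prems(4)[OF m] unfolding coef_diff by (simp add: c_def)
    next
      case False
      hence kD: "k \<notin> D" using k by blast
      hence "\<not> le k m" using Suc.prems(2)[OF m] k by blast
      hence "coef (G m) k = 0" using Suc.prems(3)[OF m] k by (simp add: lower_def)
      thus ?thesis using Suc.prems(5)[of k] k kD by (simp add: coef_diff)
    qed
  qed (use Suc.prems in auto)
  then obtain c' where c': "\<And>l. l \<in> P \<Longrightarrow> y l - c * G m l = (\<Sum>x\<in>?D. c' x * G x l)" by blast
  have "y l = (\<Sum>x\<in>D. (if x = m then c else c' x) * G x l)" if "l \<in> P" for l
  proof -
    have "(\<Sum>x\<in>D. (if x = m then c else c' x) * G x l) = c * G m l + (\<Sum>x\<in>?D. (if x = m then c else c' x) * G x l)"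
      using sum.remove[OF finD m, of "\<lambda>x. (if x = m then c else c' x) * G x l"] by simp
    also have "(\<Sum>x\<in>?D. (if x = m then c else c' x) * G x l) = (\<Sum>x\<in>?D. c' x * G x l)"
      by (rule sum.cong) auto
    finally show ?thesis using c'[OF that] by simp
  qed
  thus ?case by (intro exI[of _ "\<lambda>x. if x = m then c else c' x"]) simp
qed

end

text \<open>Over the rationals, positive weights make the form definite; this is the gain from
  evaluating at a number instead of working over the rational functions.\<close>

locale orthogonal_flag = triangular_flag +
  fixes z :: "'a \<Rightarrow> rat" and v :: "'a \<Rightarrow> 'a \<Rightarrow> rat"
  assumes z_pos: "\<And>l. l \<in> P \<Longrightarrow> z l > 0"
    and v_lower: "\<And>m. m \<in> P \<Longrightarrow> lower v m"
    and v_nonzero: "\<And>m. m \<in> P \<Longrightarrow> \<exists>l\<in>P. v m l \<noteq> 0"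
    and v_orth: "\<And>m k. \<lbrakk>m \<in> P; k \<in> P; m \<noteq> k\<rbrakk> \<Longrightarrow> (\<Sum>l\<in>P. z l * v m l * v k l) = 0"
begin

definition ip :: "('a \<Rightarrow> rat) \<Rightarrow> ('a \<Rightarrow> rat) \<Rightarrow> rat" where
  "ip y y' = (\<Sum>l\<in>P. z l * y l * y' l)"

lemma ip_sum:
  assumes "\<And>l. l \<in> P \<Longrightarrow> y l = (\<Sum>m\<in>D. c m * v m l)"
  shows "ip y y' = (\<Sum>m\<in>D. c m * ip (v m) y')"
proof -
  have "ip y y' = (\<Sum>l\<in>P. \<Sum>m\<in>D. c m * (z l * v m l * y' l))"
    unfolding ip_def by (rule sum.cong) (simp_all add: assms sum_distrib_left sum_distrib_right algebra_simps)
  also have "\<dots> = (\<Sum>m\<in>D. c m * ip (v m) y')"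
    unfolding ip_def sum_distrib_left by (rule sum.swap)
  finally show ?thesis .
qed

lemma ip_orth: "\<lbrakk>m \<in> P; k \<in> P; m \<noteq> k\<rbrakk> \<Longrightarrow> ip (v m) (v k) = 0"
  using v_orth by (simp add: ip_def)

lemma ip_pos:
  assumes m: "m \<in> P" shows "ip (v m) (v m) > 0"
proof -
  obtain l where l: "l \<in> P" "v m l \<noteq> 0" using v_nonzero[OF m] by blast
  show ?thesis unfolding ip_def
  proof (rule sum_pos2[OF finite_P l(1)])
    show "0 < z l * v m l * v m l" using z_pos[OF l(1)] l(2) by (simp add: mult.assoc zero_less_mult_iff)
         (metis linorder_neqE_linordered_idom)
    show "0 \<le> z i * v m i * v m i" if "i \<in> P" for i
      using z_pos[OF that] by (simp add: mult.assoc)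
  qed
qed

text \<open>If the diagonal coefficient vanished, \<open>v m\<close> would be a combination of the strictly lower \<open>v k\<close>, to which it is
  orthogonal.\<close>

lemma v_diag: "m \<in> P \<Longrightarrow> coef (v m) m \<noteq> 0"
proof (induction "card {k \<in> P. le k m \<and> k \<noteq> m}" arbitrary: m rule: less_induct)
  case less
  let ?D = "{k \<in> P. le k m \<and> k \<noteq> m}"
  show ?case
  proof
    assume 0: "coef (v m) m = 0"
    have "\<exists>c. \<forall>l\<in>P. v m l = (\<Sum>x\<in>?D. c x * v x l)"
    proof (rule spanning)
      show "x \<in> ?D" if "k \<in> ?D" "x \<in> P" "le x k" for k x
        using that le_trans le_antisym less.prems by blast
      show "lower v x" if "x \<in> ?D" for x using that v_lower by blast
      show "coef (v x) x \<noteq> 0" if x: "x \<in> ?D" for x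
      proof (rule less.hyps)
        have "{k \<in> P. le k x \<and> k \<noteq> x} \<subset> ?D"
          using x le_trans le_antisym less.prems by blast
        thus "card {k \<in> P. le k x \<and> k \<noteq> x} < card ?D"
          using finite_P by (intro psubset_card_mono) auto
        show "x \<in> P" using x by blast
      qed
      show "coef (v m) k = 0" if "k \<in> P - ?D" for k
        using that 0 v_lower[OF less.prems] by (auto simp: lower_def)
    qed auto
    then obtain c where "\<And>l. l \<in> P \<Longrightarrow> v m l = (\<Sum>x\<in>?D. c x * v x l)" by blast
    hence "ip (v m) (v m) = (\<Sum>x\<in>?D. c x * ip (v x) (v m))" by (rule ip_sum)
    also have "\<dots> = 0" by (rule sum.neutral) (use ip_orth less.prems in auto)
    finally show False using ip_pos[OF less.prems] by simp
  qed
qed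

lemma expansion:
  assumes "D \<subseteq> P" "\<And>k m. \<lbrakk>k \<in> D; m \<in> P; le m k\<rbrakk> \<Longrightarrow> m \<in> D"
    and "\<And>k. k \<in> P - D \<Longrightarrow> coef y k = 0" and l: "l \<in> P"
  shows "y l = (\<Sum>m\<in>D. ip y (v m) / ip (v m) (v m) * v m l)"
proof -
  have "\<exists>c. \<forall>l\<in>P. y l = (\<Sum>m\<in>D. c m * v m l)"
    by (rule spanning) (use assms v_lower v_diag in auto)
  then obtain c where c: "\<And>l. l \<in> P \<Longrightarrow> y l = (\<Sum>m\<in>D. c m * v m l)" by blast
  have "c m = ip y (v m) / ip (v m) (v m)" if m: "m \<in> D" for m
  proof -
    have "ip y (v m) = (\<Sum>x\<in>D. c x * ip (v x) (v m))" by (rule ip_sum[OF c])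
    also have "\<dots> = (\<Sum>x\<in>D. if x = m then c m * ip (v m) (v m) else 0)"
      by (rule sum.cong) (use ip_orth assms(1) m in auto)
    also have "\<dots> = c m * ip (v m) (v m)"
      using m finite_subset[OF assms(1) finite_P] by simp
    finally show ?thesis using ip_pos[of m] m assms(1) by auto
  qed
  thus ?thesis using c[OF l] by simp
qed

text \<open>The dual orthogonality relation, obtained by expanding the unit vector at
  \<open>k\<close> in the basis \<open>v\<close>.\<close>

lemma completeness:
  assumes "l \<in> P" "k \<in> P"
  shows "z k * (\<Sum>m\<in>P. v m l * v m k / ip (v m) (v m)) = (if l = k then 1 else 0)"
proof -
  let ?y = "\<lambda>l. if l = k then 1 else 0 :: rat"
  have ip: "ip ?y (v m) = z k * v m k" for m
  proof -
    have "ip ?y (v m) = (\<Sum>l\<in>P. if l = k then z k * v m k else 0)"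
      unfolding ip_def by (rule sum.cong) auto
    thus ?thesis using assms(2) finite_P by simp
  qed
  have "?y l = (\<Sum>m\<in>P. ip ?y (v m) / ip (v m) (v m) * v m l)"
    by (rule expansion) (use assms in auto)
  also have "\<dots> = z k * (\<Sum>m\<in>P. v m l * v m k / ip (v m) (v m))"
    unfolding ip by (simp add: sum_distrib_left mult_ac)
  finally show ?thesis ..
qed

text \<open>\<open>T\<close> maps \<open>v m\<close> into the span of the \<open>v k\<close> with \<open>k \<le> m\<close>; being self-adjoint, it has no
  component on the \<open>v k\<close> with \<open>k < m\<close> either.\<close>

lemma eigenvector:
  fixes T :: "'a \<Rightarrow> 'a \<Rightarrow> rat" and F :: "'a \<Rightarrow> 'a \<Rightarrow> rat"
  assumes selfadjoint: "\<And>l k. \<lbrakk>l \<in> P; k \<in> P\<rbrakk> \<Longrightarrow> z k * T l k = z l * T k l"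
    and F: "\<And>m. m \<in> P \<Longrightarrow> lower F m" "\<And>m. m \<in> P \<Longrightarrow> coef (F m) m \<noteq> 0"
    and TF: "\<And>m. m \<in> P \<Longrightarrow> lower (\<lambda>m k. \<Sum>l\<in>P. F m l * T l k) m"
    and m: "m \<in> P"
  shows "\<exists>x. \<forall>k\<in>P. (\<Sum>l\<in>P. v m l * T l k) = x * v m k"
proof -
  define Tv where "Tv = (\<lambda>m k. \<Sum>l\<in>P. v m l * T l k)"
  have Tv_lower: "lower Tv m" if m: "m \<in> P" for m
    unfolding lower_def
  proof (intro ballI impI)
    fix k assume k: "k \<in> P" "\<not> le k m"
    let ?D = "{x \<in> P. le x m}"
    \<comment> \<open>The action of \<open>T\<close> is known to be triangular only on the vectors
      \<open>F x\<close>, so \<open>v m\<close> is first written in terms of those with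
      \<open>x\<close> below or equal to \<open>m\<close>.\<close>
    have "\<exists>c. \<forall>l\<in>P. v m l = (\<Sum>x\<in>?D. c x * F x l)"
      by (rule spanning) (use le_trans F v_lower[OF m] in \<open>auto simp: lower_def\<close>)
    then obtain c where c: "\<And>l. l \<in> P \<Longrightarrow> v m l = (\<Sum>x\<in>?D. c x * F x l)" by blast
    have "Tv m j = (\<Sum>x\<in>?D. c x * (\<Sum>l\<in>P. F x l * T l j))" for j
    proof -
      have "Tv m j = (\<Sum>l\<in>P. \<Sum>x\<in>?D. c x * (F x l * T l j))"
        unfolding Tv_def by (rule sum.cong) (simp_all add: c sum_distrib_right mult.assoc)
      thus ?thesis unfolding sum_distrib_left by (subst sum.swap)
    qed
    hence "Tv m = (\<lambda>j. \<Sum>x\<in>?D. c x * (\<Sum>l\<in>P. F x l * T l j))" by (rule ext)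
    hence "coef (Tv m) k = (\<Sum>x\<in>?D. c x * coef (\<lambda>j. \<Sum>l\<in>P. F x l * T l j) k)"
      by (simp only:) (rule coef_sum)
    also have "\<dots> = 0"
    proof (rule sum.neutral, rule ballI)
      fix x assume x: "x \<in> ?D"
      hence "\<not> le k x" using k le_trans by blast
      thus "c x * coef (\<lambda>j. \<Sum>l\<in>P. F x l * T l j) k = 0" using TF[of x] x k by (simp add: lower_def)
    qed
    finally show "coef (Tv m) k = 0" .
  qed
  have adj: "ip (Tv m) (v k) = ip (Tv k) (v m)" for m k
  proof -
    have "ip (Tv m) (v k) = (\<Sum>j\<in>P. \<Sum>l\<in>P. v m l * v k j * (z j * T l j))"
      unfolding ip_def Tv_def by (simp add: sum_distrib_left sum_distrib_right mult_ac)
    also have "\<dots> = (\<Sum>j\<in>P. \<Sum>l\<in>P. v m l * v k j * (z l * T j l))"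
      by (intro sum.cong refl) (simp add: selfadjoint)
    also have "\<dots> = (\<Sum>l\<in>P. \<Sum>j\<in>P. v m l * v k j * (z l * T j l))" by (rule sum.swap)
    also have "\<dots> = ip (Tv k) (v m)"
      unfolding ip_def Tv_def by (simp add: sum_distrib_left sum_distrib_right mult_ac)
    finally show ?thesis .
  qed
  have zero: "ip (Tv m) (v k) = 0" if "m \<in> P" "k \<in> P" "\<not> le k m" for m k
  proof -
    let ?D = "{x \<in> P. le x m}"
    have y: "Tv m l = (\<Sum>x\<in>?D. ip (Tv m) (v x) / ip (v x) (v x) * v x l)" if "l \<in> P" for l
      by (rule expansion) (use that le_trans Tv_lower[OF \<open>m \<in> P\<close>] in \<open>auto simp: lower_def\<close>)
    have "ip (Tv m) (v k) = (\<Sum>x\<in>?D. ip (Tv m) (v x) / ip (v x) (v x) * ip (v x) (v k))"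
      by (rule ip_sum[OF y])
    also have "\<dots> = 0" by (rule sum.neutral) (use that ip_orth in auto)
    finally show ?thesis .
  qed
  have off: "ip (Tv m) (v k) = 0" if "k \<in> P" "k \<noteq> m" for k
    using zero[OF m that(1)] zero[OF that(1) m] adj[of m k] le_antisym[OF m that(1)] that(2) by metis
  have "Tv m j = ip (Tv m) (v m) / ip (v m) (v m) * v m j" if j: "j \<in> P" for j
  proof -
    have "Tv m j = (\<Sum>x\<in>P. ip (Tv m) (v x) / ip (v x) (v x) * v x j)"
      by (rule expansion) (use j in auto)
    also have "\<dots> = (\<Sum>x\<in>P. if x = m then ip (Tv m) (v m) / ip (v m) (v m) * v m j else 0)"
      by (rule sum.cong) (use off in auto)
    finally show ?thesis using m finite_P by simp
  qed
  thus ?thesis unfolding Tv_def by blast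
qed

end

section \<open>Jack polynomials at $b = 0$ and $b = 1$\<close>

lemma cexp_inject:
  assumes "kap \<in> partitions n" "nu \<in> partitions n" "cexp kap = cexp nu"
  shows "kap = nu"
proof -
  have "0 \<notin># kap" "0 \<notin># nu" using assms(1,2) by (auto simp: partitions_def)
  from exponents_cexp[OF this(1)] exponents_cexp[OF this(2)] show ?thesis
    unfolding assms(3) by (rule trans[OF sym])
qed

lemma dominated_antisym:
  assumes "kap \<in> partitions n" "nu \<in> partitions n" "dominated kap nu" "dominated nu kap"
  shows "kap = nu"
proof (rule cexp_inject[OF assms(1,2)], rule poly_mapping_eqI)
  fix j
  have "(\<Sum>i<k. Poly_Mapping.lookup (cexp kap) i) = (\<Sum>i<k. Poly_Mapping.lookup (cexp nu) i)" for k
    using assms(3,4) by (auto simp: dominated_def sum_take_parts_desc intro: le_antisym)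
  from this[of j] this[of "Suc j"]
  show "Poly_Mapping.lookup (cexp kap) j = Poly_Mapping.lookup (cexp nu) j" by simp
qed

lemma dominated_refl: "dominated nu nu"
  by (simp add: dominated_def)

lemma dominated_trans: "\<lbrakk>dominated kap mu; dominated mu nu\<rbrakk> \<Longrightarrow> dominated kap nu"
proof -
  assume "dominated kap mu" "dominated mu nu"
  hence "sum_mset kap = sum_mset nu"
    "sum_list (take k (parts_desc kap)) \<le> sum_list (take k (parts_desc mu))"
    "sum_list (take k (parts_desc mu)) \<le> sum_list (take k (parts_desc nu))" for k
    by (simp_all add: dominated_def)
  thus ?thesis unfolding dominated_def using order_trans by blast
qed

lemma replicate_in_partitions: "replicate_mset n 1 \<in> partitions n"
  by (auto simp: partitions_def)

lemma parts_desc_replicate: "parts_desc (replicate_mset n 1) = replicate n 1"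
proof -
  have "set (parts_desc (replicate_mset n 1)) \<subseteq> {1}" by (auto simp: parts_desc_def split: if_splits)
  moreover have "length (parts_desc (replicate_mset n 1)) = n" by (simp add: length_parts_desc)
  ultimately show ?thesis by (metis replicate_eqI singletonD subsetD)
qed

lemma cexp_replicate: "cexp (replicate_mset n 1) = (\<Sum>j<n. Poly_Mapping.single j 1)"
  unfolding cexp_def parts_desc_replicate size_replicate_mset by (rule sum.cong) simp_all

text \<open>Giving all cells different colours produces content 1^n without a repetition in any
  column.\<close>

lemma replicate_dominated:
  assumes nu: "nu \<in> partitions n" shows "dominated (replicate_mset n 1) nu"
proof -
  obtain row col where tab: "bij_betw (\<lambda>i. (row i, col i)) {1..n} (shape nu)"
    using tableau_exists[OF nu] .
  have "(\<Sum>i\<in>{1..n}. Poly_Mapping.single (i - 1) (1::nat)) = cexp (replicate_mset n 1)"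
    unfolding cexp_replicate
    by (rule sum.reindex_bij_witness[of _ Suc "\<lambda>i. i - 1"]) auto
  thus ?thesis
    by (rule dominated_if_injective_on_columns[OF nu replicate_in_partitions tab]) auto
qed

text \<open>The monomial is a product of n distinct variables, so only a partition with n parts can
  reach it; p_1^n does so once for each ordering of the variables.\<close>

lemma pcoef_replicate:
  assumes lam: "lam \<in> partitions n"
  shows "pcoef n lam (cexp (replicate_mset n 1)) = (if lam = replicate_mset n 1 then fact n else 0)"
proof (cases "lam = replicate_mset n 1")
  case False
  have z: "0 \<notin># lam" "0 \<notin># replicate_mset n (1::nat)" using lam by (auto simp: partitions_def)
  have "pcoef n lam (cexp (replicate_mset n 1)) = 0"
  proof (rule ccontr)
    assume "\<not> ?thesis"
    from pcoef_nonzero[OF z(1) this] size_le_partition[OF lam] False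
    show False unfolding exponents_cexp[OF z(2)] by auto
  qed
  thus ?thesis using False by simp
next
  case True
  have look: "Poly_Mapping.lookup (cexp (replicate_mset n 1)) i = (if i < n then 1 else 0)" for i
    unfolding lookup_cexp parts_desc_replicate by simp
  have iff: "(\<Sum>j<n. Poly_Mapping.single (g j) 1) = cexp (replicate_mset n 1) \<longleftrightarrow> inj_on g {..<n}"
    if g: "g \<in> {..<n} \<rightarrow>\<^sub>E {..<n}" for g :: "nat \<Rightarrow> nat"
  proof
    assume eq: "(\<Sum>j<n. Poly_Mapping.single (g j) 1) = cexp (replicate_mset n 1)"
    have c: "card {j\<in>{..<n}. g j = i} = (if i < n then 1 else 0)" for i
      using look[of i] unfolding eq[symmetric] by (simp add: lookup_sum_single)
    show "inj_on g {..<n}"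
    proof (rule inj_onI)
      fix a b assume ab: "a \<in> {..<n}" "b \<in> {..<n}" "g a = g b"
      have "g b < n" using g ab(2) by (auto dest: PiE_mem)
      then obtain x where "{j\<in>{..<n}. g j = g b} = {x}" using c[of "g b"] by (auto simp: card_1_singleton_iff)
      moreover have "a \<in> {j\<in>{..<n}. g j = g b}" "b \<in> {j\<in>{..<n}. g j = g b}" using ab by auto
      ultimately show "a = b" by simp
    qed
  next
    assume inj: "inj_on g {..<n}"
    have "g ` {..<n} = {..<n}"
      by (rule endo_inj_surj) (use g inj in \<open>auto dest: PiE_mem\<close>)
    hence "bij_betw g {..<n} {..<n}" using inj by (simp add: bij_betw_def)
    thus "(\<Sum>j<n. Poly_Mapping.single (g j) 1) = cexp (replicate_mset n 1)"
      unfolding cexp_replicate by (rule sum.reindex_bij_betw)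
  qed
  have "pcoef n lam (cexp (replicate_mset n 1)) = card {g \<in> {..<n} \<rightarrow>\<^sub>E {..<n}.
     (\<Sum>j<n. Poly_Mapping.single (g j) 1) = cexp (replicate_mset n 1)}"
    unfolding pcoef_def True parts_desc_replicate size_replicate_mset
  proof -
    have "(\<Sum>j<n. Poly_Mapping.single (g j) (replicate n 1 ! j)) = (\<Sum>j<n. Poly_Mapping.single (g j) (1::nat))"
      for g :: "nat \<Rightarrow> nat" by (rule sum.cong) auto
    thus "card {g \<in> {..<n} \<rightarrow>\<^sub>E {..<n}. (\<Sum>j<n. Poly_Mapping.single (g j) (replicate n 1 ! j)) =
          cexp (replicate_mset n 1)} =
        card {g \<in> {..<n} \<rightarrow>\<^sub>E {..<n}. (\<Sum>j<n. Poly_Mapping.single (g j) 1) = cexp (replicate_mset n 1)}"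
      by (simp only:)
  qed
  also have "\<dots> = card {g \<in> {..<n} \<rightarrow>\<^sub>E {..<n}. inj_on g {..<n}}"
    by (intro arg_cong[of _ _ card] Collect_cong conj_cong refl iff)
  also have "\<dots> = fact n"
    by (subst card_inj_on_subset_funcset) (auto simp: fact_prod_rev)
  finally show ?thesis using True by simp
qed

lemma lookup_monomial_sym:
  assumes kap: "kap \<in> partitions n"
  shows "Poly_Mapping.lookup (monomial_sym n mu) (cexp kap) = (if mu = kap then 1 else 0)"
proof -
  have z: "0 \<notin># kap" using kap by (simp add: partitions_def)
  have "Poly_Mapping.keys (cexp kap) \<subseteq> {..<n}"
    unfolding keys_cexp[OF z] using size_le_partition[OF kap] by auto
  hence "cexp kap \<in> {e. Poly_Mapping.keys e \<subseteq> {..<n} \<and> exponents e = mu} \<longleftrightarrow> mu = kap"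
    using exponents_cexp[OF z] by auto
  thus ?thesis
    using finite_monomials[of n mu] by (simp add: monomial_sym_def lookup_sum lookup_single when_def)
qed

text \<open>The defining identity is used with \<open>n\<close> variables, enough for every
  partition of \<open>n\<close> to fit into them.\<close>

lemma jack_monomial_coeff:
  assumes J: "jack_family J" and theta: "theta \<in> partitions n"
  obtains u where "u (replicate_mset n 1) = fact n"
    "\<And>kap. kap \<in> partitions n \<Longrightarrow>
       (\<Sum>lam\<in>partitions n. Poly_Mapping.lookup (J theta) lam * of_nat (pcoef n lam (cexp kap))) =
       (if dominated kap theta then u kap else 0)"
proof -
  have keys: "Poly_Mapping.keys (J theta) \<subseteq> partitions n"
    using J theta by (auto simp: jack_family_def)
  obtain u where u: "in_vars n (J theta) = (\<Sum>mu\<in>{mu \<in> partitions n. dominated mu theta}.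
                    Poly_Mapping.single 0 (u mu) * monomial_sym n mu)"
    and u1: "u (replicate_mset n 1) = fact n"
    using J theta unfolding jack_family_def by meson
  have "(\<Sum>lam\<in>partitions n. Poly_Mapping.lookup (J theta) lam * of_nat (pcoef n lam (cexp kap))) =
       (if dominated kap theta then u kap else 0)" if kap: "kap \<in> partitions n" for kap
  proof -
    have "(\<Sum>lam\<in>partitions n. Poly_Mapping.lookup (J theta) lam * of_nat (pcoef n lam (cexp kap))) =
        (\<Sum>lam\<in>Poly_Mapping.keys (J theta). Poly_Mapping.lookup (J theta) lam * of_nat (pcoef n lam (cexp kap)))"
      by (rule sum.mono_neutral_right) (use keys finite_partitions in \<open>auto simp: in_keys_iff\<close>)
    also have "\<dots> = Poly_Mapping.lookup (in_vars n (J theta)) (cexp kap)"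
      by (simp add: in_vars_def lookup_sum lookup_const_mult lookup_power_sums)
    also have "\<dots> = (\<Sum>mu\<in>{mu \<in> partitions n. dominated mu theta}. if mu = kap then u kap else 0)"
      unfolding u lookup_sum lookup_const_mult lookup_monomial_sym[OF kap]
      by (rule sum.cong) auto
    also have "\<dots> = (if dominated kap theta then u kap else 0)"
      using kap finite_partitions by simp
    finally show ?thesis .
  qed
  thus thesis using that u1 by blast
qed

text \<open>The factor n! in the integral normalisation is exactly the coefficient of the squarefree
  monomial in p_1^n, the only power sum product in which it occurs.\<close>

lemma jack_unit_coeff:
  assumes J: "jack_family J" and theta: "theta \<in> partitions n"
  shows "Poly_Mapping.lookup (J theta) (replicate_mset n 1) = 1"
proof -
  let ?o = "replicate_mset n (1::nat)"
  obtain u where u1: "u ?o = fact n" and u: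
    "\<And>kap. kap \<in> partitions n \<Longrightarrow>
       (\<Sum>lam\<in>partitions n. Poly_Mapping.lookup (J theta) lam * of_nat (pcoef n lam (cexp kap))) =
       (if dominated kap theta then u kap else 0)"
    using jack_monomial_coeff[OF J theta] by blast
  have "(\<Sum>lam\<in>partitions n. Poly_Mapping.lookup (J theta) lam * of_nat (pcoef n lam (cexp ?o))) =
      (\<Sum>lam\<in>partitions n. if lam = ?o then Poly_Mapping.lookup (J theta) ?o * fact n else 0)"
  proof (rule sum.cong[OF refl])
    fix lam assume "lam \<in> partitions n"
    show "Poly_Mapping.lookup (J theta) lam * of_nat (pcoef n lam (cexp ?o)) =
        (if lam = ?o then Poly_Mapping.lookup (J theta) ?o * fact n else 0)"
      unfolding pcoef_replicate[OF \<open>lam \<in> partitions n\<close>] by simp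
  qed
  also have "\<dots> = Poly_Mapping.lookup (J theta) ?o * fact n"
    using replicate_in_partitions finite_partitions by simp
  finally have "Poly_Mapping.lookup (J theta) ?o * fact n = fact n"
    using u[OF replicate_in_partitions] u1 replicate_dominated[OF theta] by simp
  thus ?thesis by simp
qed

lemma scalar_prod_partitions:
  assumes "Poly_Mapping.keys f \<subseteq> partitions n" "Poly_Mapping.keys g \<subseteq> partitions n"
  shows "scalar_prod f g = (\<Sum>lam\<in>partitions n.
    of_nat (zee lam) * alpha ^ size lam * Poly_Mapping.lookup f lam * Poly_Mapping.lookup g lam)"
proof -
  let ?P = "partitions n"
  let ?h = "\<lambda>lam. of_nat (zee lam) * alpha ^ size lam * Poly_Mapping.lookup f lam * Poly_Mapping.lookup g lam"
  have "scalar_prod f g = (\<Sum>lam\<in>Poly_Mapping.keys f. \<Sum>mu\<in>Poly_Mapping.keys g. if mu = lam then ?h lam else 0)"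
    unfolding scalar_prod_def by (intro sum.cong refl) (auto simp: mult_ac)
  also have "\<dots> = (\<Sum>lam\<in>Poly_Mapping.keys f. ?h lam)"
    by (intro sum.cong refl) (auto simp: in_keys_iff)
  also have "\<dots> = (\<Sum>lam\<in>?P. ?h lam)"
    by (rule sum.mono_neutral_left) (use assms finite_partitions in \<open>auto simp: in_keys_iff\<close>)
  finally show ?thesis .
qed

section \<open>Structure constants from an orthogonal triangular basis\<close>

interpretation partition_flag: triangular_flag "partitions n" dominated
  "\<lambda>lam kap. of_nat (pcoef n lam (cexp kap))" for n
proof
  show "y l = 0" if "\<And>k. k \<in> partitions n \<Longrightarrow> (\<Sum>l\<in>partitions n. y l * rat_of_nat (pcoef n l (cexp k))) = 0"
    "l \<in> partitions n" for y l
    by (rule power_sum_independent[OF that])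
qed (use finite_partitions dominated_refl dominated_trans dominated_antisym in blast)+

text \<open>One tableau is chosen for each shape. Triangularity holds for every \<open>mu\<close>,
  and this is what lets the class sums act within the flag.\<close>

lemma alternating_family:
  assumes s: "s \<in> matching_invols True n"
  obtains col where
    "\<And>mu m. m \<in> partitions n \<Longrightarrow> partition_flag.lower n (\<lambda>m. alt_num_middle bip n s (col m) mu) m"
    "\<And>m. m \<in> partitions n \<Longrightarrow> partition_flag.coef n (alt_num_middle bip n s (col m) (replicate_mset n 1)) m \<noteq> 0"
proof -
  have "\<forall>m. \<exists>rc. m \<in> partitions n \<longrightarrow> bij_betw (\<lambda>i. (fst rc i, snd rc i)) {1..n} (shape m)"
    using tableau_exists by (metis fst_conv snd_conv)
  then obtain rc where rc: "\<And>m. m \<in> partitions n \<Longrightarrow> bij_betw (\<lambda>i. (fst (rc m) i, snd (rc m) i)) {1..n} (shape m)"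
    by metis
  show thesis
  proof (rule that[of "\<lambda>m. snd (rc m)"])
    show "partition_flag.lower n (\<lambda>m. alt_num_middle bip n s (snd (rc m)) mu) m" if "m \<in> partitions n" for mu m
      unfolding partition_flag.lower_def partition_flag.coef_def
      using alt_num_middle_triangular[OF s that _ _ rc[OF that]] by blast
    show "partition_flag.coef n (alt_num_middle bip n s (snd (rc m)) (replicate_mset n 1)) m \<noteq> 0"
      if "m \<in> partitions n" for m
      unfolding partition_flag.coef_def
      using alt_num_middle_diagonal[OF s that rc[OF that], of bip] by simp
  qed
qed

text \<open>No matching is constructed: the antisymmetrised elements span all vectors, and if the
  type \<open>lam\<close> did not occur, all of them would vanish in that coordinate.\<close>

lemma ctype_surj:
  assumes s: "s \<in> matching_invols True n" and lam: "lam \<in> partitions n"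
  shows "\<exists>t\<in>matching_invols bip n. ctype (vertices n) s t = lam"
proof (rule ccontr)
  assume none: "\<not> ?thesis"
  obtain col where col:
    "\<And>mu m. m \<in> partitions n \<Longrightarrow> partition_flag.lower n (\<lambda>m. alt_num_middle bip n s (col m) mu) m"
    "\<And>m. m \<in> partitions n \<Longrightarrow> partition_flag.coef n (alt_num_middle bip n s (col m) (replicate_mset n 1)) m \<noteq> 0"
    using alternating_family[OF s] by blast
  have "\<exists>c. \<forall>l\<in>partitions n. (if l = lam then 1 else 0) =
      (\<Sum>m\<in>partitions n. c m * alt_num_middle bip n s (col m) (replicate_mset n 1) l)"
    by (rule partition_flag.spanning) (use col in auto)
  then obtain c where c: "(if lam = lam then 1 else 0) =
      (\<Sum>m\<in>partitions n. c m * alt_num_middle bip n s (col m) (replicate_mset n 1) lam)"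
    using lam by blast
  have "num_middle bip n s t lam mu = 0" for t mu
    unfolding num_middle_def using none by (simp add: card_eq_0_iff) blast
  thus False using c by (simp add: alt_num_middle_def)
qed

text \<open>The right-hand side does not change when some \<open>v m\<close> is multiplied by a
  nonzero scalar, so evaluated Jack polynomials may be inserted in any rescaling.\<close>

lemma num_middle_formula:
  fixes v :: "nat multiset \<Rightarrow> nat multiset \<Rightarrow> rat"
  assumes s: "s \<in> matching_invols True n" and t: "t \<in> matching_invols bip n" and lam: "ctype (vertices n) s t = lam"
    and mu: "mu \<in> partitions n" and nu: "nu \<in> partitions n"
    and lower: "\<And>m. m \<in> partitions n \<Longrightarrow> partition_flag.lower n v m"
    and nz: "\<And>m. m \<in> partitions n \<Longrightarrow> \<exists>l\<in>partitions n. v m l \<noteq> 0"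
    and orth: "\<And>m k. \<lbrakk>m \<in> partitions n; k \<in> partitions n; m \<noteq> k\<rbrakk> \<Longrightarrow>
       (\<Sum>l\<in>partitions n. of_nat (zeta bip l) * v m l * v k l) = 0"
  defines "j \<equiv> \<lambda>m. \<Sum>l\<in>partitions n. of_nat (zeta bip l) * v m l * v m l"
    and "one \<equiv> replicate_mset n 1"
  shows "\<And>m. m \<in> partitions n \<Longrightarrow> v m one \<noteq> 0" "\<And>m. m \<in> partitions n \<Longrightarrow> j m > 0"
    "of_nat (num_middle bip n s t mu nu) =
      of_nat (zeta bip lam) * (\<Sum>m\<in>partitions n. v m lam * v m mu * v m nu / (j m * v m one))"
proof -
  let ?P = "partitions n" and ?V = "vertices n"
  interpret orthogonal_flag ?P dominated "\<lambda>lam kap. of_nat (pcoef n lam (cexp kap))"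
    "\<lambda>l. of_nat (zeta bip l)" v
  proof unfold_locales
    show "0 < rat_of_nat (zeta bip l)" if "l \<in> ?P" for l using zeta_pos[OF that] by simp
    show "partition_flag.lower n v m" if "m \<in> ?P" for m using that by (rule lower)
    show "\<exists>l\<in>?P. v m l \<noteq> 0" if "m \<in> ?P" for m using that by (rule nz)
    show "(\<Sum>l\<in>?P. of_nat (zeta bip l) * v m l * v k l) = 0" if "m \<in> ?P" "k \<in> ?P" "m \<noteq> k" for m k
      using that by (rule orth)
  qed
  have j: "j m = ip (v m) (v m)" for m by (simp add: j_def ip_def)
  show jpos: "j m > 0" if "m \<in> ?P" for m using ip_pos[OF that] by (simp add: j)
  have one: "one \<in> ?P" unfolding one_def by (rule replicate_in_partitions)
  have lamP: "lam \<in> ?P" using ctype_in_partitions[OF s t] lam by simp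
  have sb: "s \<in> matching_invols bip n" by (rule matching_invols_weaken[OF s])
  have "\<forall>l\<in>?P. \<exists>t. t \<in> matching_invols bip n \<and> ctype ?V s t = l" using ctype_surj[OF s] by blast
  from bchoice[OF this] obtain rep where rep: "\<And>l. l \<in> ?P \<Longrightarrow> rep l \<in> matching_invols bip n"
    "\<And>l. l \<in> ?P \<Longrightarrow> ctype ?V s (rep l) = l" by blast
  have num_middle_rep: "num_middle bip n s u k m = num_middle bip n s (rep (ctype ?V s u)) k m" if "u \<in> matching_invols bip n" for u k m
    using num_middle_cong[OF sb that rep(1)] rep(2) ctype_in_partitions[OF s that] by simp
  \<comment> \<open>The class sum of type \<open>mu\<close> in the power sum basis, computed at a
    representative of each type; \<open>num_middle_rep\<close> makes the representative
    immaterial.\<close>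
  define T where "T = (\<lambda>mu l k. of_nat (num_middle bip n s (rep l) k mu) :: rat)"
  obtain col where col:
    "\<And>mu m. m \<in> ?P \<Longrightarrow> partition_flag.lower n (\<lambda>m. alt_num_middle bip n s (col m) mu) m"
    "\<And>m. m \<in> ?P \<Longrightarrow> partition_flag.coef n (alt_num_middle bip n s (col m) one) m \<noteq> 0"
    using alternating_family[OF s, of bip] unfolding one_def by blast
  have num_middle_one: "num_middle bip n s u l one = (if ctype ?V s u = l then 1 else 0)" if u: "u \<in> matching_invols bip n" for u l
  proof -
    have "{w \<in> matching_invols bip n. ctype ?V s w = l \<and> ctype ?V w u = one} = (if ctype ?V s u = l then {u} else {})"
      using ctype_self_iff[OF _ u, of _ bip] u unfolding one_def by auto
    thus ?thesis by (simp add: num_middle_def)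
  qed
  \<comment> \<open>Antisymmetrised matchings are finite combinations of matchings, so
    \<open>T mu\<close> merely replaces the class 1^n by \<open>mu\<close> in them, and the
    triangularity of the result is already known.\<close>
  have FT: "(\<Sum>l\<in>?P. alt_num_middle bip n s c one l * T mu l k) = alt_num_middle bip n s c mu k" for c mu k
  proof -
    let ?C = "column_group n c" and ?u = "\<lambda>p. conj_by (twist p) s"
    have u: "?u p \<in> matching_invols bip n" if "p \<in> ?C" for p by (rule conj_twist_matching_invols[OF s that])
    have "(\<Sum>l\<in>?P. alt_num_middle bip n s c one l * T mu l k) =
        (\<Sum>p\<in>?C. \<Sum>l\<in>?P. of_int (sign p) * of_nat (num_middle bip n s (?u p) l one) * T mu l k)"
      unfolding alt_num_middle_def sum_distrib_right by (rule sum.swap)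
    also have "\<dots> = (\<Sum>p\<in>?C. of_int (sign p) * of_nat (num_middle bip n s (?u p) k mu))"
    proof (rule sum.cong[OF refl])
      fix p assume p: "p \<in> ?C"
      have "(\<Sum>l\<in>?P. of_int (sign p) * of_nat (num_middle bip n s (?u p) l one) * T mu l k) =
          (\<Sum>l\<in>?P. if l = ctype ?V s (?u p) then of_int (sign p) * T mu l k else 0)"
        by (rule sum.cong) (auto simp: num_middle_one[OF u[OF p]])
      also have "\<dots> = of_int (sign p) * T mu (ctype ?V s (?u p)) k"
        using finite_partitions ctype_in_partitions[OF s u[OF p]] by simp
      finally show "(\<Sum>l\<in>?P. of_int (sign p) * of_nat (num_middle bip n s (?u p) l one) * T mu l k) =
          of_int (sign p) * of_nat (num_middle bip n s (?u p) k mu)"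
        using num_middle_rep[OF u[OF p]] by (simp add: T_def)
    qed
    finally show ?thesis by (simp add: alt_num_middle_def)
  qed
  have adj: "of_nat (zeta bip k) * T mu l k = of_nat (zeta bip l) * T mu k l"
    if "l \<in> ?P" "k \<in> ?P" for mu l k
    using num_middle_swap[OF sb rep(1)[OF that(1)] rep(1)[OF that(2)] rep(2)[OF that(1)] rep(2)[OF that(2)], of mu]
    unfolding T_def by (metis of_nat_mult)
  have eigen: "\<exists>x. \<forall>k\<in>?P. (\<Sum>l\<in>?P. v m l * T mu l k) = x * v m k" if m: "m \<in> ?P" for m mu
  proof (rule eigenvector[OF adj _ _ _ m])
    show "partition_flag.lower n (\<lambda>m. alt_num_middle bip n s (col m) one) m" if "m \<in> ?P" for m
      by (rule col(1)[where mu = one, OF that])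
    show "partition_flag.coef n (alt_num_middle bip n s (col m) one) m \<noteq> 0" if "m \<in> ?P" for m
      using col(2)[OF that] .
    show "partition_flag.lower n (\<lambda>m k. \<Sum>l\<in>?P. alt_num_middle bip n s (col m) one l * T mu l k) m" if "m \<in> ?P" for m
      unfolding FT by (rule col(1)[where mu = mu, OF that])
  qed
  \<comment> \<open>The only matching of type 1^n relative to \<open>s\<close> is \<open>s\<close>
    itself, so the column of \<open>T mu\<close> at 1^n is the indicator of
    \<open>mu\<close>.\<close>
  have at_one: "(\<Sum>l\<in>?P. v m l * T mu l one) = v m mu" if mu: "mu \<in> ?P" for m mu
  proof -
    have "T mu l one = (if l = mu then 1 else 0)" if l: "l \<in> ?P" for l
    proof -
      have "w \<in> matching_invols bip n \<and> ctype ?V s w = one \<and> ctype ?V w (rep l) = mu \<longleftrightarrow> w = s \<and> l = mu" for w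
      proof (cases "w = s")
        case True
        thus ?thesis using ctype_self_iff[OF sb sb] rep(2)[OF l] sb by (simp add: one_def)
      next
        case False
        thus ?thesis using ctype_self_iff[OF sb, of w bip] by (auto simp: one_def)
      qed
      hence "{w \<in> matching_invols bip n. ctype ?V s w = one \<and> ctype ?V w (rep l) = mu} = (if l = mu then {s} else {})"
        by auto
      thus ?thesis by (simp add: T_def num_middle_def)
    qed
    hence "(\<Sum>l\<in>?P. v m l * T mu l one) = (\<Sum>l\<in>?P. if l = mu then v m mu else 0)"
      by (intro sum.cong) auto
    thus ?thesis using mu finite_partitions by simp
  qed
  \<comment> \<open>If this coefficient were 0, the eigenvalue equation read at 1^n would give v m
    mu = 0 for every \<open>mu\<close>.\<close>
  show v1: "v m one \<noteq> 0" if m: "m \<in> ?P" for m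
  proof
    assume 0: "v m one = 0"
    have "v m mu = 0" if mu: "mu \<in> ?P" for mu
    proof -
      obtain x where "\<And>k. k \<in> ?P \<Longrightarrow> (\<Sum>l\<in>?P. v m l * T mu l k) = x * v m k" using eigen[OF m] by blast
      from this[OF one] show ?thesis using at_one[OF mu] 0 by simp
    qed
    thus False using nz[OF m] by blast
  qed
  have char: "(\<Sum>l\<in>?P. v m l * T nu l mu) = v m mu * v m nu / v m one" if m: "m \<in> ?P" for m
  proof -
    obtain x where x: "\<And>k. k \<in> ?P \<Longrightarrow> (\<Sum>l\<in>?P. v m l * T nu l k) = x * v m k" using eigen[OF m] by blast
    have "x = v m nu / v m one" using x[OF one] at_one[OF nu] v1[OF m] by (simp add: field_simps)
    thus ?thesis using x[OF mu] by simp
  qed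
  \<comment> \<open>The product of two coefficients is unfolded into the action of
    \<open>T nu\<close>; completeness of \<open>v\<close> then collapses the sum to a single matrix
    entry.\<close>
  have "of_nat (zeta bip lam) * (\<Sum>m\<in>?P. v m lam * v m mu * v m nu / (j m * v m one)) =
      of_nat (zeta bip lam) * (\<Sum>m\<in>?P. v m lam / j m * (\<Sum>l\<in>?P. v m l * T nu l mu))"
    by (intro arg_cong2[of _ _ _ _ "(*)"] refl sum.cong) (simp add: char)
  also have "\<dots> = of_nat (zeta bip lam) * (\<Sum>m\<in>?P. \<Sum>l\<in>?P. T nu l mu * (v m l * v m lam / j m))"
    by (simp add: sum_distrib_left mult_ac)
  also have "\<dots> = of_nat (zeta bip lam) * (\<Sum>l\<in>?P. \<Sum>m\<in>?P. T nu l mu * (v m l * v m lam / j m))"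
    by (subst sum.swap) (rule refl)
  also have "\<dots> = (\<Sum>l\<in>?P. T nu l mu * (of_nat (zeta bip lam) * (\<Sum>m\<in>?P. v m l * v m lam / j m)))"
    by (simp add: sum_distrib_left mult_ac)
  also have "\<dots> = (\<Sum>l\<in>?P. if l = lam then T nu l mu else 0)"
    by (rule sum.cong) (use completeness[OF _ lamP] in \<open>simp_all add: j\<close>)
  also have "\<dots> = T nu lam mu" using lamP finite_partitions by simp
  also have "\<dots> = of_nat (num_middle bip n s t mu nu)" using num_middle_rep[OF t] lam by (simp add: T_def)
  finally show "of_nat (num_middle bip n s t mu nu) =
      of_nat (zeta bip lam) * (\<Sum>m\<in>partitions n. v m lam * v m mu * v m nu / (j m * v m one))" ..
qed

text \<open>At the chosen point \<alpha> is the base of the power in \<open>zeta bip\<close>, so the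
  scalar product evaluates to the form for which the class sums are self-adjoint. The outer pair is
  bipartite in both cases; only the middle matchings follow \<open>bip\<close>.\<close>

lemma jack_coeff_value:
  assumes J: "jack_family J"
    and s: "s \<in> matching_invols True n" and t: "t \<in> matching_invols True n" and lam: "ctype (vertices n) s t = lam"
    and mu: "mu \<in> partitions n" and nu: "nu \<in> partitions n"
  shows "has_value (jack_coeff J lam mu nu) (if bip then 0 else 1) (of_nat (num_middle bip n s t mu nu))"
proof -
  let ?P = "partitions n" and ?L = "\<lambda>m l. Poly_Mapping.lookup (J m) l"
  define x :: rat where "x = (if bip then 0 else 1)"
  define one where "one = replicate_mset n (1::nat)"
  have one: "one \<in> ?P" unfolding one_def by (rule replicate_in_partitions)
  have lamP: "lam \<in> ?P" using ctype_in_partitions[OF s t] lam by simp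
  have L1: "?L m one = 1" if "m \<in> ?P" for m unfolding one_def by (rule jack_unit_coeff[OF J that])
  have keys: "Poly_Mapping.keys (J m) \<subseteq> ?P" if "m \<in> ?P" for m using J that by (auto simp: jack_family_def)
  have "\<forall>m. \<exists>cp. m \<in> ?P \<longrightarrow> fst cp \<noteq> 0 \<and> (\<forall>l\<in>?P. fst cp * ?L m l = to_fract (snd cp l)) \<and>
      (\<exists>l\<in>?P. poly (snd cp l) x \<noteq> 0)"
  proof
    fix m show "\<exists>cp. m \<in> ?P \<longrightarrow> fst cp \<noteq> 0 \<and> (\<forall>l\<in>?P. fst cp * ?L m l = to_fract (snd cp l)) \<and>
      (\<exists>l\<in>?P. poly (snd cp l) x \<noteq> 0)"
    proof (cases "m \<in> ?P")
      case True
      have "?L m one \<noteq> 0" using L1[OF True] by simp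
      from regular_rescaling[of ?P one "?L m" x, OF finite_partitions one this]
      obtain c p where "c \<noteq> 0 \<and> (\<forall>l\<in>?P. c * ?L m l = to_fract (p l)) \<and> (\<exists>l\<in>?P. poly (p l) x \<noteq> 0)"
        by blast
      thus ?thesis by (intro exI[of _ "(c, p)"]) simp
    qed simp
  qed
  from choice[OF this] obtain cp where
    cp: "\<And>m. m \<in> ?P \<Longrightarrow> fst (cp m) \<noteq> 0"
      "\<And>m l. m \<in> ?P \<Longrightarrow> l \<in> ?P \<Longrightarrow> fst (cp m) * ?L m l = to_fract (snd (cp m) l)"
      "\<And>m. m \<in> ?P \<Longrightarrow> \<exists>l\<in>?P. poly (snd (cp m) l) x \<noteq> 0"
    by blast
  define p where "p = (\<lambda>m. snd (cp m))"
  define v where "v = (\<lambda>m l. poly (p m l) x)"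
  \<comment> \<open>The coefficient of p_1^n in each Jack polynomial is 1, so the rescaling factor
    reappears as the entry at 1^n.\<close>
  have p1: "fst (cp m) = to_fract (p m one)" if "m \<in> ?P" for m
    using cp(2)[OF that one] L1[OF that] by (simp add: p_def)
  have pL: "to_fract (p m one) * ?L m l = to_fract (p m l)" if "m \<in> ?P" "l \<in> ?P" for m l
    using cp(2)[OF that] p1[OF that(1)] by (simp add: p_def)
  have of_nat_fract': "of_nat k = to_fract (of_nat k)" for k
    by (metis of_nat_fract to_fract_def)
  have to_fract_sum: "(\<Sum>l\<in>A. to_fract (h l)) = to_fract (\<Sum>l\<in>A. h l)" for A and h :: "nat multiset \<Rightarrow> rat poly"
    by (induction A rule: infinite_finite_induct) auto
  have to_fract_power: "to_fract q ^ k = to_fract (q ^ k)" for q :: "rat poly" and k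
    by (induction k) auto
  have alpha: "alpha = to_fract [:1, 1:]"
    by (simp add: alpha_def b_par_def one_pCons flip: to_fract_1 to_fract_add)
  have zeta: "of_nat (zeta bip l) = of_nat (zee l) * (x + 1) ^ size l" for l
    by (simp add: zeta_def x_def)
  have lower: "partition_flag.lower n v m" if m: "m \<in> ?P" for m
    unfolding partition_flag.lower_def partition_flag.coef_def
  proof (intro ballI impI)
    fix k assume k: "k \<in> ?P" "\<not> dominated k m"
    have "(\<Sum>l\<in>?P. ?L m l * of_nat (pcoef n l (cexp k))) = 0"
      using jack_monomial_coeff[OF J m] k by (metis (no_types, lifting))
    hence "to_fract (p m one) * (\<Sum>l\<in>?P. ?L m l * of_nat (pcoef n l (cexp k))) = 0" by simp
    hence "(\<Sum>l\<in>?P. to_fract (p m l * of_nat (pcoef n l (cexp k)))) = 0"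
      by (simp add: sum_distrib_left pL[OF m] of_nat_fract' flip: mult.assoc)
    hence "to_fract (\<Sum>l\<in>?P. p m l * of_nat (pcoef n l (cexp k))) = 0" by (simp only: to_fract_sum)
    hence "(\<Sum>l\<in>?P. p m l * of_nat (pcoef n l (cexp k))) = 0" by (simp only: to_fract_eq_0_iff)
    from arg_cong[OF this, of "\<lambda>q. poly q x"]
    show "(\<Sum>l\<in>?P. v m l * of_nat (pcoef n l (cexp k))) = 0" by (simp add: poly_sum v_def)
  qed
  have orth: "(\<Sum>l\<in>?P. of_nat (zeta bip l) * v m l * v k l) = 0" if mk: "m \<in> ?P" "k \<in> ?P" "m \<noteq> k" for m k
  proof -
    have "scalar_prod (J m) (J k) = 0" using J mk unfolding jack_family_def by blast
    hence "(\<Sum>l\<in>?P. of_nat (zee l) * alpha ^ size l * ?L m l * ?L k l) = 0"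
      by (simp add: scalar_prod_partitions[OF keys[OF mk(1)] keys[OF mk(2)]])
    hence "to_fract (p m one) * to_fract (p k one) *
        (\<Sum>l\<in>?P. of_nat (zee l) * alpha ^ size l * ?L m l * ?L k l) = 0" by simp
    moreover have "to_fract (p m one) * to_fract (p k one) * (of_nat (zee l) * alpha ^ size l * ?L m l * ?L k l) =
        to_fract (of_nat (zee l) * [:1, 1:] ^ size l * p m l * p k l)" if l: "l \<in> ?P" for l
    proof -
      have "to_fract (p m one) * to_fract (p k one) * (of_nat (zee l) * alpha ^ size l * ?L m l * ?L k l) =
          of_nat (zee l) * alpha ^ size l * (to_fract (p m one) * ?L m l) * (to_fract (p k one) * ?L k l)"
        by (simp only: mult_ac)
      also have "\<dots> = to_fract (of_nat (zee l) * [:1, 1:] ^ size l * p m l * p k l)"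
        unfolding pL[OF mk(1) l] pL[OF mk(2) l] of_nat_fract' alpha to_fract_power by (simp only: to_fract_mult)
      finally show ?thesis .
    qed
    ultimately have "(\<Sum>l\<in>?P. to_fract (of_nat (zee l) * [:1, 1:] ^ size l * p m l * p k l)) = 0"
      by (simp add: sum_distrib_left)
    hence "(\<Sum>l\<in>?P. of_nat (zee l) * [:1, 1:] ^ size l * p m l * p k l) = 0"
      by (simp only: to_fract_sum to_fract_eq_0_iff)
    from arg_cong[OF this, of "\<lambda>q. poly q x"]
    show ?thesis by (simp add: poly_sum v_def zeta add.commute)
  qed
  have nz: "\<exists>l\<in>?P. v m l \<noteq> 0" if "m \<in> ?P" for m using cp(3)[OF that] by (simp add: v_def p_def)
  define j where "j m = (\<Sum>l\<in>?P. of_nat (zeta bip l) * v m l * v m l)" for m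
  note tf = num_middle_formula[where v = v, OF s matching_invols_weaken[OF t, of bip] lam mu nu, folded j_def one_def]
  have v1: "v m one \<noteq> 0" if "m \<in> ?P" for m
    by (rule tf(1)[OF _ _ _ that]) (fact lower, fact nz, fact orth)
  have jpos: "j m > 0" if "m \<in> ?P" for m
    by (rule tf(2)[OF _ _ _ that]) (fact lower, fact nz, fact orth)
  have formula: "of_nat (num_middle bip n s t mu nu) =
      of_nat (zeta bip lam) * (\<Sum>m\<in>?P. v m lam * v m mu * v m nu / (j m * v m one))"
    by (rule tf(3)) (fact lower, fact nz, fact orth)
  \<comment> \<open>Undoing the rescaling divides by the entry at 1^n; its nonvanishing at
    \<open>x\<close> is what excludes a pole.\<close>
  have L: "has_value (?L m l) x (v m l / v m one)" if ml: "m \<in> ?P" "l \<in> ?P" for m l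
  proof (rule has_valueI[of _ "p m l" "p m one"])
    have "to_fract (p m one) \<noteq> 0" using cp(1)[OF ml(1)] p1[OF ml(1)] by simp
    thus "?L m l = to_fract (p m l) / to_fract (p m one)" using pL[OF ml] by (metis nonzero_mult_div_cancel_left)
    show "poly (p m one) x \<noteq> 0" using v1[OF ml(1)] by (simp add: v_def)
  qed (simp add: v_def)
  have z: "has_value (of_nat (zee l) * alpha ^ size l) x (of_nat (zeta bip l))" for l
    unfolding zeta by (intro has_value_mult has_value_of_nat has_value_power has_value_alpha)
  have norm: "has_value (jack_norm J m) x (j m / (v m one * v m one))" if m: "m \<in> ?P" for m
  proof -
    have "has_value (jack_norm J m) x (\<Sum>l\<in>?P. of_nat (zeta bip l) * (v m l / v m one) * (v m l / v m one))"
      unfolding jack_norm_def scalar_prod_partitions[OF keys[OF m] keys[OF m]]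
      by (intro has_value_sum has_value_mult z L m)
    thus ?thesis by (simp add: j_def sum_divide_distrib)
  qed
  have one_val: "has_value 1 x 1" using has_value_of_nat[of 1 x] by simp
  have "has_value (of_nat (zee lam) * alpha ^ size lam * (\<Sum>m\<in>?P. 1 / jack_norm J m * ?L m lam * ?L m mu * ?L m nu)) x
      (of_nat (zeta bip lam) * (\<Sum>m\<in>?P. 1 / (j m / (v m one * v m one)) *
         (v m lam / v m one) * (v m mu / v m one) * (v m nu / v m one)))"
  proof (intro has_value_mult[OF z] has_value_sum)
    fix m assume m: "m \<in> ?P"
    have "j m / (v m one * v m one) \<noteq> 0" using jpos[OF m] v1[OF m] by simp
    thus "has_value (1 / jack_norm J m * ?L m lam * ?L m mu * ?L m nu) x
        (1 / (j m / (v m one * v m one)) * (v m lam / v m one) * (v m mu / v m one) * (v m nu / v m one))"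
      by (intro has_value_mult has_value_divide one_val norm L m lamP mu nu)
  qed
  moreover have "of_nat (zee lam) * alpha ^ size lam * (\<Sum>m\<in>?P. 1 / jack_norm J m * ?L m lam * ?L m mu * ?L m nu) =
      jack_coeff J lam mu nu"
    using jack_series_lookup[OF J lamP mu nu] lamP
    by (simp add: jack_coeff_def alpha_def add.commute partitions_def)
  moreover have "of_nat (zeta bip lam) * (\<Sum>m\<in>?P. 1 / (j m / (v m one * v m one)) *
         (v m lam / v m one) * (v m mu / v m one) * (v m nu / v m one)) = of_nat (num_middle bip n s t mu nu)"
    unfolding formula by (intro arg_cong2[of _ _ _ _ "(*)"] refl sum.cong) (use v1 in \<open>simp add: field_simps\<close>)
  ultimately show ?thesis by (simp add: x_def)
qed

theorem theorem5p3:
  fixes J :: "nat multiset \<Rightarrow> symfun"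
    and n :: nat
    and lam mu nu :: "nat multiset"
    and d1 d2 :: "vertex set set"
  assumes "jack_family J"
    and "n \<ge> 1"
    and "lam \<in> partitions n" and "mu \<in> partitions n" and "nu \<in> partitions n"
    and "bipartite_matching n d1" and "bipartite_matching n d2"
    and "coset_type n d1 d2 = lam"
  shows "has_value (jack_coeff J lam mu nu) 1 (of_nat (num_matchings n d1 d2 mu nu)) \<and>
         has_value (jack_coeff J lam mu nu) 0 (of_nat (num_bipartite_matchings n d1 d2 mu nu))"
proof -
  have "d1 \<in> edges n ` matching_invols True n" "d2 \<in> edges n ` matching_invols True n"
    using bij_edges[of n True] assms(6,7) unfolding bij_betw_def by auto
  then obtain s t where s: "s \<in> matching_invols True n" "d1 = edges n s" and t: "t \<in> matching_invols True n" "d2 = edges n t"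
    by blast
  have "ctype (vertices n) s t = lam" using coset_type_edges[OF s(1) t(1)] assms(8) s(2) t(2) by simp
  note val = jack_coeff_value[OF assms(1) s(1) t(1) this assms(4,5)]
  show ?thesis
    using val[of False] val[of True] card_matchings_eq_num_middle[OF s(1) t(1), of False]
      card_matchings_eq_num_middle[OF s(1) t(1), of True]
    by (simp add: num_matchings_def num_bipartite_matchings_def s(2) t(2))
qed

end
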